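(* There is a natural group isomorphism identifying the space of signatures $S$ (of rectifiable paths in $\mathbb{R}^n$) with $G^\infty(\mathbb{R}^n)$, where $(G^\infty(\mathbb{R}^n),d_\infty,1_\infty)$ is the inverse limit of the free nilpotent Lie groups $(G^k(\mathbb{R}^n),d_k,1_k)$, $k\ge 1$, with left invariant Carnot-Carathéodory metrics $d_k$. Further, the metric space $(G^\infty(\mathbb{R}^n),d_\infty)$ is a complete metric tree.
   Context: Here $n$ is a positive integer. Paths are continuous maps from compact intervals; a path is rectifiable if its length $L$ is finite; lengths in $\mathbb{R}^n$ are Euclidean. Tensor algebras: $T^k(\mathbb{R}^n)=\prod_{i=0}^k(\mathbb{R}^n)^{\otimes i}$ with coordinate projections $\xi_i:T^k(\mathbb{R}^n)\to(\mathbb{R}^n)^{\otimes i}$, $0\le i\le k$, and truncations $\pi^l_k:T^l(\mathbb{R}^n)\to T^k(\mathbb{R}^n)$ for $k\le l$ (forgetting the components of degree $>k$). The truncated tensor product is $g\otimes_k h=\sum_{0\le i+j\le k}\xi_i(g)\otimes\xi_j(h)$, with unit $1_k=(1,0,\dots,0)$. The infinite tensor algebra $T^\infty(\mathbb{R}^n)=\prod_{i=0}^\infty(\mathbb{R}^n)^{\otimes i}$ has the product $\otimes$ defined analogously without truncation, and unit $1=(1,0,0,\dots)$. Signatures: for a rectifiable path $\gamma:[a,b]\to\mathbb{R}^n$ the step $k$ signature is $$S_k(\gamma)_{a,b}=\Bigl(1,\int_{a<t<b}d\gamma_t,\dots,\int_{a<t_1<\cdots<t_k<b}d\gamma_{t_1}\otimes\cdots\otimes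 d\gamma_{t_k}\Bigr)\in T^k(\mathbb{R}^n)$$ (iterated Riemann-Stieltjes integrals). The (full) signature of $\gamma:[0,1]\to\mathbb{R}^n$ is the element of $T^\infty(\mathbb{R}^n)$ whose degree $i$ component, for every $i\ge 1$, is the $i$-th iterated integral of $\gamma$ over $[0,1]$, and whose degree $0$ component is $1$. $S$ is the set of signatures of all rectifiable paths $\gamma:[0,1]\to\mathbb{R}^n$; with the product $\otimes$ it is a group $(S,\otimes,1)$ (the product corresponds to concatenation of paths by Chen's theorem). Free nilpotent groups: $\mathfrak t^k(\mathbb{R}^n)=\{g\in T^k(\mathbb{R}^n):\xi_0(g)=0\}$ is a Lie algebra with bracket $[g,h]=g\otimes_k h-h\otimes_k g$; $\mathfrak g^k(\mathbb{R}^n)$ is its smallest Lie subalgebra containing $(\mathbb{R}^n)^{\otimes 1}$; and the free nilpotent Lie group of step $k$ over $\mathbb{R}^n$ is $G^k(\mathbb{R}^n)=\exp(\mathfrak g^k(\mathbb{R}^n))$, where $\exp(a)=1_k+\sum_{i=1}^k a^{\otimes i}/i!$ (powers with respect to $\otimes_k$). It is a group under $\otimes_k$, and equals $\{S_k(\gamma)_{0,1}:\gamma:[0,1]\to\mathbb{R}^n\text{ rectifiable}\}$. The Carnot-Carathéodory norm is $\|g\|=\inf\{L(\gamma):\gamma:[0,1]\to\mathbb{R}^n\text{ rectifiable},\ S_k(\gamma)_{0,1}=g\}$ and the Carnot-Carathéodory metric is $d_k(g,h)=\|g^{-1}\otimes_k h\|$. The truncations restrict to maps $\pi_{k+1}=\pi^{k+1}_k:G^{k+1}(\mathbb{R}^n)\to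 G^k(\mathbb{R}^n)$, which are 1-Lipschitz homomorphisms. Inverse limit: $G^\infty(\mathbb{R}^n)$ is the set of sequences $(x_k)_{k\ge1}\in\prod_{k\ge 1} G^k(\mathbb{R}^n)$ with $\pi_{k+1}(x_{k+1})=x_k$ for all $k\ge 1$ and $\sup_k d_k(1_k,x_k)<\infty$, with metric $d_\infty((x_k),(y_k))=\sup_k d_k(x_k,y_k)$, base point $1_\infty=(1_k)_k$, and componentwise group operations. A metric space is a geodesic space if any two points $x,y$ are joined by a path of length $d(x,y)$. An arc is a subset homeomorphic to $[0,1]$; a space is uniquely arcwise connected if any two different points are the end points of exactly one arc. A metric tree is a uniquely arcwise connected geodesic metric space. *)

theory Defs
  imports "HOL-Analysis.Analysis" "HOL-Algebra.Group"
begin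

section \<open>Rectifiable paths\<close>

text \<open>The length is taken with respect to an arbitrary distance function: it is applied both to
  the Euclidean distance and to the metric of an abstract metric space.\<close>

definition path_length ::
    "('a \<Rightarrow> 'a \<Rightarrow> real) \<Rightarrow> real \<Rightarrow> real \<Rightarrow> (real \<Rightarrow> 'a) \<Rightarrow> ennreal" where
  "path_length d a b \<gamma> =
     (SUP ts \<in> {ts. sorted ts \<and> set ts \<subseteq> {a..b}}.
        \<Sum>i<length ts - 1. ennreal (d (\<gamma> (ts ! i)) (\<gamma> (ts ! Suc i))))"

definition rectifiable :: "real \<Rightarrow> real \<Rightarrow> (real \<Rightarrow> real^'n) \<Rightarrow> bool" where
  "rectifiable a b \<gamma> \<longleftrightarrow> continuous_on {a..b} \<gamma> \<and> path_length dist a b \<gamma> < \<infinity>"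

section \<open>Tensor algebras\<close>

text \<open>A tensor of degree \<open>i\<close> over \<open>real^'n\<close> is given by its coordinates in the standard basis
  \<open>e j1 \<otimes> \<dots> \<otimes> e ji\<close>, which is indexed by the words \<open>[j1, \<dots>, ji]\<close> of length \<open>i\<close>
  over \<open>'n\<close>. An element of the infinite tensor algebra is thus an arbitrary function on words,
  its component of degree \<open>i\<close> being its restriction to the words of length \<open>i\<close>. The truncated
  tensor algebra of order \<open>k\<close> consists of the functions vanishing on words longer than \<open>k\<close>.\<close>

type_synonym 'n tensors = "'n list \<Rightarrow> real"

definition tensors_upto :: "nat \<Rightarrow> 'n tensors set" where
  "tensors_upto k = {g. \<forall>w. k < length w \<longrightarrow> g w = 0}"

definition tensors_of_degree :: "nat \<Rightarrow> 'n tensors set" where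
  "tensors_of_degree i = {g. \<forall>w. length w \<noteq> i \<longrightarrow> g w = 0}"

definition truncate :: "nat \<Rightarrow> 'n tensors \<Rightarrow> 'n tensors" where
  "truncate k g = (\<lambda>w. if length w \<le> k then g w else 0)"

text \<open>The product of the basis tensors of the words \<open>u\<close> and \<open>v\<close> is the one of \<open>u @ v\<close>, so the
  coefficient of a product at \<open>w\<close> is a sum over all ways to cut \<open>w\<close> in two.\<close>

definition tensor_mult :: "'n tensors \<Rightarrow> 'n tensors \<Rightarrow> 'n tensors" where
  "tensor_mult g h = (\<lambda>w. \<Sum>i\<le>length w. g (take i w) * h (drop i w))"

definition trunc_mult :: "nat \<Rightarrow> 'n tensors \<Rightarrow> 'n tensors \<Rightarrow> 'n tensors" where
  "trunc_mult k g h = truncate k (tensor_mult g h)"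

text \<open>The same function is the unit of every truncated algebra and of the infinite one.\<close>

definition tensor_one :: "'n tensors" where
  "tensor_one = (\<lambda>w. if w = [] then 1 else 0)"

section \<open>Signatures\<close>

text \<open>Classical Riemann-Stieltjes integral: limit over tagged partitions as the mesh tends
  to zero.\<close>

definition has_RS_integral ::
    "(real \<Rightarrow> real) \<Rightarrow> (real \<Rightarrow> real) \<Rightarrow> real \<Rightarrow> real \<Rightarrow> real \<Rightarrow> bool" where
  "has_RS_integral f g a b I \<longleftrightarrow>
     (\<forall>\<epsilon>>0. \<exists>\<delta>>0. \<forall>p. p tagged_division_of {a..b} \<and> (\<forall>(x, K)\<in>p. diameter K < \<delta>) \<longrightarrow>
        \<bar>(\<Sum>(x, K)\<in>p. f x * (g (Sup K) - g (Inf K))) - I\<bar> < \<epsilon>)"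

definition RS_integral :: "(real \<Rightarrow> real) \<Rightarrow> (real \<Rightarrow> real) \<Rightarrow> real \<Rightarrow> real \<Rightarrow> real" where
  "RS_integral f g a b = (THE I. has_RS_integral f g a b I)"

text \<open>\<open>iter_integral \<gamma> a [jk, \<dots>, j1] b\<close> is the integral of
  \<open>d\<gamma>\<^bsup>j1\<^esup>(t1) \<dots> d\<gamma>\<^bsup>jk\<^esup>(tk)\<close> over \<open>a < t1 < \<dots> < tk < b\<close>. The word is
  reversed: its head belongs to the outermost integration variable \<open>tk\<close>.\<close>

primrec iter_integral :: "(real \<Rightarrow> real^'n) \<Rightarrow> real \<Rightarrow> 'n list \<Rightarrow> real \<Rightarrow> real" where
  "iter_integral \<gamma> a [] b = 1"
| "iter_integral \<gamma> a (j # w) b = RS_integral (iter_integral \<gamma> a w) (\<lambda>t. \<gamma> t $ j) a b"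

definition step_signature :: "nat \<Rightarrow> real \<Rightarrow> real \<Rightarrow> (real \<Rightarrow> real^'n) \<Rightarrow> 'n tensors" where
  "step_signature k a b \<gamma> = (\<lambda>w. if length w \<le> k then iter_integral \<gamma> a (rev w) b else 0)"

definition signature :: "(real \<Rightarrow> real^'n) \<Rightarrow> 'n tensors" where
  "signature \<gamma> = (\<lambda>w. iter_integral \<gamma> 0 (rev w) 1)"

definition signature_group :: "'n::finite tensors monoid" where
  "signature_group =
     \<lparr>carrier = {signature \<gamma> | \<gamma> :: real \<Rightarrow> real^'n. rectifiable 0 1 \<gamma>},
      mult = tensor_mult, one = tensor_one\<rparr>"

section \<open>Free nilpotent groups\<close>

definition lie_bracket :: "nat \<Rightarrow> 'n tensors \<Rightarrow> 'n tensors \<Rightarrow> 'n tensors" where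
  "lie_bracket k g h = (\<lambda>w. trunc_mult k g h w - trunc_mult k h g w)"

definition lie_subalgebra :: "nat \<Rightarrow> 'n tensors set \<Rightarrow> bool" where
  "lie_subalgebra k V \<longleftrightarrow>
     V \<subseteq> {g \<in> tensors_upto k. g [] = 0} \<and>
     (\<lambda>w. 0) \<in> V \<and>
     (\<forall>g\<in>V. \<forall>h\<in>V. (\<lambda>w. g w + h w) \<in> V) \<and>
     (\<forall>c. \<forall>g\<in>V. (\<lambda>w. c * g w) \<in> V) \<and>
     (\<forall>g\<in>V. \<forall>h\<in>V. lie_bracket k g h \<in> V)"

text \<open>Only meaningful for \<open>k \<ge> 1\<close>; for \<open>k = 0\<close> the intersection is over the empty family.\<close>

definition free_nilpotent_algebra :: "nat \<Rightarrow> 'n tensors set" where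
  "free_nilpotent_algebra k = \<Inter>{V. lie_subalgebra k V \<and> tensors_of_degree 1 \<subseteq> V}"

definition tensor_exp :: "nat \<Rightarrow> 'n tensors \<Rightarrow> 'n tensors" where
  "tensor_exp k a =
     (\<lambda>w. tensor_one w + (\<Sum>i=1..k. (trunc_mult k a ^^ i) tensor_one w / fact i))"

definition free_nilpotent_group :: "nat \<Rightarrow> 'n tensors monoid" where
  "free_nilpotent_group k =
     \<lparr>carrier = tensor_exp k ` free_nilpotent_algebra k,
      mult = trunc_mult k, one = tensor_one\<rparr>"

definition cc_norm :: "nat \<Rightarrow> 'n::finite tensors \<Rightarrow> real" where
  "cc_norm k g =
     Inf {enn2real (path_length dist 0 1 \<gamma>) | \<gamma> :: real \<Rightarrow> real^'n.
            rectifiable 0 1 \<gamma> \<and> step_signature k 0 1 \<gamma> = g}"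

definition cc_dist :: "nat \<Rightarrow> 'n::finite tensors \<Rightarrow> 'n tensors \<Rightarrow> real" where
  "cc_dist k g h = cc_norm k (trunc_mult k (inv\<^bsub>free_nilpotent_group k\<^esub> g) h)"

section \<open>The inverse limit\<close>

definition inverse_limit_group :: "(nat \<Rightarrow> 'n::finite tensors) monoid" where
  "inverse_limit_group =
     \<lparr>carrier =
        {x \<in> (\<Pi>\<^sub>E k\<in>{1..}. carrier (free_nilpotent_group k)).
           (\<forall>k\<ge>1. truncate k (x (Suc k)) = x k) \<and>
           bdd_above ((\<lambda>k. cc_dist k tensor_one (x k)) ` {1..})},
      mult = (\<lambda>x y. \<lambda>k\<in>{1..}. trunc_mult k (x k) (y k)),
      one = (\<lambda>k\<in>{1..}. tensor_one)\<rparr>"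

text \<open>The locale \<open>Metric_space\<close> demands symmetry and nonnegativity also off the carrier; hence the
  value 0 there.\<close>

definition inverse_limit_dist ::
    "(nat \<Rightarrow> 'n::finite tensors) \<Rightarrow> (nat \<Rightarrow> 'n tensors) \<Rightarrow> real" where
  "inverse_limit_dist x y =
     (if x \<in> carrier inverse_limit_group \<and> y \<in> carrier inverse_limit_group
      then SUP k\<in>{1..}. cc_dist k (x k) (y k) else 0)"

text \<open>The natural map sends the signature of \<open>\<gamma>\<close> to the sequence of its step \<open>k\<close> signatures.\<close>

definition truncations :: "'n tensors \<Rightarrow> nat \<Rightarrow> 'n tensors" where
  "truncations s = (\<lambda>k\<in>{1..}. truncate k s)"

section \<open>Metric trees\<close>

definition geodesic_space :: "'a set \<Rightarrow> ('a \<Rightarrow> 'a \<Rightarrow> real) \<Rightarrow> bool" where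
  "geodesic_space M d \<longleftrightarrow>
     (\<forall>x\<in>M. \<forall>y\<in>M. \<exists>a b \<gamma>. a \<le> b \<and>
        continuous_map (top_of_set {a..b}) (Metric_space.mtopology M d) \<gamma> \<and>
        \<gamma> a = x \<and> \<gamma> b = y \<and> path_length d a b \<gamma> = ennreal (d x y))"

definition arc_with_ends :: "'a topology \<Rightarrow> 'a \<Rightarrow> 'a \<Rightarrow> 'a set \<Rightarrow> bool" where
  "arc_with_ends X x y A \<longleftrightarrow>
     A \<subseteq> topspace X \<and>
     (\<exists>f. homeomorphic_map (top_of_set {0..1::real}) (subtopology X A) f \<and> f 0 = x \<and> f 1 = y)"

definition uniquely_arcwise_connected :: "'a topology \<Rightarrow> bool" where
  "uniquely_arcwise_connected X \<longleftrightarrow>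
     (\<forall>x\<in>topspace X. \<forall>y\<in>topspace X. x \<noteq> y \<longrightarrow> (\<exists>!A. arc_with_ends X x y A))"

definition metric_tree :: "'a set \<Rightarrow> ('a \<Rightarrow> 'a \<Rightarrow> real) \<Rightarrow> bool" where
  "metric_tree M d \<longleftrightarrow>
     Metric_space M d \<and> geodesic_space M d \<and>
     uniquely_arcwise_connected (Metric_space.mtopology M d)"

end

theory Submission
  imports Defs
begin

text \<open>
  Everything takes place in the group \<open>U\<close> of tensor series with constant term \<open>1\<close>. Bounding the
  coefficient at a word of length \<open>n\<close> by \<open>r ^ n / n!\<close> (\<open>small\<close>) defines a left invariant metric on
  \<open>U\<close>, and a curve that is 1-Lipschitz for it is automatically horizontal: the bounds leave only the
  degree one part free to first order, so the coefficients of the curve are the iterated integrals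
  of that part (\<open>curve_primitive\<close>). Signatures of paths of length at most \<open>L\<close> are thus the end points
  of such curves of length \<open>L\<close> starting at \<open>1\<close> (\<open>reach\<close>, \<open>rectifiable_reach\<close>, \<open>reach_rectifiable\<close>).
  Chen's theorem becomes the joining of curves, and the space of curves is compact by Tychonoff's
  theorem (\<open>curve_cluster\<close>), which lets one pass to limits of signatures without losing length
  (\<open>reach_closed\<close>).

  That \<open>exp\<close> of the free nilpotent Lie algebra consists of the truncated signatures is proved through
  the logarithmic derivative \<open>E\<inverse> * degree_der E\<close>, where \<open>degree_der\<close> multiplies degree \<open>n\<close> by \<open>n\<close>.
  Up to terms of high degree, it is a Lie series exactly if \<open>E\<close> is the exponential of one. This holds
  for polygons, hence for all signatures, and conversely such an \<open>E\<close> is, again up to high degree, a product of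
  signatures whose leading terms remove its components one degree after the other. With this, an element
  of the inverse limit is a sequence of truncations of signatures of bounded length, and
  compactness yields one signature above all of them (\<open>limit_signature\<close>). The same compactness gives
  shortest paths and completeness; the metric is the length of the shortest path with signature
  \<open>X\<inverse> * Y\<close>.

  The tree property rests on the following argument (\<open>curve_image_subset\<close>). Let two curves of signatures
  have the same end points. By the shuffle product the coordinate functions span an algebra, and
  the integral of a coordinate along a curve against \<open>d\<gamma>\<^bsub>j\<^esub>\<close> is again a coordinate of the end point.
  So the two curves give the same integrals for all functions in this algebra, and by the
  Stone-Weierstrass theorem for all continuous functions. If an injective curve visited a point off
  the other one, then bump functions near this point would show that its underlying path is
  constant there, against injectivity. Hence a geodesic lies in the image of every rectifiable
  curve with the same end points, by approximation in the image of every continuous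
  path (\<open>geodesic_subset_path\<close>), and so it is the only arc between its end points.
\<close>

section \<open>The ring of tensor series\<close>

lemma tensor_mult_Nil [simp]: "tensor_mult g h [] = g [] * h []"
  by (simp add: tensor_mult_def)

text \<open>Splitting off the first letter turns the convolution into a recursion on words, so that
  associativity needs no exchange of double sums.\<close>

lemma tensor_mult_Cons:
  "tensor_mult g h (a # w) = g [] * h (a # w) + tensor_mult (\<lambda>u. g (a # u)) h w"
  unfolding tensor_mult_def by (simp add: sum.atMost_Suc_shift del: sum.atMost_Suc)

lemma tensor_mult_add_left:
  "tensor_mult (\<lambda>w. g w + g' w) h w = tensor_mult g h w + tensor_mult g' h w"
  by (simp add: tensor_mult_def distrib_right sum.distrib)

lemma tensor_mult_add_right:
  "tensor_mult g (\<lambda>w. h w + h' w) w = tensor_mult g h w + tensor_mult g h' w"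
  by (simp add: tensor_mult_def distrib_left sum.distrib)

lemma tensor_mult_scale_left: "tensor_mult (\<lambda>w. c * g w) h w = c * tensor_mult g h w"
  by (simp add: tensor_mult_def sum_distrib_left mult.assoc)

lemma tensor_mult_scale_right: "tensor_mult g (\<lambda>w. c * h w) w = c * tensor_mult g h w"
  by (simp add: tensor_mult_def sum_distrib_left mult.left_commute)

lemma tensor_mult_assoc: "tensor_mult (tensor_mult f g) h = tensor_mult f (tensor_mult g h)"
proof
  fix w show "tensor_mult (tensor_mult f g) h w = tensor_mult f (tensor_mult g h) w"
    by (induction w arbitrary: f)
      (simp_all add: tensor_mult_Cons tensor_mult_add_left tensor_mult_scale_left algebra_simps)
qed

lemma tensor_mult_one_left: "tensor_mult tensor_one g = g"
proof
  fix w :: "'a list"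
  have "tensor_mult (\<lambda>u. 0) g v = 0" for v by (simp add: tensor_mult_def)
  then show "tensor_mult tensor_one g w = g w"
    by (cases w) (simp_all add: tensor_mult_Cons tensor_one_def)
qed

lemma tensor_mult_one_right: "tensor_mult g tensor_one = g"
proof
  fix w show "tensor_mult g tensor_one w = g w"
    by (induction w arbitrary: g) (simp_all add: tensor_mult_Cons, simp_all add: tensor_one_def)
qed

text \<open>A type of its own for the tensors makes the tensor product the multiplication of a real algebra;
  on functions that symbol would be pointwise.\<close>

typedef 'n series = "UNIV :: 'n tensors set" morphisms cf Series ..

setup_lifting type_definition_series

declare Series_inverse [simplified, simp] cf_inverse [simp]

lemma series_eqI: "(\<And>w. cf X w = cf Y w) \<Longrightarrow> X = Y"
  by (metis cf_inverse ext)

instantiation series :: (type) real_algebra_1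
begin

lift_definition zero_series :: "'a series" is "\<lambda>w. 0" .
lift_definition one_series :: "'a series" is tensor_one .
lift_definition plus_series :: "'a series \<Rightarrow> 'a series \<Rightarrow> 'a series" is "\<lambda>g h w. g w + h w" .
lift_definition minus_series :: "'a series \<Rightarrow> 'a series \<Rightarrow> 'a series" is "\<lambda>g h w. g w - h w" .
lift_definition uminus_series :: "'a series \<Rightarrow> 'a series" is "\<lambda>g w. - g w" .
lift_definition times_series :: "'a series \<Rightarrow> 'a series \<Rightarrow> 'a series" is tensor_mult .
lift_definition scaleR_series :: "real \<Rightarrow> 'a series \<Rightarrow> 'a series" is "\<lambda>c g w. c * g w" .

instance
proof
  show "(0::'a series) \<noteq> 1"
    by transfer (auto simp: tensor_one_def fun_eq_iff)
qed (transfer; auto simp: fun_eq_iff tensor_mult_assoc tensor_mult_one_left tensor_mult_one_right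
      tensor_mult_add_left tensor_mult_add_right tensor_mult_scale_left tensor_mult_scale_right
      algebra_simps)+

end

lemma cf_zero [simp]: "cf 0 w = 0" by transfer simp
lemma cf_one: "cf 1 = tensor_one" by transfer simp
lemma cf_one_Nil [simp]: "cf 1 [] = 1" by (simp add: cf_one tensor_one_def)
lemma cf_one_nonempty [simp]: "w \<noteq> [] \<Longrightarrow> cf 1 w = 0" by (simp add: cf_one tensor_one_def)
lemma cf_add [simp]: "cf (X + Y) w = cf X w + cf Y w" by transfer simp
lemma cf_diff [simp]: "cf (X - Y) w = cf X w - cf Y w" by transfer simp
lemma cf_uminus [simp]: "cf (- X) w = - cf X w" by transfer simp
lemma cf_scaleR [simp]: "cf (c *\<^sub>R X) w = c * cf X w" by transfer simp
lemma cf_mult: "cf (X * Y) = tensor_mult (cf X) (cf Y)" by transfer simp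
lemma cf_mult_sum: "cf (X * Y) w = (\<Sum>i\<le>length w. cf X (take i w) * cf Y (drop i w))"
  by (simp add: cf_mult tensor_mult_def)
lemma cf_mult_Nil [simp]: "cf (X * Y) [] = cf X [] * cf Y []"
  by (simp add: cf_mult)
lemma cf_sum [simp]: "cf (sum f A) w = (\<Sum>i\<in>A. cf (f i) w)"
  by (induction A rule: infinite_finite_induct) auto

lemma cf_mult_singleton: "cf (X * Y) [j] = cf X [] * cf Y [j] + cf X [j] * cf Y []"
  by (simp add: cf_mult tensor_mult_Cons)

text \<open>Congruence modulo the components of degree above \<open>k\<close> reads \<open>order_ge (Suc k) (X - Y)\<close>; calculations
  in the truncated algebra of order \<open>k\<close> are carried out as such congruences.\<close>

definition order_ge :: "nat \<Rightarrow> 'n series \<Rightarrow> bool" where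
  "order_ge m X \<longleftrightarrow> (\<forall>w. length w < m \<longrightarrow> cf X w = 0)"

lemma order_geD: "order_ge m X \<Longrightarrow> length w < m \<Longrightarrow> cf X w = 0"
  by (simp add: order_ge_def)

lemma order_ge_0 [simp]: "order_ge 0 X"
  by (simp add: order_ge_def)

lemma order_ge_zero [simp]: "order_ge m 0"
  by (simp add: order_ge_def)

lemma order_ge_1_iff: "order_ge (Suc 0) X \<longleftrightarrow> cf X [] = 0"
  by (auto simp: order_ge_def)

lemma order_ge_mono: "order_ge m X \<Longrightarrow> n \<le> m \<Longrightarrow> order_ge n X"
  by (auto simp: order_ge_def)

lemma order_ge_add: "order_ge m X \<Longrightarrow> order_ge m Y \<Longrightarrow> order_ge m (X + Y)"
  by (auto simp: order_ge_def)

lemma order_ge_diff: "order_ge m X \<Longrightarrow> order_ge m Y \<Longrightarrow> order_ge m (X - Y)"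
  by (auto simp: order_ge_def)

lemma order_ge_uminus: "order_ge m X \<Longrightarrow> order_ge m (- X)"
  by (auto simp: order_ge_def)

lemma order_ge_scaleR: "order_ge m X \<Longrightarrow> order_ge m (c *\<^sub>R X)"
  by (auto simp: order_ge_def)

lemma order_ge_sum: "(\<And>i. i \<in> A \<Longrightarrow> order_ge m (f i)) \<Longrightarrow> order_ge m (sum f A)"
  by (auto simp: order_ge_def)

lemma order_ge_mult:
  assumes "order_ge m X" "order_ge n Y"
  shows "order_ge (m + n) (X * Y)"
  unfolding order_ge_def
proof (intro allI impI)
  fix w :: "'a list" assume w: "length w < m + n"
  show "cf (X * Y) w = 0" unfolding cf_mult_sum
  proof (rule sum.neutral, rule ballI)
    fix i assume "i \<in> {..length w}"
    then have "length (take i w) < m \<or> length (drop i w) < n" using w by auto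
    then show "cf X (take i w) * cf Y (drop i w) = 0"
      using assms by (auto simp: order_ge_def simp del: length_take length_drop)
  qed
qed

lemma order_ge_mult_left: "order_ge m X \<Longrightarrow> order_ge m (X * Y)"
  using order_ge_mult[of m X 0 Y] by simp

lemma order_ge_mult_right: "order_ge m Y \<Longrightarrow> order_ge m (X * Y)"
  using order_ge_mult[of 0 X m Y] by simp

lemma order_ge_power: "order_ge (Suc 0) X \<Longrightarrow> order_ge n (X ^ n)"
proof (induction n)
  case (Suc n)
  then show ?case using order_ge_mult[of "Suc 0" X n "X ^ n"] by simp
qed simp

lemma order_ge_trans: "order_ge m (X - Y) \<Longrightarrow> order_ge m (Y - Z) \<Longrightarrow> order_ge m (X - Z)"
  using order_ge_add[of m "X - Y" "Y - Z"] by simp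

lemma order_ge_sym: "order_ge m (X - Y) \<Longrightarrow> order_ge m (Y - X)"
  using order_ge_uminus[of m "X - Y"] by simp

section \<open>Unipotent series: inverses and exponentials\<close>

definition unip :: "'n series \<Rightarrow> bool" where
  "unip X \<longleftrightarrow> cf X [] = 1"

lemma unip_one [simp]: "unip 1"
  by (simp add: unip_def)

lemma unip_mult: "unip X \<Longrightarrow> unip Y \<Longrightarrow> unip (X * Y)"
  by (simp add: unip_def)

text \<open>The geometric series of \<open>1 - X\<close>. For unipotent \<open>X\<close> its \<open>n\<close>-th power starts in degree \<open>n\<close>, so cutting
  the sum off at the length of the word loses nothing; the same applies to \<open>exp_series\<close> below when
  the constant term of the argument vanishes.\<close>

definition tinv :: "'n series \<Rightarrow> 'n series" where
  "tinv X = Series (\<lambda>w. \<Sum>n\<le>length w. cf ((1 - X) ^ n) w)"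

lemma tinv_cong_geometric:
  assumes "unip X"
  shows "order_ge (Suc N) (tinv X - (\<Sum>n\<le>N. (1 - X) ^ n))"
  unfolding order_ge_def
proof (intro allI impI)
  fix w :: "'a list" assume w: "length w < Suc N"
  have "order_ge (Suc 0) (1 - X)" using assms by (simp add: unip_def order_ge_1_iff)
  then have "cf ((1 - X) ^ n) w = 0" if "n > length w" for n
    using order_ge_power that order_geD by blast
  then have "(\<Sum>n\<le>N. cf ((1 - X) ^ n) w) = (\<Sum>n\<le>length w. cf ((1 - X) ^ n) w)"
    using w by (intro sum.mono_neutral_right) auto
  then show "cf (tinv X - (\<Sum>n\<le>N. (1 - X) ^ n)) w = 0"
    by (simp add: tinv_def)
qed

lemma series_eq_if_cong: "(\<And>N. order_ge (Suc N) (X - Y)) \<Longrightarrow> X = Y"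
  by (rule series_eqI) (metis cf_diff eq_iff_diff_eq_0 lessI order_geD)

lemma mult_tinv [simp]:
  assumes "unip X" shows "X * tinv X = 1" and "tinv X * X = 1"
proof -
  define Z where "Z = 1 - X"
  have X: "X = 1 - Z" by (simp add: Z_def)
  have Z: "order_ge (Suc N) (Z ^ Suc N)" for N
    using assms by (intro order_ge_power) (simp add: Z_def unip_def order_ge_1_iff)
  have l: "(1 - Z) * (\<Sum>n\<le>N. Z ^ n) = 1 - Z ^ Suc N" for N
  proof (induction N)
    case (Suc N)
    then show ?case unfolding sum.atMost_Suc distrib_left by (simp add: left_diff_distrib)
  qed simp
  have r: "(\<Sum>n\<le>N. Z ^ n) * (1 - Z) = 1 - Z ^ Suc N" for N
  proof (induction N)
    case (Suc N)
    then show ?case unfolding sum.atMost_Suc distrib_right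
      by (simp add: right_diff_distrib power_commutes mult.assoc)
  qed simp
  note g = tinv_cong_geometric[OF assms, folded Z_def]
  show "X * tinv X = 1"
  proof (rule series_eq_if_cong)
    fix N
    have "X * tinv X - 1 = X * (tinv X - (\<Sum>n\<le>N. Z ^ n)) - Z ^ Suc N"
      using l[of N] unfolding X by (simp add: algebra_simps)
    then show "order_ge (Suc N) (X * tinv X - 1)"
      using Z g by (simp add: order_ge_diff order_ge_mult_right del: power_Suc)
  qed
  show "tinv X * X = 1"
  proof (rule series_eq_if_cong)
    fix N
    have "tinv X * X - 1 = (tinv X - (\<Sum>n\<le>N. Z ^ n)) * X - Z ^ Suc N"
      using r[of N] unfolding X by (simp add: algebra_simps)
    then show "order_ge (Suc N) (tinv X * X - 1)"
      using Z g by (simp add: order_ge_diff order_ge_mult_left del: power_Suc)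
  qed
qed

lemma mult_tinv_assoc [simp]:
  assumes "unip X" shows "X * (tinv X * Y) = Y" and "tinv X * (X * Y) = Y"
  using assms by (simp_all flip: mult.assoc)

lemma unip_tinv [simp]: "unip X \<Longrightarrow> unip (tinv X)"
  using cf_mult_Nil[of X "tinv X"] by (simp add: unip_def)

lemma tinv_unique: "X * Y = 1 \<Longrightarrow> unip X \<Longrightarrow> tinv X = Y"
  by (metis mult_tinv_assoc(2) mult.right_neutral)

lemma tinv_one [simp]: "tinv 1 = 1"
  by (rule tinv_unique) auto

lemma tinv_tinv [simp]: "unip X \<Longrightarrow> tinv (tinv X) = X"
  by (rule tinv_unique) auto

lemma tinv_mult: "unip X \<Longrightarrow> unip Y \<Longrightarrow> tinv (X * Y) = tinv Y * tinv X"
  by (rule tinv_unique) (auto simp: unip_mult mult.assoc)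

lemma order_ge_tinv_cong:
  assumes "unip X" "unip Y" "order_ge m (X - Y)"
  shows "order_ge m (tinv X - tinv Y)"
proof -
  have "tinv X * (X - Y) * tinv Y = tinv Y - tinv X"
    using assms by (simp add: algebra_simps)
  then show ?thesis
    using assms(3) by (metis order_ge_mult_left order_ge_mult_right order_ge_sym)
qed

lemma cf_tinv_singleton: "unip X \<Longrightarrow> cf (tinv X) [j] = - cf X [j]"
  using cf_mult_singleton[of X "tinv X" j] unip_tinv[of X]
  by (simp add: unip_def)

definition exp_series :: "'n series \<Rightarrow> 'n series" where
  "exp_series a = Series (\<lambda>w. \<Sum>n\<le>length w. cf (a ^ n) w / fact n)"

lemma exp_series_cong:
  assumes "order_ge (Suc 0) a"
  shows "order_ge (Suc N) (exp_series a - (\<Sum>n\<le>N. (1 / fact n) *\<^sub>R a ^ n))"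
  unfolding order_ge_def
proof (intro allI impI)
  fix w :: "'a list" assume w: "length w < Suc N"
  have "cf (a ^ n) w = 0" if "n > length w" for n
    using order_ge_power[OF assms] that order_geD by blast
  then have "(\<Sum>n\<le>N. cf (a ^ n) w / fact n) = (\<Sum>n\<le>length w. cf (a ^ n) w / fact n)"
    using w by (intro sum.mono_neutral_right) auto
  then show "cf (exp_series a - (\<Sum>n\<le>N. (1 / fact n) *\<^sub>R a ^ n)) w = 0"
    by (simp add: exp_series_def)
qed

lemma unip_exp_series [simp]: "unip (exp_series a)"
  by (simp add: unip_def exp_series_def)

subsection \<open>Exponentials of vectors\<close>

definition vec_series :: "real^'n \<Rightarrow> 'n series" where
  "vec_series v = Series (\<lambda>w. if length w = 1 then v $ hd w else 0)"

text \<open>The signature of the segment from \<open>0\<close> to \<open>v\<close>, which is the exponential of \<open>v\<close> (\<open>exp_series_vec\<close>).\<close>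

definition exp_vec :: "real^'n \<Rightarrow> 'n series" where
  "exp_vec v = Series (\<lambda>w. (\<Prod>j\<leftarrow>w. v $ j) / fact (length w))"

lemma cf_vec_series_mult:
  "cf (vec_series v * X) w = (case w of [] \<Rightarrow> 0 | j # u \<Rightarrow> v $ j * cf X u)"
proof (cases w)
  case (Cons j u)
  have *: "tensor_mult (\<lambda>x. if x = [] then c else 0) h u = c * h u" for c and h :: "'a tensors"
    using tensor_mult_one_left[of h] tensor_mult_scale_left[of c tensor_one h u]
    by (simp add: tensor_one_def if_distrib cong: if_cong)
  have "(\<lambda>x. cf (vec_series v) (j # x)) = (\<lambda>x. if x = [] then v $ j else 0)"
    by (auto simp: vec_series_def fun_eq_iff)
  then show ?thesis using Cons *[of "v $ j"]
    by (simp add: cf_mult tensor_mult_Cons) (simp add: vec_series_def)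
qed (simp add: cf_mult vec_series_def)

lemma cf_vec_series_power:
  "cf (vec_series v ^ n) w = (if length w = n then (\<Prod>j\<leftarrow>w. v $ j) else 0)"
  by (induction n arbitrary: w)
    (auto simp: cf_one tensor_one_def cf_vec_series_mult split: list.split)

lemma exp_series_vec: "exp_series (vec_series v) = exp_vec v"
proof (rule series_eqI)
  fix w :: "'a list"
  have "cf (vec_series v ^ n) w / fact n
      = (if n = length w then (\<Prod>j\<leftarrow>w. v $ j) / fact (length w) else 0)" for n
    by (simp add: cf_vec_series_power)
  then show "cf (exp_series (vec_series v)) w = cf (exp_vec v) w"
    by (simp add: exp_series_def exp_vec_def)
qed

lemma unip_exp_vec [simp]: "unip (exp_vec v)"
  by (simp add: unip_def exp_vec_def)

lemma cf_exp_vec_singleton [simp]: "cf (exp_vec v) [j] = v $ j"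
  by (simp add: exp_vec_def)

lemma cf_exp_vec_scale: "cf (exp_vec (s *\<^sub>R v)) w = s ^ length w * cf (exp_vec v) w"
proof -
  have "(\<Prod>j\<leftarrow>w. s * v $ j) = s ^ length w * (\<Prod>j\<leftarrow>w. v $ j)"
    by (induction w) auto
  then show ?thesis by (simp add: exp_vec_def)
qed

lemma binomial_fact_sum:
  "(\<Sum>i\<le>n. (s ^ i / fact i) * (t ^ (n - i) / fact (n - i))) = (s + t) ^ n / (fact n :: real)"
proof -
  have "real (n choose i) / fact n = 1 / (fact i * fact (n - i))" if "i \<le> n" for i
    using binomial_fact[OF that, where 'a = real] by (simp add: field_simps)
  then have "(\<Sum>i\<le>n. (s ^ i / fact i) * (t ^ (n - i) / fact (n - i)))
      = (\<Sum>i\<le>n. real (n choose i) * s ^ i * t ^ (n - i)) / fact n"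
    by (auto simp: sum_divide_distrib field_simps intro!: sum.cong)
  then show ?thesis by (simp add: binomial_ring)
qed

lemma exp_vec_add: "exp_vec (s *\<^sub>R v) * exp_vec (t *\<^sub>R v) = exp_vec ((s + t) *\<^sub>R v)"
proof (rule series_eqI)
  fix w :: "'a list"
  let ?n = "length w" and ?p = "\<Prod>j\<leftarrow>w. v $ j"
  have p: "(\<Prod>j\<leftarrow>take i w. v $ j) * (\<Prod>j\<leftarrow>drop i w. v $ j) = ?p" for i
    by (metis append_take_drop_id map_append prod_list.append)
  have "cf (exp_vec (s *\<^sub>R v) * exp_vec (t *\<^sub>R v)) w
      = (\<Sum>i\<le>?n. (s ^ i / fact i) * (t ^ (?n - i) / fact (?n - i)) * ?p)"
    unfolding cf_mult_sum cf_exp_vec_scale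
  proof (intro sum.cong refl)
    fix i assume "i \<in> {..?n}"
    then show "s ^ length (take i w) * cf (exp_vec v) (take i w)
        * (t ^ length (drop i w) * cf (exp_vec v) (drop i w))
      = (s ^ i / fact i) * (t ^ (?n - i) / fact (?n - i)) * ?p"
      unfolding p[of i, symmetric] by (simp add: exp_vec_def min_absorb2)
  qed
  also have "\<dots> = (s + t) ^ ?n / fact ?n * ?p"
    unfolding sum_distrib_right[symmetric] binomial_fact_sum ..
  finally show "cf (exp_vec (s *\<^sub>R v) * exp_vec (t *\<^sub>R v)) w = cf (exp_vec ((s + t) *\<^sub>R v)) w"
    unfolding cf_exp_vec_scale by (simp add: exp_vec_def)
qed

lemma exp_vec_0 [simp]: "exp_vec 0 = 1"
proof (rule series_eqI)
  fix w :: "'a list" show "cf (exp_vec 0) w = cf 1 w"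
    by (cases w) (auto simp: exp_vec_def)
qed

lemma tinv_exp_vec: "tinv (exp_vec v) = exp_vec (- v)"
proof (rule tinv_unique)
  show "exp_vec v * exp_vec (- v) = 1"
    using exp_vec_add[of 1 v "-1"] by simp
qed simp

subsection \<open>Dilations\<close>

text \<open>The automorphism induced by the homothety of ratio \<open>s\<close>: it scales paths by \<open>s\<close>.\<close>

definition dil :: "real \<Rightarrow> 'n series \<Rightarrow> 'n series" where
  "dil s X = Series (\<lambda>w. s ^ length w * cf X w)"

lemma cf_dil [simp]: "cf (dil s X) w = s ^ length w * cf X w"
  by (simp add: dil_def)

lemma dil_mult: "dil s (X * Y) = dil s X * dil s Y"
proof (rule series_eqI)
  fix w :: "'a list"
  have "s ^ length w = s ^ i * s ^ (length w - i)" if "i \<le> length w" for i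
    using that by (simp flip: power_add)
  then show "cf (dil s (X * Y)) w = cf (dil s X * dil s Y) w"
    by (auto simp: cf_mult_sum sum_distrib_left min_absorb2 intro!: sum.cong)
qed

lemma dil_one [simp]: "dil s 1 = 1"
  by (rule series_eqI) (auto simp: cf_one tensor_one_def)

lemma unip_dil [simp]: "unip (dil s X) = unip X"
  by (simp add: unip_def)

lemma tinv_dil: "unip X \<Longrightarrow> tinv (dil s X) = dil s (tinv X)"
  by (rule tinv_unique) (simp_all flip: dil_mult)

section \<open>Unit-speed curves of unipotent series\<close>

text \<open>These are the bounds that the signature of a path of length \<open>r\<close> satisfies. Because of the factorials
  the binomial theorem makes \<open>r\<close> subadditive under products, and as the inverse is bounded as
  well the notion is symmetric. So \<open>small r (tinv X * Y)\<close> says that \<open>X\<close> and \<open>Y\<close> are at distance at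
  most \<open>r\<close> for a left invariant metric. The Euclidean norm in degree one is what finally ties \<open>r\<close> to the
  length of paths.\<close>

definition small :: "real \<Rightarrow> 'n::finite series \<Rightarrow> bool" where
  "small r X \<longleftrightarrow> unip X \<and> norm (\<chi> j. cf X [j]) \<le> r \<and>
     (\<forall>w. \<bar>cf X w\<bar> \<le> r ^ length w / fact (length w)) \<and>
     (\<forall>w. \<bar>cf (tinv X) w\<bar> \<le> r ^ length w / fact (length w))"

lemma small_nonneg: "small r X \<Longrightarrow> 0 \<le> r"
  using norm_ge_zero order_trans unfolding small_def by blast

lemma small_unip: "small r X \<Longrightarrow> unip X"
  by (simp add: small_def)

lemma small_cf: "small r X \<Longrightarrow> \<bar>cf X w\<bar> \<le> r ^ length w / fact (length w)"
  by (simp add: small_def)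

lemma small_one: "0 \<le> r \<Longrightarrow> small r 1"
  by (auto simp: small_def cf_one tensor_one_def zero_vec_def[symmetric])

lemma small_mono: "small r X \<Longrightarrow> r \<le> r' \<Longrightarrow> small r' X"
  using small_nonneg[of r X] unfolding small_def
  by (meson divide_right_mono fact_ge_zero order_trans power_mono)

lemma small_tinv: "small r X \<Longrightarrow> small r (tinv X)"
proof -
  assume X: "small r X"
  have "norm (\<chi> j. cf (tinv X) [j]) = norm (- (\<chi> j. cf X [j]))"
    using X by (intro arg_cong[where f = norm]) (simp add: vec_eq_iff cf_tinv_singleton small_unip)
  then show ?thesis using X by (auto simp: small_def)
qed

lemma small_mult_bound:
  assumes X: "\<And>w. \<bar>cf X w\<bar> \<le> r ^ length w / fact (length w)"
    and Y: "\<And>w. \<bar>cf Y w\<bar> \<le> s ^ length w / fact (length w)"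
    and "0 \<le> r"
  shows "\<bar>cf (X * Y) w\<bar> \<le> (r + s) ^ length w / fact (length w)"
proof -
  let ?n = "length w"
  have "\<bar>cf (X * Y) w\<bar> \<le> (\<Sum>i\<le>?n. \<bar>cf X (take i w) * cf Y (drop i w)\<bar>)"
    unfolding cf_mult_sum by (rule sum_abs)
  also have "\<dots> \<le> (\<Sum>i\<le>?n. (r ^ i / fact i) * (s ^ (?n - i) / fact (?n - i)))"
  proof (rule sum_mono)
    fix i assume "i \<in> {..?n}"
    then have l: "length (take i w) = i" "length (drop i w) = ?n - i" by auto
    show "\<bar>cf X (take i w) * cf Y (drop i w)\<bar> \<le> (r ^ i / fact i) * (s ^ (?n - i) / fact (?n - i))"
      unfolding abs_mult using X[of "take i w"] Y[of "drop i w"] \<open>0 \<le> r\<close> unfolding l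
      by (intro mult_mono) auto
  qed
  finally show ?thesis unfolding binomial_fact_sum .
qed

lemma small_mult:
  assumes "small r X" "small s Y" shows "small (r + s) (X * Y)"
proof -
  have u: "unip X" "unip Y" using assms by (auto simp: small_unip)
  have "(\<chi> j. cf (X * Y) [j]) = (\<chi> j. cf X [j]) + (\<chi> j. cf Y [j])"
    using u by (simp add: vec_eq_iff cf_mult_singleton unip_def)
  then have "norm (\<chi> j. cf (X * Y) [j]) \<le> r + s"
    using assms by (auto simp: small_def intro!: norm_triangle_le add_mono)
  moreover have "\<bar>cf (X * Y) w\<bar> \<le> (r + s) ^ length w / fact (length w)" for w
    using assms by (intro small_mult_bound small_cf) (auto simp: small_nonneg)
  moreover have "\<bar>cf (tinv (X * Y)) w\<bar> \<le> (s + r) ^ length w / fact (length w)" for w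
    unfolding tinv_mult[OF u]
    by (intro small_mult_bound small_cf small_tinv assms) (use assms small_nonneg in blast)
  ultimately show ?thesis using u by (simp add: small_def unip_mult add.commute)
qed

lemma small_exp_vec:
  assumes "norm v \<le> r" shows "small r (exp_vec v)"
proof -
  have b: "\<bar>cf (exp_vec u) w\<bar> \<le> r ^ length w / fact (length w)" if "norm u \<le> r" for u :: "real^'a" and w
  proof -
    have "\<bar>\<Prod>j\<leftarrow>w. u $ j\<bar> \<le> r ^ length w"
    proof (induction w)
      case (Cons j w)
      have "\<bar>u $ j\<bar> \<le> r" using component_le_norm_cart[of u j] that by simp
      then show ?case using Cons by (auto simp: abs_mult intro!: mult_mono)
    qed simp
    then show ?thesis by (simp add: exp_vec_def divide_right_mono)
  qed
  have "(\<chi> j. cf (exp_vec v) [j]) = v" by (simp add: vec_eq_iff)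
  then show ?thesis using b[of v] b[of "- v"] assms by (simp add: small_def tinv_exp_vec)
qed

lemma small_dil:
  assumes "small r X" "0 \<le> s" shows "small (s * r) (dil s X)"
proof -
  have "(\<chi> j. cf (dil s X) [j]) = s *\<^sub>R (\<chi> j. cf X [j])" by (simp add: vec_eq_iff)
  then have "norm (\<chi> j. cf (dil s X) [j]) \<le> s * r"
    using assms by (simp add: small_def mult_left_mono)
  moreover have "\<bar>s ^ length w * c\<bar> \<le> (s * r) ^ length w / fact (length w)"
    if "\<bar>c\<bar> \<le> r ^ length w / fact (length w)" for c and w :: "'a list"
    using mult_left_mono[OF that, of "s ^ length w"] assms(2) by (simp add: abs_mult power_mult_distrib)
  ultimately show ?thesis using assms by (auto simp: small_def tinv_dil)
qed

text \<open>Curves are parametrized by \<open>{0..L}\<close>, start at \<open>1\<close> and are 1-Lipschitz for the metric given by \<open>small\<close>.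
  They turn out to be the curves of signatures of the initial pieces of 1-Lipschitz paths, although no
  integral occurs here; thereby translation, reversal, joining and limits of curves are
  immediate.\<close>

definition curve :: "real \<Rightarrow> (real \<Rightarrow> 'n::finite series) \<Rightarrow> bool" where
  "curve L G \<longleftrightarrow> G 0 = 1 \<and> (\<forall>s t. 0 \<le> s \<and> s \<le> t \<and> t \<le> L \<longrightarrow>
     unip (G s) \<and> small (t - s) (tinv (G s) * G t))"

lemma curveI:
  assumes "G 0 = 1" "\<And>s t. 0 \<le> s \<Longrightarrow> s \<le> t \<Longrightarrow> t \<le> L \<Longrightarrow> unip (G s) \<and> small (t - s) (tinv (G s) * G t)"
  shows "curve L G"
  using assms unfolding curve_def by blast

text \<open>The elements that are the signature of a path of length at most \<open>L\<close>.\<close>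

definition reach :: "real \<Rightarrow> 'n::finite series \<Rightarrow> bool" where
  "reach L X \<longleftrightarrow> 0 \<le> L \<and> (\<exists>G. curve L G \<and> G L = X)"

lemma curve_0: "curve L G \<Longrightarrow> G 0 = 1"
  by (simp add: curve_def)

lemma curve_unip: "curve L G \<Longrightarrow> 0 \<le> t \<Longrightarrow> t \<le> L \<Longrightarrow> unip (G t)"
  by (auto simp: curve_def)

lemma curve_small: "curve L G \<Longrightarrow> 0 \<le> s \<Longrightarrow> s \<le> t \<Longrightarrow> t \<le> L \<Longrightarrow> small (t - s) (tinv (G s) * G t)"
  by (auto simp: curve_def)

lemma curve_small_0: "curve L G \<Longrightarrow> 0 \<le> t \<Longrightarrow> t \<le> L \<Longrightarrow> small t (G t)"
  using curve_small[of L G 0 t] by (simp add: curve_0)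

lemma curve_const: "curve L (\<lambda>t. 1)"
  by (simp add: curve_def small_one)

lemma curve_restrict: "curve L G \<Longrightarrow> L' \<le> L \<Longrightarrow> curve L' G"
  unfolding curve_def by (meson order_trans)

lemma curve_shift:
  assumes G: "curve L G" and a: "0 \<le> a" "a \<le> L"
  shows "curve (L - a) (\<lambda>t. tinv (G a) * G (a + t))"
proof -
  have ua: "unip (G a)" using assms by (intro curve_unip)
  have "unip (tinv (G a) * G (a + s)) \<and>
        small (t - s) (tinv (tinv (G a) * G (a + s)) * (tinv (G a) * G (a + t)))"
    if "0 \<le> s" "s \<le> t" "t \<le> L - a" for s t
  proof -
    have us: "unip (G (a + s))" using that a by (intro curve_unip[OF G]) auto
    have "tinv (tinv (G a) * G (a + s)) * (tinv (G a) * G (a + t)) = tinv (G (a + s)) * G (a + t)"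
      using ua us by (simp add: tinv_mult mult.assoc)
    moreover have "small (t - s) (tinv (G (a + s)) * G (a + t))"
      using curve_small[OF G, of "a + s" "a + t"] that a by simp
    ultimately show ?thesis using ua us by (simp add: unip_mult)
  qed
  then show ?thesis using ua by (intro curveI) simp_all
qed

lemma curve_reverse:
  assumes G: "curve L G" and L: "0 \<le> L"
  shows "curve L (\<lambda>t. tinv (G L) * G (L - t))"
proof -
  have uL: "unip (G L)" using assms by (intro curve_unip) auto
  have "unip (tinv (G L) * G (L - s)) \<and>
        small (t - s) (tinv (tinv (G L) * G (L - s)) * (tinv (G L) * G (L - t)))"
    if "0 \<le> s" "s \<le> t" "t \<le> L" for s t
  proof -
    have u: "unip (G (L - s))" "unip (G (L - t))" using that by (auto intro!: curve_unip[OF G])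
    have "tinv (tinv (G L) * G (L - s)) * (tinv (G L) * G (L - t)) = tinv (tinv (G (L - t)) * G (L - s))"
      using uL u by (simp add: tinv_mult mult.assoc)
    moreover have "small (t - s) (tinv (tinv (G (L - t)) * G (L - s)))"
      using curve_small[OF G, of "L - t" "L - s"] that by (intro small_tinv) simp
    ultimately show ?thesis using uL u by (simp add: unip_mult)
  qed
  then show ?thesis using uL by (intro curveI) simp_all
qed

definition join_at :: "real \<Rightarrow> (real \<Rightarrow> 'n series) \<Rightarrow> (real \<Rightarrow> 'n series) \<Rightarrow> real \<Rightarrow> 'n series" where
  "join_at L G H t = (if t \<le> L then G t else G L * H (t - L))"

lemma curve_join:
  assumes G: "curve L G" and H: "curve M H" and L: "0 \<le> L"
  shows "curve (L + M) (join_at L G H)"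
proof -
  have uL: "unip (G L)" using assms by (intro curve_unip) auto
  have "unip (join_at L G H s) \<and> small (t - s) (tinv (join_at L G H s) * join_at L G H t)"
    if st: "0 \<le> s" "s \<le> t" "t \<le> L + M" for s t
  proof -
    consider "t \<le> L" | "s \<le> L" "L < t" | "L < s" using st by linarith
    then show ?thesis
    proof cases
      case 1
      then show ?thesis using st curve_unip[OF G, of s] curve_small[OF G, of s t] by (simp add: join_at_def)
    next
      case 2
      have "small ((L - s) + (t - L)) ((tinv (G s) * G L) * H (t - L))"
        using 2 st by (intro small_mult curve_small[OF G] curve_small_0[OF H]) auto
      then show ?thesis using 2 st curve_unip[OF G, of s] by (simp add: join_at_def mult.assoc)
    next
      case 3
      have u: "unip (H (s - L))" using 3 st by (intro curve_unip[OF H]) auto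
      have "small ((t - L) - (s - L)) (tinv (H (s - L)) * H (t - L))"
        using 3 st by (intro curve_small[OF H]) auto
      then show ?thesis using 3 st u uL
        by (simp add: join_at_def unip_mult tinv_mult mult.assoc)
    qed
  qed
  moreover have "join_at L G H 0 = 1" using G L by (simp add: join_at_def curve_0)
  ultimately show ?thesis by (intro curveI) simp_all
qed

lemma join_end: "curve M H \<Longrightarrow> 0 \<le> M \<Longrightarrow> join_at L G H (L + M) = G L * H M"
  by (cases "M = 0") (auto simp: join_at_def curve_0)

lemma reach_unip: "reach L X \<Longrightarrow> unip X"
  using curve_unip by (auto simp: reach_def)

lemma reach_nonneg: "reach L X \<Longrightarrow> 0 \<le> L"
  by (simp add: reach_def)

lemma reach_one: "0 \<le> L \<Longrightarrow> reach L 1"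
  unfolding reach_def using curve_const by blast

lemma reach_mult: "reach L X \<Longrightarrow> reach M Y \<Longrightarrow> reach (L + M) (X * Y)"
  unfolding reach_def by (metis add_nonneg_nonneg curve_join join_end)

lemma reach_mono: "reach L X \<Longrightarrow> L \<le> M \<Longrightarrow> reach M X"
  using reach_mult[of L X "M - L" 1] reach_one[of "M - L"] by simp

lemma reach_tinv: "reach L X \<Longrightarrow> reach L (tinv X)"
proof -
  assume "reach L X"
  then obtain G where G: "0 \<le> L" "curve L G" "G L = X" by (auto simp: reach_def)
  then show ?thesis
    unfolding reach_def by (intro conjI exI[of _ "\<lambda>t. tinv (G L) * G (L - t)"] curve_reverse)
      (auto simp: curve_0)
qed

lemma curve_reach:
  assumes G: "curve L G" and st: "0 \<le> s" "s \<le> t" "t \<le> L"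
  shows "reach (t - s) (tinv (G s) * G t)"
proof -
  have "curve (t - s) (\<lambda>u. tinv (G s) * G (s + u))"
    using curve_restrict[OF curve_shift[OF G, of s], of "t - s"] st by simp
  then show ?thesis unfolding reach_def using st by force
qed

lemma reach_0: "reach 0 X \<Longrightarrow> X = 1"
  by (auto simp: reach_def curve_0)

lemma curve_dil:
  assumes G: "curve L G" and s: "0 < s"
  shows "curve (s * L) (\<lambda>t. dil s (G (t / s)))"
proof -
  have "unip (dil s (G (u / s))) \<and> small (t - u) (tinv (dil s (G (u / s))) * dil s (G (t / s)))"
    if "0 \<le> u" "u \<le> t" "t \<le> s * L" for u t
  proof -
    have *: "0 \<le> u / s" "u / s \<le> t / s" "t / s \<le> L"
      using that s by (auto simp: divide_right_mono field_simps)
    then have u: "unip (G (u / s))" by (intro curve_unip[OF G]) auto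
    have "small (s * (t / s - u / s)) (dil s (tinv (G (u / s)) * G (t / s)))"
      using curve_small[OF G *] s by (intro small_dil) auto
    then show ?thesis using u s by (simp add: tinv_dil dil_mult right_diff_distrib)
  qed
  then show ?thesis using curve_0[OF G] by (intro curveI) simp_all
qed

lemma reach_dil:
  assumes "reach L X" "0 < s" shows "reach (s * L) (dil s X)"
proof -
  from assms obtain G where "0 \<le> L" "curve L G" "G L = X" by (auto simp: reach_def)
  then show ?thesis unfolding reach_def
    using curve_dil[of L G s] assms(2) by (intro conjI exI[of _ "\<lambda>t. dil s (G (t / s))"]) auto
qed

lemma curve_exp_vec:
  assumes "norm v \<le> 1" shows "curve L (\<lambda>t. exp_vec (t *\<^sub>R v))"
proof -
  have "tinv (exp_vec (s *\<^sub>R v)) * exp_vec (t *\<^sub>R v) = exp_vec ((t - s) *\<^sub>R v)" for s t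
    using exp_vec_add[of "- s" v t] by (simp add: tinv_exp_vec)
  moreover have "small (t - s) (exp_vec ((t - s) *\<^sub>R v))" if "s \<le> t" for s t
    using assms that by (intro small_exp_vec) (simp add: mult_left_le)
  ultimately show ?thesis by (intro curveI) simp_all
qed

lemma reach_exp_vec: "reach (norm v) (exp_vec v)"
proof -
  have "curve (norm v) (\<lambda>t. exp_vec (t *\<^sub>R (v /\<^sub>R norm v)))"
    by (intro curve_exp_vec) (cases "v = 0", simp_all)
  then show ?thesis
    unfolding reach_def by (intro conjI exI[of _ "\<lambda>t. exp_vec (t *\<^sub>R (v /\<^sub>R norm v))"])
      (cases "v = 0"; simp)+
qed

section \<open>Coefficientwise limits and compactness\<close>

definition conv :: "'i filter \<Rightarrow> ('i \<Rightarrow> 'n series) \<Rightarrow> 'n series \<Rightarrow> bool" where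
  "conv F X Y \<longleftrightarrow> (\<forall>w. ((\<lambda>i. cf (X i) w) \<longlongrightarrow> cf Y w) F)"

lemma convD: "conv F X Y \<Longrightarrow> ((\<lambda>i. cf (X i) w) \<longlongrightarrow> cf Y w) F"
  by (simp add: conv_def)

lemma conv_const: "conv F (\<lambda>i. X) X"
  by (simp add: conv_def)

lemma conv_unique: "conv F X Y \<Longrightarrow> conv F X Z \<Longrightarrow> F \<noteq> bot \<Longrightarrow> Y = Z"
  by (metis series_eqI convD tendsto_unique)

lemma conv_mono: "conv F X Y \<Longrightarrow> F' \<le> F \<Longrightarrow> conv F' X Y"
  unfolding conv_def using tendsto_mono by blast

lemma conv_mult: "conv F X X' \<Longrightarrow> conv F Y Y' \<Longrightarrow> conv F (\<lambda>i. X i * Y i) (X' * Y')"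
  unfolding conv_def cf_mult_sum by (auto intro!: tendsto_intros)

lemma conv_diff: "conv F X X' \<Longrightarrow> conv F Y Y' \<Longrightarrow> conv F (\<lambda>i. X i - Y i) (X' - Y')"
  unfolding conv_def by (auto intro!: tendsto_intros)

lemma conv_power: "conv F X X' \<Longrightarrow> conv F (\<lambda>i. X i ^ n) (X' ^ n)"
  by (induction n) (auto intro: conv_const conv_mult)

lemma conv_tinv: "conv F X X' \<Longrightarrow> conv F (\<lambda>i. tinv (X i)) (tinv X')"
proof -
  assume X: "conv F X X'"
  have "conv F (\<lambda>i. (1 - X i) ^ n) ((1 - X') ^ n)" for n
    by (intro conv_power conv_diff conv_const X)
  then show ?thesis unfolding conv_def tinv_def by (auto intro!: tendsto_intros)
qed

lemma conv_unip:
  assumes "conv F X Y" "F \<noteq> bot" "eventually (\<lambda>i. unip (X i)) F" shows "unip Y"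
proof -
  have "((\<lambda>i. cf (X i) []) \<longlongrightarrow> 1) F"
    using assms(3) by (intro tendsto_eventually) (simp add: unip_def)
  then show ?thesis using assms(1,2) unfolding unip_def by (metis convD tendsto_unique)
qed

lemma conv_small:
  assumes X: "conv F X Y" and F: "F \<noteq> bot" and s: "eventually (\<lambda>i. small r (X i)) F"
  shows "small r Y"
proof -
  have "unip Y" using X F by (rule conv_unip) (use s in \<open>auto elim: eventually_mono simp: small_unip\<close>)
  moreover have "norm (\<chi> j. cf Y [j]) \<le> r"
  proof (rule tendsto_upperbound[OF _ _ F])
    show "((\<lambda>i. norm (\<chi> j. cf (X i) [j])) \<longlongrightarrow> norm (\<chi> j. cf Y [j])) F"
      by (intro tendsto_norm vec_tendstoI) (simp add: convD[OF X])
    show "\<forall>\<^sub>F i in F. norm (\<chi> j. cf (X i) [j]) \<le> r"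
      using s by (auto elim: eventually_mono simp: small_def)
  qed
  moreover have "\<bar>cf Y w\<bar> \<le> r ^ length w / fact (length w)"
    if X: "conv F X Y" and s: "eventually (\<lambda>i. small r (X i)) F" for X Y w
  proof (rule tendsto_upperbound[OF _ _ F])
    show "((\<lambda>i. \<bar>cf (X i) w\<bar>) \<longlongrightarrow> \<bar>cf Y w\<bar>) F" by (intro tendsto_intros convD X)
    show "\<forall>\<^sub>F i in F. \<bar>cf (X i) w\<bar> \<le> r ^ length w / fact (length w)"
      using s by (auto elim: eventually_mono simp: small_def)
  qed
  from this[OF X s] this[OF conv_tinv[OF X] eventually_mono[OF s small_tinv]]
  have "\<bar>cf Y w\<bar> \<le> r ^ length w / fact (length w)"
       "\<bar>cf (tinv Y) w\<bar> \<le> r ^ length w / fact (length w)" for w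
    by auto
  ultimately show ?thesis by (simp add: small_def)
qed

lemma conv_small_one:
  assumes "eventually (\<lambda>i. small (r i) (X i)) F" "(r \<longlongrightarrow> 0) F"
  shows "conv F X 1"
  unfolding conv_def
proof
  fix w
  show "((\<lambda>i. cf (X i) w) \<longlongrightarrow> cf 1 w) F"
  proof (cases "w = []")
    case True
    then show ?thesis using assms(1)
      by (intro tendsto_eventually, elim eventually_mono) (auto dest: small_unip simp: unip_def)
  next
    case False
    have "((\<lambda>i. r i ^ length w / fact (length w)) \<longlongrightarrow> 0 ^ length w / fact (length w)) F"
      by (intro tendsto_intros assms) auto
    then have "((\<lambda>i. r i ^ length w / fact (length w)) \<longlongrightarrow> 0) F"
      using False by (simp add: power_0_left)
    then have "((\<lambda>i. cf (X i) w) \<longlongrightarrow> 0) F"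
      by (rule Lim_null_comparison[rotated]) (use assms(1) in \<open>auto elim: eventually_mono simp: small_def\<close>)
    then show ?thesis using False by simp
  qed
qed

text \<open>The bounds of \<open>small\<close> confine a curve to a product of compact intervals, indexed by parameter and
  word, and being a curve is a closed condition. So Tychonoff's theorem gives cluster points; a filter
  replaces subsequences, because the index set is uncountable.\<close>

lemma curve_cluster:
  fixes G :: "'i \<Rightarrow> real \<Rightarrow> 'n::finite series"
  assumes F: "F \<noteq> bot" and G: "\<And>i. curve L (G i)" and L: "0 \<le> L"
  obtains F' H where "F' \<noteq> bot" "F' \<le> F" "curve L H"
    "\<And>t. 0 \<le> t \<Longrightarrow> t \<le> L \<Longrightarrow> conv F' (\<lambda>i. G i t) (H t)"
proof -
  define B :: "real \<Rightarrow> 'n list \<Rightarrow> real set"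
    where "B t w = {- (t ^ length w / fact (length w)) .. t ^ length w / fact (length w)}" for t w
  define K where "K = Pi\<^sub>E UNIV (\<lambda>(t, w). if t \<in> {0..L} then B t w else {0})"
  define g where "g i = (\<lambda>(t, w). if t \<in> {0..L} then cf (G i t) w else 0)" for i
  have "compact K"
  proof -
    have "compactin (product_topology (\<lambda>_. euclidean) UNIV) K"
      unfolding K_def compactin_PiE by (auto simp: B_def)
    then show ?thesis by (simp add: euclidean_product_topology)
  qed
  have gK: "g i \<in> K" for i
  proof -
    have "cf (G i t) w \<in> B t w" if "0 \<le> t" "t \<le> L" for t w
      using small_cf[OF curve_small_0[OF G that, of i], of w] by (auto simp: B_def abs_le_iff)
    then show ?thesis by (auto simp: K_def g_def)
  qed
  have "filtermap g F \<noteq> bot" using F by (simp add: filtermap_bot_iff)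
  moreover have "eventually (\<lambda>x. x \<in> K) (filtermap g F)"
    by (simp add: eventually_filtermap gK)
  ultimately obtain x where x: "x \<in> K" "inf (nhds x) (filtermap g F) \<noteq> bot"
    using \<open>compact K\<close> unfolding compact_filter by blast
  define F' where "F' = inf F (filtercomap g (nhds x))"
  have "F' \<noteq> bot"
  proof
    assume "F' = bot"
    then obtain P Q where P: "eventually P F" and Q: "eventually Q (nhds x)"
      and PQ: "\<And>i. P i \<Longrightarrow> \<not> Q (g i)"
      unfolding F'_def trivial_limit_def eventually_inf eventually_filtercomap by blast
    have "eventually (\<lambda>y. \<not> Q y) (filtermap g F)"
      unfolding eventually_filtermap using P by (rule eventually_mono) (rule PQ)
    then have "eventually (\<lambda>y. False) (inf (nhds x) (filtermap g F))"
      unfolding eventually_inf using Q by blast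
    then show False using x(2) by (simp add: trivial_limit_def)
  qed
  have "F' \<le> F" by (simp add: F'_def)
  have lim: "(g \<longlongrightarrow> x) F'"
    unfolding F'_def by (rule filterlim_mono[OF filterlim_filtercomap order_refl]) simp
  define H where "H t = Series (\<lambda>w. x (t, w))" for t
  have conv: "conv F' (\<lambda>i. G i t) (H t)" if "0 \<le> t" "t \<le> L" for t
    unfolding conv_def
  proof
    fix w
    have "((\<lambda>i. g i (t, w)) \<longlongrightarrow> x (t, w)) F'"
      by (rule continuous_on_tendsto_compose[OF continuous_on_product_coordinates lim]) auto
    then show "((\<lambda>i. cf (G i t) w) \<longlongrightarrow> cf (H t) w) F'"
      using that by (simp add: g_def H_def)
  qed
  have "curve L H"
  proof -
    have "conv F' (\<lambda>i. G i 0) 1"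
      using curve_0[OF G] by (simp add: conv_const)
    then have "H 0 = 1"
      using conv_unique[OF conv[of 0] _ \<open>F' \<noteq> bot\<close>] L by blast
    moreover have "unip (H s)" "small (t - s) (tinv (H s) * H t)"
      if "0 \<le> s" "s \<le> t" "t \<le> L" for s t
    proof -
      have "conv F' (\<lambda>i. G i s) (H s)" using that by (intro conv) auto
      then show "unip (H s)" using \<open>F' \<noteq> bot\<close>
        by (rule conv_unip) (use that curve_unip[OF G] in \<open>auto intro!: always_eventually\<close>)
      have "conv F' (\<lambda>i. tinv (G i s) * G i t) (tinv (H s) * H t)"
        using that by (intro conv_mult conv_tinv conv) auto
      then show "small (t - s) (tinv (H s) * H t)" using \<open>F' \<noteq> bot\<close>
        by (rule conv_small) (use that curve_small[OF G] in \<open>auto intro!: always_eventually\<close>)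
    qed
    ultimately show ?thesis by (intro curveI) simp_all
  qed
  show ?thesis using that \<open>F' \<noteq> bot\<close> \<open>F' \<le> F\<close> \<open>curve L H\<close> conv by blast
qed

text \<open>Lower semicontinuity of length: in the limit the curves lose their excess \<open>e i\<close>, since
  the piece of length \<open>e i\<close> at their end tends to \<open>1\<close>.\<close>

lemma reach_closed:
  fixes X :: "'i \<Rightarrow> 'n::finite series"
  assumes F: "F \<noteq> bot" and X: "\<forall>\<^sub>F i in F. reach (C + e i) (X i)"
    and e: "\<And>i. 0 \<le> e i" "(e \<longlongrightarrow> 0) F"
    and C: "0 \<le> C" and Y: "conv F X Y"
  shows "reach C Y"
proof -
  have "\<exists>G. curve C G \<and> (reach (C + e i) (X i) \<longrightarrow> small (e i) (tinv (G C) * X i))" for i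
  proof (cases "reach (C + e i) (X i)")
    case True
    then obtain G where G: "curve (C + e i) G" "G (C + e i) = X i" by (auto simp: reach_def)
    have "small (C + e i - C) (tinv (G C) * G (C + e i))" using C e by (intro curve_small[OF G(1)]) auto
    moreover have "curve C G" using e by (intro curve_restrict[OF G(1)]) simp
    ultimately show ?thesis using G(2) by auto
  next
    case False
    then show ?thesis using curve_const by blast
  qed
  then obtain G where G: "\<And>i. curve C (G i)"
    "\<And>i. reach (C + e i) (X i) \<Longrightarrow> small (e i) (tinv (G i C) * X i)" by metis
  obtain F' H where F': "F' \<noteq> bot" "F' \<le> F" "curve C H"
    and H: "\<And>t. 0 \<le> t \<Longrightarrow> t \<le> C \<Longrightarrow> conv F' (\<lambda>i. G i t) (H t)"
    using curve_cluster[of F C G] F G(1) C by auto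
  have "\<forall>\<^sub>F i in F'. small (e i) (tinv (G i C) * X i)"
    using eventually_mono[OF X G(2)] F'(2) by (rule filter_leD[rotated])
  then have "conv F' (\<lambda>i. tinv (G i C) * X i) 1"
    using tendsto_mono[OF F'(2) e(2)] by (rule conv_small_one)
  then have "conv F' (\<lambda>i. G i C * (tinv (G i C) * X i)) (H C * 1)"
    using C by (intro conv_mult H) auto
  moreover have "unip (G i C)" for i using C by (intro curve_unip[OF G(1)]) auto
  ultimately have "conv F' X (H C)" by simp
  with conv_mono[OF Y F'(2)] have "H C = Y" using conv_unique F'(1) by blast
  then show ?thesis using C F'(3) by (auto simp: reach_def)
qed

lemma reach_cluster:
  fixes X :: "'i \<Rightarrow> 'n::finite series"
  assumes "F \<noteq> bot" "\<And>i. reach L (X i)"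
  obtains F' Y where "F' \<noteq> bot" "F' \<le> F" "conv F' X Y"
proof -
  from assms(2) obtain G where G: "\<And>i. curve L (G i)" "\<And>i. G i L = X i" and L: "0 \<le> L"
    unfolding reach_def by metis
  obtain F' H where "F' \<noteq> bot" "F' \<le> F" "curve L H"
    and H: "\<And>t. 0 \<le> t \<Longrightarrow> t \<le> L \<Longrightarrow> conv F' (\<lambda>i. G i t) (H t)"
    using curve_cluster[of F L G] assms(1) G(1) L by auto
  moreover have "conv F' X (H L)" using H[OF L order_refl] unfolding G(2) .
  ultimately show ?thesis using that by blast
qed

section \<open>Coefficients of a curve are iterated integrals\<close>

text \<open>Errors of second order disappear when the interval is subdivided.\<close>

lemma increment_bound:
  fixes \<phi> :: "real \<Rightarrow> real"
  assumes inc: "\<And>u v. s \<le> u \<Longrightarrow> u \<le> v \<Longrightarrow> v \<le> t \<Longrightarrow> \<bar>\<phi> v - \<phi> u\<bar> \<le> M * (v - u) + C * (v - u)\<^sup>2"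
    and st: "s \<le> t"
  shows "\<bar>\<phi> t - \<phi> s\<bar> \<le> M * (t - s)"
proof -
  have b: "\<bar>\<phi> t - \<phi> s\<bar> \<le> M * (t - s) + C * (t - s)\<^sup>2 / real (Suc n)" for n
  proof -
    define h where "h = (t - s) / real (Suc n)"
    have h: "0 \<le> h" "real (Suc n) * h = t - s" using st by (auto simp: h_def)
    have "\<phi> t - \<phi> s = (\<Sum>i<Suc n. \<phi> (s + real (Suc i) * h) - \<phi> (s + real i * h))"
      using sum_lessThan_telescope[of "\<lambda>i. \<phi> (s + real i * h)" "Suc n"] h(2) by simp
    also have "\<bar>\<dots>\<bar> \<le> (\<Sum>i<Suc n. \<bar>\<phi> (s + real (Suc i) * h) - \<phi> (s + real i * h)\<bar>)"
      by (rule sum_abs)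
    also have "\<dots> \<le> (\<Sum>i<Suc n. M * h + C * h\<^sup>2)"
    proof (rule sum_mono)
      fix i assume "i \<in> {..<Suc n}"
      then have "real (Suc i) * h \<le> real (Suc n) * h" using h by (intro mult_right_mono) auto
      then show "\<bar>\<phi> (s + real (Suc i) * h) - \<phi> (s + real i * h)\<bar> \<le> M * h + C * h\<^sup>2"
        using inc[of "s + real i * h" "s + real (Suc i) * h"] h by (simp add: algebra_simps)
    qed
    also have "\<dots> = M * (real (Suc n) * h) + C * (real (Suc n) * h) * h"
      by (simp add: algebra_simps power2_eq_square)
    also have "\<dots> = M * (t - s) + C * (t - s)\<^sup>2 / real (Suc n)"
      unfolding h(2) by (simp add: h_def power2_eq_square)
    finally show ?thesis .
  qed
  have "(\<lambda>n. M * (t - s) + C * (t - s)\<^sup>2 / real (Suc n)) \<longlonglongrightarrow> M * (t - s) + 0"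
    by (intro tendsto_intros LIMSEQ_Suc lim_const_over_n)
  from LIMSEQ_le_const[OF this] b show ?thesis by auto
qed

lemma curve_singleton_diff:
  assumes G: "curve L G" and st: "0 \<le> s" "s \<le> t" "t \<le> L"
  shows "cf (tinv (G s) * G t) [j] = cf (G t) [j] - cf (G s) [j]"
proof -
  have u: "unip (G s)" "unip (G t)" using st by (auto intro!: curve_unip[OF G])
  then have "cf (tinv (G s)) [] = 1" "cf (G t) [] = 1" using unip_tinv by (auto simp: unip_def)
  then show ?thesis using u by (simp add: cf_mult_singleton cf_tinv_singleton)
qed

lemma curve_singleton_norm:
  assumes "curve L G" "0 \<le> s" "s \<le> t" "t \<le> L"
  shows "norm ((\<chi> j. cf (G t) [j]) - (\<chi> j. cf (G s) [j])) \<le> t - s"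
proof -
  have "(\<chi> j. cf (G t) [j]) - (\<chi> j. cf (G s) [j]) = (\<chi> j. cf (tinv (G s) * G t) [j])"
    using curve_singleton_diff[OF assms] by (simp add: vec_eq_iff)
  then show ?thesis using curve_small[OF assms] by (simp add: small_def)
qed

lemma curve_singleton_abs:
  assumes "curve L G" "0 \<le> s" "s \<le> t" "t \<le> L"
  shows "\<bar>cf (G t) [j] - cf (G s) [j]\<bar> \<le> t - s"
  using curve_singleton_norm[OF assms]
    component_le_norm_cart[of "(\<chi> j. cf (G t) [j]) - (\<chi> j. cf (G s) [j])" j] by simp

text \<open>The coefficient at \<open>w @ [j]\<close> is the integral of the one at \<open>w\<close> against the coordinate \<open>j\<close>: in the product
  of \<open>G s\<close> with the increment \<open>tinv (G s) * G t\<close>, the cut after the last letter gives the old value, the cut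
  before it gives the main term, and every other cut leaves a word of length at least two for the
  increment, which is of second order.\<close>

lemma curve_primitive:
  assumes G: "curve L G"
  obtains C where "0 \<le> C" "\<And>s t. 0 \<le> s \<Longrightarrow> s \<le> t \<Longrightarrow> t \<le> L \<Longrightarrow>
    \<bar>cf (G t) (w @ [j]) - cf (G s) (w @ [j]) - cf (G s) w * (cf (G t) [j] - cf (G s) [j])\<bar> \<le> C * (t - s)\<^sup>2"
proof
  let ?n = "length w" and ?w = "w @ [j]"
  define C where "C = (\<Sum>i<?n. \<bar>L\<bar> ^ i * \<bar>L\<bar> ^ (?n - i - 1))"
  show "0 \<le> C" unfolding C_def by (intro sum_nonneg) auto
  fix s t assume st: "0 \<le> s" "s \<le> t" "t \<le> L"
  define X where "X = tinv (G s) * G t"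
  have us: "unip (G s)" using st by (intro curve_unip[OF G]) auto
  have X: "small (t - s) X" unfolding X_def using G st by (rule curve_small)
  have "cf (G t) ?w = cf (G s * X) ?w" using us by (simp add: X_def)
  also have "\<dots> = cf (G s) ?w + cf (G s) w * cf X [j] + (\<Sum>i<?n. cf (G s) (take i ?w) * cf X (drop i ?w))"
    using small_unip[OF X] by (simp add: cf_mult_sum unip_def lessThan_Suc_atMost[symmetric])
  also have "cf X [j] = cf (G t) [j] - cf (G s) [j]"
    unfolding X_def by (rule curve_singleton_diff[OF G st])
  finally have "\<bar>cf (G t) ?w - cf (G s) ?w - cf (G s) w * (cf (G t) [j] - cf (G s) [j])\<bar>
     = \<bar>\<Sum>i<?n. cf (G s) (take i ?w) * cf X (drop i ?w)\<bar>" by simp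
  also have "\<dots> \<le> (\<Sum>i<?n. \<bar>cf (G s) (take i ?w) * cf X (drop i ?w)\<bar>)" by (rule sum_abs)
  also have "\<dots> \<le> (\<Sum>i<?n. \<bar>L\<bar> ^ i * (\<bar>L\<bar> ^ (?n - i - 1) * (t - s)\<^sup>2))"
  proof (rule sum_mono)
    fix i assume "i \<in> {..<?n}"
    then have i: "length (take i ?w) = i" "length (drop i ?w) = Suc ?n - i"
        "Suc ?n - i = (?n - i - 1) + 2" by auto
    have f: "x / fact m \<le> x" if "0 \<le> x" for x :: real and m
      using that fact_ge_1[of m, where 'a = real] by (simp add: divide_le_eq mult_le_cancel_left1)
    have "\<bar>cf (G s) (take i ?w)\<bar> \<le> s ^ i / fact i"
      using small_cf[OF curve_small_0[OF G], of s "take i ?w"] st i(1) by (simp del: take_append)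
    also have "\<dots> \<le> s ^ i" using st by (intro f) auto
    also have "\<dots> \<le> \<bar>L\<bar> ^ i" using st by (intro power_mono) auto
    finally have 1: "\<bar>cf (G s) (take i ?w)\<bar> \<le> \<bar>L\<bar> ^ i" .
    have "\<bar>cf X (drop i ?w)\<bar> \<le> (t - s) ^ (Suc ?n - i) / fact (Suc ?n - i)"
      using small_cf[OF X, of "drop i ?w"] i(2) by (simp del: drop_append)
    also have "\<dots> \<le> (t - s) ^ (Suc ?n - i)" using st by (intro f) auto
    also have "\<dots> = (t - s) ^ (?n - i - 1) * (t - s)\<^sup>2" unfolding i(3) by (rule power_add)
    also have "\<dots> \<le> \<bar>L\<bar> ^ (?n - i - 1) * (t - s)\<^sup>2" using st by (intro mult_right_mono power_mono) auto
    finally show "\<bar>cf (G s) (take i ?w) * cf X (drop i ?w)\<bar> \<le> \<bar>L\<bar> ^ i * (\<bar>L\<bar> ^ (?n - i - 1) * (t - s)\<^sup>2)"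
      unfolding abs_mult using 1 by (intro mult_mono) auto
  qed
  also have "\<dots> = C * (t - s)\<^sup>2" by (simp add: C_def sum_distrib_right mult.assoc)
  finally show "\<bar>cf (G t) ?w - cf (G s) ?w - cf (G s) w * (cf (G t) [j] - cf (G s) [j])\<bar> \<le> C * (t - s)\<^sup>2" .
qed

lemma curve_bounded:
  assumes "curve L G" "0 \<le> s" "s \<le> L"
  shows "\<bar>cf (G s) w\<bar> \<le> L ^ length w / fact (length w)"
  using small_cf[OF small_mono[OF curve_small_0[OF assms] assms(3)]] .

lemma curve_lipschitz:
  assumes G: "curve L G"
  obtains C where "0 \<le> C" "\<And>s t. 0 \<le> s \<Longrightarrow> s \<le> t \<Longrightarrow> t \<le> L \<Longrightarrow> \<bar>cf (G t) w - cf (G s) w\<bar> \<le> C * (t - s)"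
proof (cases w rule: rev_cases)
  case Nil
  have "cf (G t) [] = 1" if "0 \<le> t" "t \<le> L" for t using curve_unip[OF G that] by (simp add: unip_def)
  then show ?thesis using Nil by (intro that[of 0]) auto
next
  case (snoc v j)
  obtain C where C: "0 \<le> C" "\<And>s t. 0 \<le> s \<Longrightarrow> s \<le> t \<Longrightarrow> t \<le> L \<Longrightarrow>
    \<bar>cf (G t) w - cf (G s) w - cf (G s) v * (cf (G t) [j] - cf (G s) [j])\<bar> \<le> C * (t - s)\<^sup>2"
    unfolding snoc using curve_primitive[OF G] by blast
  define B where "B = \<bar>L ^ length v / fact (length v)\<bar>"
  show ?thesis
  proof (rule that[of "B + C * \<bar>L\<bar>"])
    show "0 \<le> B + C * \<bar>L\<bar>" using C(1) by (simp add: B_def)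
    fix s t assume st: "0 \<le> s" "s \<le> t" "t \<le> L"
    have "\<bar>cf (G s) v\<bar> \<le> B"
      using curve_bounded[OF G, of s v] st unfolding B_def by simp
    then have "\<bar>cf (G s) v * (cf (G t) [j] - cf (G s) [j])\<bar> \<le> B * (t - s)"
      unfolding abs_mult using curve_singleton_abs[OF G st] by (intro mult_mono) (auto simp: B_def)
    moreover have "C * (t - s)\<^sup>2 \<le> C * \<bar>L\<bar> * (t - s)"
      unfolding power2_eq_square mult.assoc[symmetric] using C(1) st
      by (intro mult_right_mono mult_left_mono) auto
    ultimately show "\<bar>cf (G t) w - cf (G s) w\<bar> \<le> (B + C * \<bar>L\<bar>) * (t - s)"
      using C(2)[OF st] by (simp add: distrib_right)
  qed
qed

subsection \<open>Lifting unit-speed paths\<close>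

text \<open>Signatures of polygonal paths.\<close>

inductive_set polygons :: "'n::finite series set" where
  polygons_one: "1 \<in> polygons"
| polygons_step: "X \<in> polygons \<Longrightarrow> X * exp_vec v \<in> polygons"

text \<open>Samples of a path at distance \<open>h\<close> are joined by segments, each of which is traversed in time \<open>h\<close> and hence
  at most with unit speed.\<close>

lemma polygon_interpolation:
  fixes g :: "real \<Rightarrow> real^'n::finite"
  assumes h: "0 \<le> h" and g: "\<And>i. norm (g (real (Suc i) * h) - g (real i * h)) \<le> h"
  shows "\<exists>G. curve (real m * h) G \<and> G (real m * h) \<in> polygons \<and>
    (\<forall>i\<le>m. \<forall>j. cf (G (real i * h)) [j] = g (real i * h) $ j - g 0 $ j)"
proof (induction m)
  case 0
  show ?case
    by (intro exI[of _ "\<lambda>t. 1"]) (simp add: curve_const polygons_one cf_one tensor_one_def)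
next
  case (Suc m)
  then obtain G where G: "curve (real m * h) G" "G (real m * h) \<in> polygons"
    "\<And>i j. i \<le> m \<Longrightarrow> cf (G (real i * h)) [j] = g (real i * h) $ j - g 0 $ j" by blast
  define v where "v = g (real (Suc m) * h) - g (real m * h)"
  have v: "norm v \<le> h" using g[of m] by (simp add: v_def)
  have hv: "h *\<^sub>R (v /\<^sub>R h) = v" using v by (cases "h = 0") auto
  define H where "H t = exp_vec (t *\<^sub>R (v /\<^sub>R h))" for t
  have H: "curve h H" unfolding H_def using v h
    by (intro curve_exp_vec) (cases "h = 0", auto simp: field_simps)
  define J where "J = join_at (real m * h) G H"
  have J: "curve (real (Suc m) * h) J"
    using curve_join[OF G(1) H] h by (simp add: J_def algebra_simps)
  have final: "J (real (Suc m) * h) = G (real m * h) * exp_vec v"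
    using join_end[OF H h, of "real m * h" G] hv by (simp add: J_def H_def algebra_simps)
  have "cf (J (real i * h)) [j] = g (real i * h) $ j - g 0 $ j" if "i \<le> Suc m" for i j
  proof (cases "i = Suc m")
    case True
    have "unip (G (real m * h))" using h by (intro curve_unip[OF G(1)]) auto
    moreover have "cf (exp_vec v) [] = 1" using unip_exp_vec unfolding unip_def by blast
    ultimately show ?thesis using G(3)[of m j]
      unfolding True final by (simp add: cf_mult_singleton unip_def v_def)
  next
    case False
    then have "i \<le> m" using that by simp
    then show ?thesis using G(3) h by (simp add: J_def join_at_def mult_right_mono)
  qed
  then show ?case using J final polygons_step[OF G(2)] by auto
qed

text \<open>The lifts of finer and finer inscribed polygons are explicit, and a cluster point of them lifts \<open>g\<close>. That
  its end point is a limit of polygon signatures is recorded, because the Lie property of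
  signatures is inherited from polygons.\<close>

lemma curve_lift_exists:
  fixes g :: "real \<Rightarrow> real^'n::finite"
  assumes L: "0 \<le> L" and g: "\<And>s t. 0 \<le> s \<Longrightarrow> s \<le> t \<Longrightarrow> t \<le> L \<Longrightarrow> norm (g t - g s) \<le> t - s"
  obtains G and F :: "nat filter" and Y where "curve L G"
    "\<And>t j. 0 \<le> t \<Longrightarrow> t \<le> L \<Longrightarrow> cf (G t) [j] = g t $ j - g 0 $ j"
    "F \<noteq> bot" "\<And>N. Y N \<in> polygons" "conv F Y (G L)"
proof -
  define h where "h N = L / real (Suc N)" for N
  have h: "0 \<le> h N" "real (Suc N) * h N = L" for N using L by (auto simp: h_def)
  have hi: "real i * h N \<le> L" if "i \<le> Suc N" for i N
    using mult_right_mono[of "real i" "real (Suc N)" "h N"] that h[of N] by auto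
  have "\<exists>G. curve L G \<and> G L \<in> polygons \<and>
    (\<forall>i\<le>Suc N. \<forall>j. cf (G (real i * h N)) [j] = g (real i * h N) $ j - g 0 $ j)" for N
  proof -
    define g' where "g' t = g (min t L)" for t
    have "norm (g' (real (Suc i) * h N) - g' (real i * h N)) \<le> h N" for i
    proof -
      have le: "real i * h N \<le> real (Suc i) * h N" using h by (intro mult_right_mono) auto
      have "norm (g' (real (Suc i) * h N) - g' (real i * h N))
          \<le> min (real (Suc i) * h N) L - min (real i * h N) L"
        unfolding g'_def using le h L by (intro g) (auto simp: min_def)
      also have "\<dots> \<le> real (Suc i) * h N - real i * h N" using le by (auto simp: min_def)
      finally show ?thesis by (simp add: algebra_simps)
    qed
    from polygon_interpolation[OF h(1) this, of "Suc N"] obtain G where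
      G: "curve L G" "G L \<in> polygons"
        "\<And>i j. i \<le> Suc N \<Longrightarrow> cf (G (real i * h N)) [j] = g' (real i * h N) $ j - g' 0 $ j"
      unfolding h(2) by blast
    have "g' (real i * h N) = g (real i * h N)" if "i \<le> Suc N" for i
      using hi[OF that] by (simp add: g'_def)
    moreover have "g' 0 = g 0" using L by (simp add: g'_def)
    ultimately show ?thesis using G by metis
  qed
  then obtain G where G: "\<And>N. curve L (G N)" "\<And>N. G N L \<in> polygons"
    "\<And>N i j. i \<le> Suc N \<Longrightarrow> cf (G N (real i * h N)) [j] = g (real i * h N) $ j - g 0 $ j"
    by metis
  obtain F H where F: "F \<noteq> bot" "F \<le> sequentially" and H: "curve L H"
    and lim: "\<And>t. 0 \<le> t \<Longrightarrow> t \<le> L \<Longrightarrow> conv F (\<lambda>N. G N t) (H t)"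
    using curve_cluster[of sequentially L G] G(1) L by auto
  have close: "\<bar>cf (G N t) [j] - (g t $ j - g 0 $ j)\<bar> \<le> 2 * h N" if t: "0 \<le> t" "t \<le> L" for N t j
  proof -
    obtain i where i: "i \<le> Suc N" "real i * h N \<le> t" "t - real i * h N \<le> h N"
    proof (cases "h N = 0")
      case True
      then show ?thesis using that[of 0] t h(2)[of N] by simp
    next
      case False
      then have hp: "0 < h N" using h[of N] by simp
      define i where "i = nat \<lfloor>t / h N\<rfloor>"
      have i: "real i = of_int \<lfloor>t / h N\<rfloor>" using t hp by (simp add: i_def)
      have "real i \<le> t / h N" unfolding i by simp
      then have 1: "real i * h N \<le> t" using hp by (simp add: pos_le_divide_eq)
      have "t / h N \<le> real i + 1" unfolding i by linarith
      then have 2: "t \<le> (real i + 1) * h N" using hp by (simp add: pos_divide_le_eq)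
      have "real i * h N \<le> real (Suc N) * h N" using 1 t h(2)[of N] by simp
      then have "real i \<le> real (Suc N)" using hp by (simp only: mult_le_cancel_right_pos)
      then show ?thesis using that[of i] 1 2 by (simp add: algebra_simps)
    qed
    have "\<bar>cf (G N t) [j] - cf (G N (real i * h N)) [j]\<bar> \<le> t - real i * h N"
      using i t h by (intro curve_singleton_abs[OF G(1)]) auto
    moreover have "\<bar>(g t - g (real i * h N)) $ j\<bar> \<le> t - real i * h N"
      using i t h by (intro order_trans[OF component_le_norm_cart] g) auto
    ultimately show ?thesis using G(3)[OF i(1), of j] i(3) by simp
  qed
  have h0: "h \<longlonglongrightarrow> 0" unfolding h_def by (intro LIMSEQ_Suc lim_const_over_n)
  have "cf (H t) [j] = g t $ j - g 0 $ j" if "0 \<le> t" "t \<le> L" for t j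
  proof -
    have "((\<lambda>N. cf (G N t) [j] - (g t $ j - g 0 $ j)) \<longlongrightarrow> 0) F"
    proof (rule Lim_null_comparison)
      show "\<forall>\<^sub>F N in F. norm (cf (G N t) [j] - (g t $ j - g 0 $ j)) \<le> 2 * h N"
        using close[OF that] by simp
      show "((\<lambda>N. 2 * h N) \<longlongrightarrow> 0) F"
        using tendsto_mult_right_zero[OF tendsto_mono[OF F(2) h0]] .
    qed
    then have "((\<lambda>N. cf (G N t) [j]) \<longlongrightarrow> g t $ j - g 0 $ j) F" by (simp add: LIM_zero_cancel)
    with convD[OF lim[OF that], of "[j]"] F(1) show ?thesis using tendsto_unique by blast
  qed
  then show ?thesis using that[OF H _ F(1) G(2) lim[OF L order_refl]] by blast
qed

subsection \<open>Second-order remainders\<close>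

text \<open>Second-order remainders stand in for derivatives: a function whose increments are of this kind is
  constant (\<open>small_rem_const\<close>), which proves identities between iterated integrals as one would by
  differentiating.\<close>

definition small_rem :: "real \<Rightarrow> (real \<Rightarrow> real \<Rightarrow> real) \<Rightarrow> bool" where
  "small_rem L R \<longleftrightarrow> (\<exists>C\<ge>0. \<forall>s t. 0 \<le> s \<and> s \<le> t \<and> t \<le> L \<longrightarrow> \<bar>R s t\<bar> \<le> C * (t - s)\<^sup>2)"

lemma small_rem_0: "small_rem L (\<lambda>s t. 0)"
  by (auto simp: small_rem_def intro: exI[of _ 0])

lemma small_rem_cong:
  "small_rem L R \<Longrightarrow> (\<And>s t. 0 \<le> s \<Longrightarrow> s \<le> t \<Longrightarrow> t \<le> L \<Longrightarrow> R s t = R' s t) \<Longrightarrow> small_rem L R'"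
  unfolding small_rem_def by metis

lemma small_rem_add:
  assumes "small_rem L R" "small_rem L R'" shows "small_rem L (\<lambda>s t. R s t + R' s t)"
proof -
  from assms obtain C C' where C: "0 \<le> C" "0 \<le> C'"
    "\<And>s t. 0 \<le> s \<Longrightarrow> s \<le> t \<Longrightarrow> t \<le> L \<Longrightarrow> \<bar>R s t\<bar> \<le> C * (t - s)\<^sup>2"
    "\<And>s t. 0 \<le> s \<Longrightarrow> s \<le> t \<Longrightarrow> t \<le> L \<Longrightarrow> \<bar>R' s t\<bar> \<le> C' * (t - s)\<^sup>2"
    unfolding small_rem_def by metis
  have "\<bar>R s t + R' s t\<bar> \<le> (C + C') * (t - s)\<^sup>2" if "0 \<le> s" "s \<le> t" "t \<le> L" for s t
    using C(3)[OF that] C(4)[OF that] by (simp add: distrib_right)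
  then show ?thesis unfolding small_rem_def using C by (intro exI[of _ "C + C'"]) auto
qed

lemma small_rem_mult:
  assumes "small_rem L R" and f: "\<And>s. 0 \<le> s \<Longrightarrow> s \<le> L \<Longrightarrow> \<bar>f s\<bar> \<le> B"
  shows "small_rem L (\<lambda>s t. f s * R s t)"
proof -
  from assms obtain C where C: "0 \<le> C"
    "\<And>s t. 0 \<le> s \<Longrightarrow> s \<le> t \<Longrightarrow> t \<le> L \<Longrightarrow> \<bar>R s t\<bar> \<le> C * (t - s)\<^sup>2"
    unfolding small_rem_def by metis
  have "\<bar>f s * R s t\<bar> \<le> (\<bar>B\<bar> * C) * (t - s)\<^sup>2" if "0 \<le> s" "s \<le> t" "t \<le> L" for s t
  proof -
    have "\<bar>f s\<bar> \<le> \<bar>B\<bar>" using f[of s] that by linarith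
    then show ?thesis unfolding abs_mult mult.assoc using C(2)[OF that] by (intro mult_mono) auto
  qed
  then show ?thesis unfolding small_rem_def using C by (intro exI[of _ "\<bar>B\<bar> * C"]) auto
qed

lemma small_rem_minus: "small_rem L R \<Longrightarrow> small_rem L (\<lambda>s t. - R s t)"
  by (simp add: small_rem_def)

lemma small_rem_diff:
  "small_rem L R \<Longrightarrow> small_rem L R' \<Longrightarrow> small_rem L (\<lambda>s t. R s t - R' s t)"
  using small_rem_add[OF _ small_rem_minus] by simp

lemma small_rem_lipschitz_mult:
  assumes "\<And>s t. 0 \<le> s \<Longrightarrow> s \<le> t \<Longrightarrow> t \<le> L \<Longrightarrow> \<bar>R s t\<bar> \<le> C * (t - s)" "0 \<le> C"
    "\<And>s t. 0 \<le> s \<Longrightarrow> s \<le> t \<Longrightarrow> t \<le> L \<Longrightarrow> \<bar>R' s t\<bar> \<le> C' * (t - s)" "0 \<le> C'"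
  shows "small_rem L (\<lambda>s t. R s t * R' s t)"
proof -
  have "\<bar>R s t * R' s t\<bar> \<le> (C * C') * (t - s)\<^sup>2" if "0 \<le> s" "s \<le> t" "t \<le> L" for s t
  proof -
    have "\<bar>R s t * R' s t\<bar> \<le> (C * (t - s)) * (C' * (t - s))"
      unfolding abs_mult using assms that by (intro mult_mono) auto
    then show ?thesis by (simp add: power2_eq_square algebra_simps)
  qed
  then show ?thesis unfolding small_rem_def using assms by (intro exI[of _ "C * C'"]) auto
qed

lemma small_rem_const:
  assumes "small_rem L (\<lambda>s t. \<phi> t - \<phi> s)" "0 \<le> s" "s \<le> t" "t \<le> L"
  shows "\<phi> t = \<phi> s"
proof -
  from assms obtain C where
    "\<And>s t. 0 \<le> s \<Longrightarrow> s \<le> t \<Longrightarrow> t \<le> L \<Longrightarrow> \<bar>\<phi> t - \<phi> s\<bar> \<le> C * (t - s)\<^sup>2"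
    unfolding small_rem_def by metis
  then have "\<bar>\<phi> t - \<phi> s\<bar> \<le> 0 * (t - s)"
    using assms by (intro increment_bound[where C = C]) auto
  then show ?thesis by simp
qed

lemma curve_primitive_rem:
  "curve L G \<Longrightarrow> small_rem L (\<lambda>s t. cf (G t) (w @ [j]) - cf (G s) (w @ [j])
      - cf (G s) w * (cf (G t) [j] - cf (G s) [j]))"
  using curve_primitive[of L G w j] unfolding small_rem_def by metis

text \<open>Induction on the word: by \<open>curve_primitive\<close> the difference of the coefficients at \<open>w @ [j]\<close> has vanishing
  derivative once the coefficients at \<open>w\<close> agree.\<close>

lemma curve_lift_unique:
  assumes G: "curve L G" and H: "curve L H"
    and eq: "\<And>t j. 0 \<le> t \<Longrightarrow> t \<le> L \<Longrightarrow> cf (G t) [j] = cf (H t) [j]"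
    and t: "0 \<le> t" "t \<le> L"
  shows "G t = H t"
proof (rule series_eqI)
  fix w show "cf (G t) w = cf (H t) w" using t
  proof (induction w arbitrary: t rule: rev_induct)
    case Nil
    then show ?case using curve_unip[OF G, of t] curve_unip[OF H, of t] by (simp add: unip_def)
  next
    case (snoc j w)
    define \<phi> where "\<phi> t = cf (G t) (w @ [j]) - cf (H t) (w @ [j])" for t
    have "small_rem L (\<lambda>s t. \<phi> t - \<phi> s)"
      by (rule small_rem_cong[OF small_rem_diff[OF curve_primitive_rem[OF G, of w j] curve_primitive_rem[OF H, of w j]]])
        (simp add: snoc.IH eq \<phi>_def)
    then have "\<phi> t = \<phi> 0" using snoc.prems by (intro small_rem_const) auto
    then show ?case using G H by (simp add: \<phi>_def curve_0)
  qed
qed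

lemma curve_constant:
  assumes G: "curve L G" and st: "0 \<le> s" "s \<le> t" "t \<le> L"
    and c: "\<And>u j. s \<le> u \<Longrightarrow> u \<le> t \<Longrightarrow> cf (G u) [j] = cf (G s) [j]"
  shows "G t = G s"
proof -
  define H where "H u = tinv (G s) * G (s + u)" for u
  have H: "curve (t - s) H" unfolding H_def
    using curve_restrict[OF curve_shift[OF G]] st by simp
  have "H (t - s) = 1"
  proof (rule curve_lift_unique[OF H curve_const])
    fix u j assume "0 \<le> u" "u \<le> t - s"
    then show "cf (H u) [j] = cf 1 [j]"
      using curve_singleton_diff[OF G, of s "s + u" j] c[of "s + u" j] st by (simp add: H_def)
  qed (use st in auto)
  then show ?thesis using curve_unip[OF G, of s] st
    by (metis H_def add_diff_cancel_left' add_diff_eq mult_tinv_assoc(1) mult.right_neutral order_trans)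
qed

section \<open>Shuffle products\<close>

text \<open>The recursion takes letters off the front, whereas integration adds them at the end of a
  word; hence the arguments are reversed words.\<close>

fun shuffle_words :: "'a list \<Rightarrow> 'a list \<Rightarrow> 'a list list" where
  "shuffle_words [] v = [v]"
| "shuffle_words u [] = [u]"
| "shuffle_words (i # u) (j # v) =
     map ((#) i) (shuffle_words u (j # v)) @ map ((#) j) (shuffle_words (i # u) v)"

lemma shuffle_words_nonempty:
  "w \<in> set (shuffle_words (i # u) v) \<Longrightarrow> w \<noteq> []"
  by (cases v) auto

text \<open>By the product rule both sides have the same derivative: the integrals for the last letters of
  the two words contribute the two halves of the shuffle recursion.\<close>

lemma curve_shuffle:
  assumes G: "curve L G"
  shows "0 \<le> t \<Longrightarrow> t \<le> L \<Longrightarrow>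
    cf (G t) (rev u) * cf (G t) (rev v) = (\<Sum>w\<leftarrow>shuffle_words u v. cf (G t) (rev w))"
proof (induction u v arbitrary: t rule: shuffle_words.induct)
  case (1 v)
  then show ?case using curve_unip[OF G, of t] by (simp add: unip_def)
next
  case (2 i u)
  then show ?case using curve_unip[OF G, of t] by (simp add: unip_def)
next
  case (3 i u j v)
  define a where "a w t = cf (G t) (rev w)" for w t
  have IH1: "(\<Sum>w\<leftarrow>shuffle_words u (j # v). a w t) = a u t * a (j # v) t" if "0 \<le> t" "t \<le> L" for t
    using 3(1)[OF that] unfolding a_def by simp
  have IH2: "(\<Sum>w\<leftarrow>shuffle_words (i # u) v. a w t) = a (i # u) t * a v t" if "0 \<le> t" "t \<le> L" for t
    using 3(2)[OF that] unfolding a_def by simp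
  have prim: "small_rem L (\<lambda>s t. a (k # w) t - a (k # w) s - a w s * (a [k] t - a [k] s))" for k w
    using curve_primitive_rem[OF G, of "rev w" k] by (simp add: a_def)
  have primsum: "small_rem L (\<lambda>s t. (\<Sum>w\<leftarrow>ws. a (k # w) t) - (\<Sum>w\<leftarrow>ws. a (k # w) s)
      - (\<Sum>w\<leftarrow>ws. a w s) * (a [k] t - a [k] s))" for k ws
  proof (induction ws)
    case (Cons w ws)
    show ?case
      by (rule small_rem_cong[OF small_rem_add[OF prim[of k w] Cons]]) (simp add: algebra_simps)
  qed (simp add: small_rem_0)
  have bd: "\<bar>a w s\<bar> \<le> L ^ length w / fact (length w)" if "0 \<le> s" "s \<le> L" for w s
    using curve_bounded[OF G that, of "rev w"] by (simp add: a_def)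
  have incr: "small_rem L (\<lambda>s t. (a w t - a w s) * (a w' t - a w' s))" for w w'
  proof -
    obtain C C' where C: "0 \<le> C" "\<And>s t. 0 \<le> s \<Longrightarrow> s \<le> t \<Longrightarrow> t \<le> L \<Longrightarrow> \<bar>a w t - a w s\<bar> \<le> C * (t - s)"
      and C': "0 \<le> C'" "\<And>s t. 0 \<le> s \<Longrightarrow> s \<le> t \<Longrightarrow> t \<le> L \<Longrightarrow> \<bar>a w' t - a w' s\<bar> \<le> C' * (t - s)"
      using curve_lipschitz[OF G, of "rev w"] curve_lipschitz[OF G, of "rev w'"] unfolding a_def by metis
    show ?thesis by (rule small_rem_lipschitz_mult[OF C(2,1) C'(2,1)])
  qed
  define \<phi> where "\<phi> t = a (i # u) t * a (j # v) t
    - (\<Sum>w\<leftarrow>shuffle_words (i # u) (j # v). a w t)" for t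
  have "small_rem L (\<lambda>s t. \<phi> t - \<phi> s)"
  proof (rule small_rem_cong)
    show "small_rem L (\<lambda>s t.
       (a (i # u) s * (a (j # v) t - a (j # v) s - a v s * (a [j] t - a [j] s)) +
        a (j # v) s * (a (i # u) t - a (i # u) s - a u s * (a [i] t - a [i] s)) +
        (a (i # u) t - a (i # u) s) * (a (j # v) t - a (j # v) s)) -
       (((\<Sum>w\<leftarrow>shuffle_words u (j # v). a (i # w) t) - (\<Sum>w\<leftarrow>shuffle_words u (j # v). a (i # w) s)
         - (\<Sum>w\<leftarrow>shuffle_words u (j # v). a w s) * (a [i] t - a [i] s)) +
        ((\<Sum>w\<leftarrow>shuffle_words (i # u) v. a (j # w) t) - (\<Sum>w\<leftarrow>shuffle_words (i # u) v. a (j # w) s)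
         - (\<Sum>w\<leftarrow>shuffle_words (i # u) v. a w s) * (a [j] t - a [j] s))))"
      by (rule small_rem_diff[OF
            small_rem_add[OF small_rem_add[OF small_rem_mult[OF prim bd] small_rem_mult[OF prim bd]] incr]
            small_rem_add[OF primsum primsum]])
  next
    fix s t assume "0 \<le> s" "s \<le> t" "t \<le> L"
    then have "0 \<le> s" "s \<le> L" by auto
    note IH = IH1[OF this] IH2[OF this]
    show "(a (i # u) s * (a (j # v) t - a (j # v) s - a v s * (a [j] t - a [j] s)) +
        a (j # v) s * (a (i # u) t - a (i # u) s - a u s * (a [i] t - a [i] s)) +
        (a (i # u) t - a (i # u) s) * (a (j # v) t - a (j # v) s)) -
       (((\<Sum>w\<leftarrow>shuffle_words u (j # v). a (i # w) t) - (\<Sum>w\<leftarrow>shuffle_words u (j # v). a (i # w) s)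
         - (\<Sum>w\<leftarrow>shuffle_words u (j # v). a w s) * (a [i] t - a [i] s)) +
        ((\<Sum>w\<leftarrow>shuffle_words (i # u) v. a (j # w) t) - (\<Sum>w\<leftarrow>shuffle_words (i # u) v. a (j # w) s)
         - (\<Sum>w\<leftarrow>shuffle_words (i # u) v. a w s) * (a [j] t - a [j] s))) = \<phi> t - \<phi> s"
      unfolding IH by (simp add: \<phi>_def o_def algebra_simps)
  qed
  then have "\<phi> t = \<phi> 0" using 3(3,4) by (intro small_rem_const) auto
  also have "\<phi> 0 = 0"
  proof -
    have z: "a w 0 = 0" if "w \<noteq> []" for w using curve_0[OF G] that by (simp add: a_def)
    have "(\<Sum>w\<leftarrow>shuffle_words (i # u) (j # v). a w 0) = (\<Sum>w\<leftarrow>shuffle_words (i # u) (j # v). 0)"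
      using shuffle_words_nonempty z by (intro arg_cong[where f = sum_list] map_cong) auto
    then show ?thesis using z[of "i # u"] by (simp add: \<phi>_def)
  qed
  finally show ?case by (simp add: \<phi>_def a_def)
qed

section \<open>Signatures have no loops\<close>

definition word_poly :: "(real \<times> 'n list) list \<Rightarrow> 'n tensors \<Rightarrow> real" where
  "word_poly P x = (\<Sum>(c, w)\<leftarrow>P. c * x w)"

definition word_integral :: "(real \<times> 'n list) list \<Rightarrow> 'n \<Rightarrow> 'n tensors \<Rightarrow> real" where
  "word_integral P j x = (\<Sum>(c, w)\<leftarrow>P. c * x (w @ [j]))"

text \<open>Membership only concerns the values on \<open>K\<close>, as the shuffle identity, to which closure under products is
  due, holds for signatures but not for arbitrary tensors.\<close>

definition word_algebra :: "'n tensors set \<Rightarrow> ('n tensors \<Rightarrow> real) set" where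
  "word_algebra K = {f. \<exists>P. \<forall>x\<in>K. f x = word_poly P x}"

lemma word_algebra_add:
  assumes "f \<in> word_algebra K" "g \<in> word_algebra K"
  shows "(\<lambda>x. f x + g x) \<in> word_algebra K"
proof -
  from assms obtain P Q where "\<forall>x\<in>K. f x = word_poly P x" "\<forall>x\<in>K. g x = word_poly Q x"
    by (auto simp: word_algebra_def)
  then have "\<forall>x\<in>K. f x + g x = word_poly (P @ Q) x" by (simp add: word_poly_def)
  then show ?thesis unfolding word_algebra_def by blast
qed

lemma word_algebra_scale:
  assumes "f \<in> word_algebra K" shows "(\<lambda>x. c * f x) \<in> word_algebra K"
proof -
  from assms obtain P where P: "\<forall>x\<in>K. f x = word_poly P x"
    by (auto simp: word_algebra_def)
  have "word_poly (map (\<lambda>(d, w). (c * d, w)) P) x = c * word_poly P x" for x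
    by (induction P) (auto simp: word_poly_def algebra_simps)
  with P have "\<forall>x\<in>K. c * f x = word_poly (map (\<lambda>(d, w). (c * d, w)) P) x" by simp
  then show ?thesis unfolding word_algebra_def by blast
qed

lemma word_algebra_coordinate: "(\<lambda>x. x w) \<in> word_algebra K"
  unfolding word_algebra_def by (simp, rule exI[of _ "[(1, w)]"]) (simp add: word_poly_def)

lemma word_algebra_mult:
  assumes shuffle: "\<And>x u v. x \<in> K \<Longrightarrow> x (rev u) * x (rev v) = (\<Sum>w\<leftarrow>shuffle_words u v. x (rev w))"
    and f: "f \<in> word_algebra K" and g: "g \<in> word_algebra K"
  shows "(\<lambda>x. f x * g x) \<in> word_algebra K"
proof -
  have zero: "(\<lambda>x. 0) \<in> word_algebra K"
    unfolding word_algebra_def by (simp, rule exI[of _ "[]"]) (simp add: word_poly_def)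
  have cong: "h \<in> word_algebra K" if "h' \<in> word_algebra K" "\<And>x. x \<in> K \<Longrightarrow> h x = h' x" for h h'
    using that by (simp add: word_algebra_def)
  have coord: "(\<lambda>x. x u * x v) \<in> word_algebra K" for u v
  proof (rule cong)
    have "(\<lambda>x. \<Sum>w\<leftarrow>ws. x (rev w)) \<in> word_algebra K" for ws
      by (induction ws) (simp_all add: zero word_algebra_add word_algebra_coordinate)
    then show "(\<lambda>x. \<Sum>w\<leftarrow>shuffle_words (rev u) (rev v). x (rev w)) \<in> word_algebra K" .
  qed (use shuffle[of _ "rev u" "rev v"] in simp)
  have left: "(\<lambda>x. x u * word_poly Q x) \<in> word_algebra K" for u Q
  proof (induction Q)
    case (Cons q Q)
    obtain c w where q: "q = (c, w)" by force
    show ?case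
      by (rule cong[OF word_algebra_add[OF word_algebra_scale[OF coord, of c u w] Cons]])
        (simp add: word_poly_def q algebra_simps)
  qed (simp add: zero word_poly_def)
  have prod: "(\<lambda>x. word_poly P x * word_poly Q x) \<in> word_algebra K" for P Q
  proof (induction P)
    case (Cons p P)
    obtain c w where p: "p = (c, w)" by force
    show ?case
      by (rule cong[OF word_algebra_add[OF word_algebra_scale[OF left, of c w Q] Cons]])
        (simp add: word_poly_def p algebra_simps)
  qed (simp add: zero word_poly_def)
  from f g obtain P Q where PQ: "\<forall>x\<in>K. f x = word_poly P x" "\<forall>x\<in>K. g x = word_poly Q x"
    by (auto simp: word_algebra_def)
  show ?thesis by (rule cong[OF prod[of P Q]]) (simp add: PQ)
qed

lemma word_algebra_ring:
  fixes K :: "'n::finite tensors set"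
  assumes K: "compact K"
    and unit: "\<And>x. x \<in> K \<Longrightarrow> x [] = 1"
    and shuffle: "\<And>x u v. x \<in> K \<Longrightarrow> x (rev u) * x (rev v) = (\<Sum>w\<leftarrow>shuffle_words u v. x (rev w))"
  shows "function_ring_on (word_algebra K) K"
proof
  show "compact K" by fact
next
  fix f assume "f \<in> word_algebra K"
  then obtain P where P: "\<forall>x\<in>K. f x = word_poly P x" by (auto simp: word_algebra_def)
  have "continuous_on K (word_poly P)"
  proof (induction P)
    case (Cons p P)
    have "continuous_on K (\<lambda>x. fst p * x (snd p) + word_poly P x)"
      by (intro continuous_intros Cons continuous_on_product_coordinates[THEN continuous_on_subset]) auto
    then show ?case by (simp add: word_poly_def case_prod_unfold)
  qed (simp add: word_poly_def)
  then show "continuous_on K f" using P by (simp cong: continuous_on_cong_simp)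
next
  fix c :: real
  have "\<forall>x\<in>K. c = word_poly [(c, [])] x" using unit by (simp add: word_poly_def)
  then show "(\<lambda>_. c) \<in> word_algebra K" unfolding word_algebra_def by blast
next
  fix x y :: "'n tensors" assume "x \<noteq> y"
  then obtain w where "x w \<noteq> y w" by blast
  then show "\<exists>f\<in>word_algebra K. f x \<noteq> f y"
    by (intro bexI[of _ "\<lambda>x. x w"] word_algebra_coordinate)
next
  fix f g assume fg: "f \<in> word_algebra K" "g \<in> word_algebra K"
  show "(\<lambda>x. f x + g x) \<in> word_algebra K" using fg by (rule word_algebra_add)
  show "(\<lambda>x. f x * g x) \<in> word_algebra K" by (rule word_algebra_mult[OF _ fg]) (rule shuffle)
qed

lemma curve_continuous:
  assumes G: "curve L G" shows "continuous_on {0..L} (\<lambda>t. cf (G t))"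
proof (rule continuous_on_coordinatewise_then_product)
  fix w
  obtain C where C: "0 \<le> C" "\<And>s t. 0 \<le> s \<Longrightarrow> s \<le> t \<Longrightarrow> t \<le> L \<Longrightarrow> \<bar>cf (G t) w - cf (G s) w\<bar> \<le> C * (t - s)"
    using curve_lipschitz[OF G, of w] by blast
  have "C-lipschitz_on {0..L} (\<lambda>t. cf (G t) w)"
  proof (rule lipschitz_onI)
    fix s t assume "s \<in> {0..L}" "t \<in> {0..L}"
    then show "dist (cf (G s) w) (cf (G t) w) \<le> C * dist s t"
      using C(2)[of s t] C(2)[of t s] by (cases "s \<le> t") (auto simp: dist_real_def)
  qed (use C in auto)
  then show "continuous_on {0..L} (\<lambda>t. cf (G t) w)" by (rule lipschitz_on_continuous_on)
qed

lemma word_integral_rem: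
  assumes "curve L G"
  shows "small_rem L (\<lambda>s t. word_integral P j (cf (G t)) - word_integral P j (cf (G s))
    - word_poly P (cf (G s)) * (cf (G t) [j] - cf (G s) [j]))"
proof (induction P)
  case Nil
  then show ?case by (simp add: word_integral_def word_poly_def small_rem_0)
next
  case (Cons p P)
  have "small_rem L (\<lambda>s t. fst p * (cf (G t) (snd p @ [j]) - cf (G s) (snd p @ [j])
      - cf (G s) (snd p) * (cf (G t) [j] - cf (G s) [j])))"
    by (rule small_rem_mult[OF curve_primitive_rem[OF assms], of _ "\<bar>fst p\<bar>"]) simp
  from small_rem_add[OF this Cons] show ?case
    by (rule small_rem_cong) (simp add: word_integral_def word_poly_def case_prod_unfold algebra_simps)
qed

text \<open>\<open>word_integral P j\<close> integrates \<open>word_poly P\<close> against the coordinate \<open>j\<close> of the curve. With \<open>\<kappa> = 0\<close> this is the bound of an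
  integral by the supremum, with \<open>\<kappa> = 1\<close> it compares the integral with the increment of the coordinate.\<close>

lemma word_integral_bound:
  assumes G: "curve L G" and st: "0 \<le> s" "s \<le> t" "t \<le> L"
    and M: "\<And>u. s \<le> u \<Longrightarrow> u \<le> t \<Longrightarrow> \<bar>word_poly P (cf (G u)) - \<kappa>\<bar> \<le> M"
  shows "\<bar>word_integral P j (cf (G t)) - word_integral P j (cf (G s))
      - \<kappa> * (cf (G t) [j] - cf (G s) [j])\<bar> \<le> M * (t - s)"
proof -
  define \<phi> where "\<phi> u = word_integral P j (cf (G u)) - \<kappa> * cf (G u) [j]" for u
  obtain C where C: "\<And>u v. 0 \<le> u \<Longrightarrow> u \<le> v \<Longrightarrow> v \<le> L \<Longrightarrow>
      \<bar>word_integral P j (cf (G v)) - word_integral P j (cf (G u))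
        - word_poly P (cf (G u)) * (cf (G v) [j] - cf (G u) [j])\<bar> \<le> C * (v - u)\<^sup>2"
    using word_integral_rem[OF G, of P j] unfolding small_rem_def by metis
  have "\<bar>\<phi> v - \<phi> u\<bar> \<le> M * (v - u) + C * (v - u)\<^sup>2" if "s \<le> u" "u \<le> v" "v \<le> t" for u v
  proof -
    have uv: "0 \<le> u" "u \<le> v" "v \<le> L" "u \<le> t" using that st by auto
    have "\<bar>(word_poly P (cf (G u)) - \<kappa>) * (cf (G v) [j] - cf (G u) [j])\<bar> \<le> M * (v - u)"
      unfolding abs_mult using M[of u] curve_singleton_abs[OF G uv(1-3), of j] that uv
      by (intro mult_mono) auto
    moreover have "\<phi> v - \<phi> u = (word_poly P (cf (G u)) - \<kappa>) * (cf (G v) [j] - cf (G u) [j])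
      + (word_integral P j (cf (G v)) - word_integral P j (cf (G u))
        - word_poly P (cf (G u)) * (cf (G v) [j] - cf (G u) [j]))"
      unfolding \<phi>_def by (simp add: algebra_simps)
    ultimately show ?thesis using C[OF uv(1-3)] by linarith
  qed
  from increment_bound[OF this st(2)] show ?thesis by (simp add: \<phi>_def algebra_simps)
qed

text \<open>The heart of the tree property. A bump function supported on the part of \<open>H\<close> off \<open>G\<close> is approximated by
  word polynomials, whose integrals along \<open>G\<close> and \<open>H\<close> depend on the common end point only and
  hence agree. The integral along \<open>G\<close> is nearly \<open>0\<close>, the one along \<open>H\<close> nearly the increment of the
  coordinate between \<open>s\<close> and \<open>t\<close>.\<close>

lemma curve_coordinate_constant:
  fixes G H :: "real \<Rightarrow> 'n::finite series"
  assumes G: "curve L G" "0 \<le> L" and H: "curve M H" "0 \<le> M" and ends: "G L = H M"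
    and inj: "inj_on H {0..M}"
    and pq: "0 \<le> p" "p < s" "s \<le> t" "t < q" "q \<le> M"
    and disj: "\<And>r. p \<le> r \<Longrightarrow> r \<le> q \<Longrightarrow> H r \<notin> G ` {0..L}"
  shows "cf (H t) [j] = cf (H s) [j]"
proof -
  define g where "g = (\<lambda>r. cf (G r))"
  define h where "h = (\<lambda>r. cf (H r))"
  define K1 K2 where "K1 = g ` {0..L}" and "K2 = h ` {0..M}"
  define D where "D = \<bar>cf (H t) [j] - cf (H s) [j]\<bar>"
  have cg: "continuous_on {0..L} g" and ch: "continuous_on {0..M} h"
    unfolding g_def h_def using curve_continuous[OF G(1)] curve_continuous[OF H(1)] .
  have K12: "compact K1" "compact K2"
    unfolding K1_def K2_def
    by (rule compact_continuous_image[OF cg compact_Icc] compact_continuous_image[OF ch compact_Icc])+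
  have injh: "inj_on h {0..M}"
  proof (rule inj_onI)
    fix x y assume xy: "x \<in> {0..M}" "y \<in> {0..M}" and "h x = h y"
    then have "H x = H y" by (simp add: h_def cf_inject)
    then show "x = y" using inj xy by (simp add: inj_onD)
  qed
  define \<sigma> where "\<sigma> = the_inv_into {0..M} h"
  have \<sigma>: "\<sigma> (h r) = r" if "0 \<le> r" "r \<le> M" for r
    using that by (simp add: \<sigma>_def the_inv_into_f_f[OF injh])
  have c\<sigma>: "continuous_on K2 \<sigma>"
    unfolding \<sigma>_def K2_def by (rule continuous_on_inv_into[OF ch compact_Icc injh])
  have notK1: "h r \<notin> K1" if "p \<le> r" "r \<le> q" for r
    using disj[OF that] by (auto simp: K1_def g_def h_def cf_inject)
  have ring: "function_ring_on (word_algebra (K1 \<union> K2)) (K1 \<union> K2)"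
  proof (rule word_algebra_ring)
    show "compact (K1 \<union> K2)" using K12 by (rule compact_Un)
  next
    fix x assume "x \<in> K1 \<union> K2"
    then show "x [] = 1" using curve_unip[OF G(1)] curve_unip[OF H(1)]
      by (auto simp: K1_def K2_def g_def h_def unip_def)
  next
    fix x u v assume "x \<in> K1 \<union> K2"
    then show "x (rev u) * x (rev v) = (\<Sum>w\<leftarrow>shuffle_words u v. x (rev w))"
      using curve_shuffle[OF G(1)] curve_shuffle[OF H(1)] by (auto simp: K1_def K2_def g_def h_def)
  qed
  define \<eta>0 where "\<eta>0 = min 1 (min (s - p) (q - t))"
  have \<eta>0: "0 < \<eta>0" "\<eta>0 \<le> 1" "\<eta>0 \<le> s - p" "\<eta>0 \<le> q - t" using pq by (auto simp: \<eta>0_def)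
  define B where "B = L + M + 2"
  have bound: "D \<le> \<eta> * B" if \<eta>: "0 < \<eta>" "\<eta> \<le> \<eta>0" for \<eta>
  proof -
    \<comment> \<open>The trapezoid that is 1 on \<open>{s..t}\<close> and 0 outside \<open>{s - \<eta>..t + \<eta>}\<close>; the function \<open>f\<close> below carries it over to the image of \<open>H\<close>.\<close>
    define \<phi> where "\<phi> r = max 0 (1 - (max 0 (s - r) + max 0 (r - t)) / \<eta>)" for r
    have \<phi>1: "\<phi> r = 1" if "s \<le> r" "r \<le> t" for r using that by (simp add: \<phi>_def)
    have \<phi>01: "0 \<le> \<phi> r" "\<phi> r \<le> 1" for r using \<eta> by (auto simp: \<phi>_def)
    have \<phi>0: "\<phi> r = 0" if "r \<le> s - \<eta> \<or> t + \<eta> \<le> r" for r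
    proof -
      have "\<eta> \<le> max 0 (s - r) + max 0 (r - t)" using that by auto
      then show ?thesis using \<eta> by (simp add: \<phi>_def)
    qed
    define f where "f x = (if x \<in> K2 then \<phi> (\<sigma> x) else 0)" for x
    have fh: "f (h r) = \<phi> r" if "0 \<le> r" "r \<le> M" for r
      using that \<sigma>[OF that] by (auto simp: f_def K2_def)
    have fK1: "f x = 0" if "x \<in> K1" for x
    proof (cases "x \<in> K2")
      case True
      then obtain r where r: "0 \<le> r" "r \<le> M" "x = h r" by (auto simp: K2_def)
      then have "r < p \<or> q < r" using notK1[of r] that by force
      then have "\<phi> r = 0" using \<eta> \<eta>0 by (intro \<phi>0) auto
      then show ?thesis using r fh by simp
    qed (simp add: f_def)
    have "continuous_on (K1 \<union> K2) f"
    proof (rule continuous_on_closed_Un)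
      show "closed K1" "closed K2" using K12 by (auto intro: compact_imp_closed)
      show "continuous_on K1 f" using fK1 by (simp cong: continuous_on_cong)
      have "continuous_on K2 (\<lambda>x. \<phi> (\<sigma> x))" unfolding \<phi>_def
        using \<eta> by (intro continuous_intros c\<sigma>) auto
      then show "continuous_on K2 f" by (simp add: f_def cong: continuous_on_cong)
    qed
    from function_ring_on.Stone_Weierstrass_basic[OF ring this \<eta>(1)] obtain P where
      P: "\<And>x. x \<in> K1 \<union> K2 \<Longrightarrow> \<bar>f x - word_poly P x\<bar> < \<eta>"
      unfolding word_algebra_def by force
    have PG: "\<bar>word_poly P (cf (G r)) - 0\<bar> \<le> \<eta>" if "0 \<le> r" "r \<le> L" for r
    proof -
      have "cf (G r) \<in> K1" using that by (simp add: K1_def g_def)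
      then show ?thesis using P[of "cf (G r)"] fK1 by auto
    qed
    have PH: "\<bar>\<phi> r - word_poly P (cf (H r))\<bar> < \<eta>" if "0 \<le> r" "r \<le> M" for r
    proof -
      have "cf (H r) \<in> K2" using that by (simp add: K2_def h_def)
      then show ?thesis using P[of "cf (H r)"] fh[OF that] by (simp add: h_def)
    qed
    define I where "I r = word_integral P j (cf (H r))" for r
    have IG: "\<bar>I M - I 0\<bar> \<le> \<eta> * L"
      using word_integral_bound[OF G(1), of 0 L P 0 \<eta> j] PG G(2) ends curve_0[OF G(1)] curve_0[OF H(1)]
      by (simp add: I_def)
    have se: "0 \<le> s - \<eta>" "t + \<eta> \<le> M" using \<eta> \<eta>0 pq by auto
    have out: "\<bar>I v - I u\<bar> \<le> \<eta> * (v - u)"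
      if "0 \<le> u" "u \<le> v" "v \<le> M" "v \<le> s - \<eta> \<or> t + \<eta> \<le> u" for u v
    proof -
      have "\<bar>word_poly P (cf (H r)) - 0\<bar> \<le> \<eta>" if "u \<le> r" "r \<le> v" for r
        using PH[of r] \<phi>0[of r] that \<open>0 \<le> u\<close> \<open>v \<le> M\<close> \<open>v \<le> s - \<eta> \<or> t + \<eta> \<le> u\<close> by auto
      from word_integral_bound[OF H(1) that(1-3) this, of j] show ?thesis by (simp add: I_def)
    qed
    have edge: "\<bar>I v - I u\<bar> \<le> (1 + \<eta>) * (v - u)" if "0 \<le> u" "u \<le> v" "v \<le> M" for u v
    proof -
      have "\<bar>word_poly P (cf (H r)) - 0\<bar> \<le> 1 + \<eta>" if "u \<le> r" "r \<le> v" for r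
        using PH[of r] \<phi>01[of r] that \<open>0 \<le> u\<close> \<open>v \<le> M\<close> by auto
      from word_integral_bound[OF H(1) that(1-3) this, of j] show ?thesis by (simp add: I_def)
    qed
    have mid: "\<bar>I t - I s - (cf (H t) [j] - cf (H s) [j])\<bar> \<le> \<eta> * (t - s)"
    proof -
      have st: "0 \<le> s" "s \<le> t" "t \<le> M" using pq by auto
      have "\<bar>word_poly P (cf (H r)) - 1\<bar> \<le> \<eta>" if "s \<le> r" "r \<le> t" for r
        using PH[of r] \<phi>1[of r] that st by auto
      from word_integral_bound[OF H(1) st this, of j] show ?thesis by (simp add: I_def)
    qed
    \<comment> \<open>The increments of \<open>I\<close> over the five pieces of \<open>{0..M}\<close> on which \<open>\<phi>\<close> is \<open>0\<close>, rises, is \<open>1\<close>, falls and is \<open>0\<close> again.\<close>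
    have "\<bar>I (s - \<eta>) - I 0\<bar> \<le> \<eta> * (s - \<eta>)" "\<bar>I M - I (t + \<eta>)\<bar> \<le> \<eta> * (M - (t + \<eta>))"
      "\<bar>I s - I (s - \<eta>)\<bar> \<le> (1 + \<eta>) * \<eta>" "\<bar>I (t + \<eta>) - I t\<bar> \<le> (1 + \<eta>) * \<eta>"
      using out[of 0 "s - \<eta>"] out[of "t + \<eta>" M] edge[of "s - \<eta>" s] edge[of t "t + \<eta>"] se pq \<eta> by auto
    with IG mid have "D \<le> \<eta> * L + \<eta> * (s - \<eta>) + \<eta> * (M - (t + \<eta>)) + 2 * ((1 + \<eta>) * \<eta>) + \<eta> * (t - s)"
      unfolding D_def by (simp only: abs_le_iff) linarith
    also have "\<dots> = \<eta> * B" by (simp add: B_def algebra_simps)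
    finally show ?thesis .
  qed
  have "D \<le> 0"
  proof (rule ccontr)
    assume "\<not> D \<le> 0"
    then have D: "0 < D" by simp
    have Bp: "0 < B" using G(2) H(2) by (simp add: B_def)
    have "D \<le> min \<eta>0 (D / (2 * B)) * B" using D Bp \<eta>0 by (intro bound) auto
    also have "\<dots> \<le> D / (2 * B) * B" using Bp by (intro mult_right_mono) auto
    also have "\<dots> < D" using D Bp by simp
    finally show False by simp
  qed
  then show ?thesis by (simp add: D_def)
qed

theorem curve_image_subset:
  fixes G H :: "real \<Rightarrow> 'n::finite series"
  assumes G: "curve L G" "0 \<le> L" and H: "curve M H" "0 \<le> M" and ends: "G L = H M"
    and inj: "inj_on H {0..M}"
  shows "H ` {0..M} \<subseteq> G ` {0..L}"
proof
  fix x assume "x \<in> H ` {0..M}"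
  then obtain t0 where t0: "0 \<le> t0" "t0 \<le> M" and x: "x = H t0" by auto
  show "x \<in> G ` {0..L}"
  proof (rule ccontr)
    assume nx: "x \<notin> G ` {0..L}"
    define g where "g = (\<lambda>r. cf (G r))"
  define h where "h = (\<lambda>r. cf (H r))"
    have cg: "continuous_on {0..L} g" and ch: "continuous_on {0..M} h"
      unfolding g_def h_def using curve_continuous[OF G(1)] curve_continuous[OF H(1)] .
    have Mp: "0 < M"
    proof (rule ccontr)
      assume "\<not> 0 < M"
      then have "x = 1" using t0 H x by (simp add: curve_0)
      then show False using nx curve_0[OF G(1)] G(2) by (metis atLeastAtMost_iff image_eqI order_refl)
    qed
    have K: "closed (g ` {0..L})"
      by (rule compact_imp_closed[OF compact_continuous_image[OF cg compact_Icc]])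
    have "h t0 \<in> - g ` {0..L}" using nx x by (auto simp: g_def h_def cf_inject)
    then obtain A where A: "open A" "t0 \<in> A" "A \<inter> {0..M} = h -` (- g ` {0..L}) \<inter> {0..M}"
      using ch K t0 unfolding continuous_on_open_invariant
      by (metis (no_types, lifting) IntI atLeastAtMost_iff open_Compl vimageI Int_iff)
    then obtain \<delta> where \<delta>: "0 < \<delta>" "\<And>r. \<bar>r - t0\<bar> < \<delta> \<Longrightarrow> r \<in> A"
      unfolding open_dist by (auto simp: dist_real_def)
    define p q where "p = max 0 (t0 - \<delta> / 2)" and "q = min M (t0 + \<delta> / 2)"
    have pq: "0 \<le> p" "p < q" "q \<le> M" using \<delta> t0 Mp by (auto simp: p_def q_def)
    have off: "H r \<notin> G ` {0..L}" if "p \<le> r" "r \<le> q" for r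
    proof -
      have "\<bar>r - t0\<bar> < \<delta>" using that \<delta>(1) t0 unfolding p_def q_def by linarith
      then have "r \<in> A \<inter> {0..M}" using \<delta> that pq by auto
      then have "h r \<notin> g ` {0..L}" unfolding A(3) by auto
      then show ?thesis by (auto simp: g_def h_def)
    qed
    define s t where "s = p + (q - p) / 3" and "t = q - (q - p) / 3"
    have st: "p < s" "s < t" "t < q" using pq by (auto simp: s_def t_def field_simps)
    have "H t = H s"
      using st pq off by (intro curve_constant[OF H(1)] curve_coordinate_constant[OF G H ends inj, of p _ _ q]) auto
    then show False using inj st pq by (auto dest: inj_onD)
  qed
qed

section \<open>Rectifiable paths and unit-speed curves\<close>

subsection \<open>Riemann-Stieltjes integrals along a curve\<close>

text \<open>Divisions that are fine for balls of fixed radius exist, so the limit is not vacuous.\<close>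

lemma has_RS_integral_unique:
  assumes I: "has_RS_integral f g a b I" and J: "has_RS_integral f g a b J"
  shows "I = J"
proof (rule ccontr)
  assume "I \<noteq> J"
  then have e: "0 < \<bar>I - J\<bar> / 2" by simp
  obtain \<delta> where \<delta>: "0 < \<delta>" "\<And>p. p tagged_division_of {a..b} \<Longrightarrow> (\<forall>(x, K)\<in>p. diameter K < \<delta>) \<Longrightarrow>
        \<bar>(\<Sum>(x, K)\<in>p. f x * (g (Sup K) - g (Inf K))) - I\<bar> < \<bar>I - J\<bar> / 2"
    using I[unfolded has_RS_integral_def, rule_format, OF e] by blast
  obtain \<delta>' where \<delta>': "0 < \<delta>'" "\<And>p. p tagged_division_of {a..b} \<Longrightarrow> (\<forall>(x, K)\<in>p. diameter K < \<delta>') \<Longrightarrow>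
        \<bar>(\<Sum>(x, K)\<in>p. f x * (g (Sup K) - g (Inf K))) - J\<bar> < \<bar>I - J\<bar> / 2"
    using J[unfolded has_RS_integral_def, rule_format, OF e] by blast
  define r where "r = min \<delta> \<delta>' / 3"
  have r: "0 < r" using \<delta>(1) \<delta>'(1) by (simp add: r_def)
  then obtain p where p: "p tagged_division_of {a..b}" "(\<lambda>x. ball x r) fine p"
    using fine_division_exists_real[of "\<lambda>x. ball x r"] by (auto simp: gauge_def)
  have "diameter K < min \<delta> \<delta>'" if "(x, K) \<in> p" for x K
  proof -
    have "K \<subseteq> ball x r" using p(2) that by (auto simp: fine_def)
    then have "diameter K \<le> diameter (ball x r)" by (intro diameter_subset) auto
    also have "\<dots> = 2 * r" using r by simp
    also have "\<dots> < min \<delta> \<delta>'" using \<delta>(1) \<delta>'(1) by (auto simp: r_def min_def)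
    finally show ?thesis .
  qed
  then have "\<forall>(x, K)\<in>p. diameter K < \<delta>" "\<forall>(x, K)\<in>p. diameter K < \<delta>'" by auto
  then show False
    using \<delta>(2)[OF p(1)] \<delta>'(2)[OF p(1)]
      abs_triangle_ineq4[of "(\<Sum>(x, K)\<in>p. f x * (g (Sup K) - g (Inf K))) - J"
        "(\<Sum>(x, K)\<in>p. f x * (g (Sup K) - g (Inf K))) - I"] by simp
qed

lemma RS_integral_eq: "has_RS_integral f g a b I \<Longrightarrow> RS_integral f g a b = I"
  unfolding RS_integral_def using has_RS_integral_unique by blast

lemma has_RS_integral_cong:
  assumes I: "has_RS_integral f g a b I"
    and f: "\<And>x. x \<in> {a..b} \<Longrightarrow> f' x = f x" and g: "\<And>x. x \<in> {a..b} \<Longrightarrow> g' x = g x + c"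
  shows "has_RS_integral f' g' a b I"
proof -
  have eq: "(\<Sum>(x, K)\<in>p. f' x * (g' (Sup K) - g' (Inf K))) = (\<Sum>(x, K)\<in>p. f x * (g (Sup K) - g (Inf K)))"
    if p: "p tagged_division_of {a..b}" for p
  proof (rule sum.cong[OF refl], clarify)
    fix x K assume xK: "(x, K) \<in> p"
    then obtain u v where "K = cbox u v" using p by blast
    moreover have "x \<in> K" "K \<subseteq> {a..b}" using p xK by blast+
    ultimately have "x \<in> {a..b}" "Sup K \<in> {a..b}" "Inf K \<in> {a..b}" by auto
    then show "f' x * (g' (Sup K) - g' (Inf K)) = f x * (g (Sup K) - g (Inf K))"
      by (simp add: f g)
  qed
  show ?thesis
    unfolding has_RS_integral_def
  proof (intro allI impI)
    fix \<epsilon> :: real assume "0 < \<epsilon>"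
    from I[unfolded has_RS_integral_def, rule_format, OF this] obtain \<delta> where
      "0 < \<delta>" and \<delta>: "\<And>p. p tagged_division_of {a..b} \<and> (\<forall>(x, K)\<in>p. diameter K < \<delta>) \<Longrightarrow>
        \<bar>(\<Sum>(x, K)\<in>p. f x * (g (Sup K) - g (Inf K))) - I\<bar> < \<epsilon>" by blast
    show "\<exists>\<delta>>0. \<forall>p. p tagged_division_of {a..b} \<and> (\<forall>(x, K)\<in>p. diameter K < \<delta>) \<longrightarrow>
        \<bar>(\<Sum>(x, K)\<in>p. f' x * (g' (Sup K) - g' (Inf K))) - I\<bar> < \<epsilon>"
    proof (intro exI[of _ \<delta>] conjI allI impI)
      fix p assume p: "p tagged_division_of {a..b} \<and> (\<forall>(x, K)\<in>p. diameter K < \<delta>)"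
      show "\<bar>(\<Sum>(x, K)\<in>p. f' x * (g' (Sup K) - g' (Inf K))) - I\<bar> < \<epsilon>"
        unfolding eq[OF conjunct1[OF p]] using p by (rule \<delta>)
    qed fact
  qed
qed

text \<open>The change of parameter \<open>\<tau>\<close> is arbitrary, continuous and monotone. On each interval of a division the error is
  quadratic in the increment of \<open>\<tau>\<close>, hence at most a small multiple of it, and these increments sum up
  to \<open>\<tau> b - \<tau> 0\<close>.\<close>

lemma curve_has_RS_integral:
  assumes G: "curve L G" and b: "0 \<le> b" "b \<le> 1"
    and \<tau>: "continuous_on {0..1} \<tau>" "\<And>s t. 0 \<le> s \<Longrightarrow> s \<le> t \<Longrightarrow> t \<le> 1 \<Longrightarrow> \<tau> s \<le> \<tau> t"
      "0 \<le> \<tau> 0" "\<tau> 1 \<le> L"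
  shows "has_RS_integral (\<lambda>t. cf (G (\<tau> t)) w) (\<lambda>t. cf (G (\<tau> t)) [j]) 0 b
    (cf (G (\<tau> b)) (w @ [j]) - cf (G (\<tau> 0)) (w @ [j]))"
  unfolding has_RS_integral_def
proof (intro allI impI)
  fix \<epsilon> :: real assume \<epsilon>: "0 < \<epsilon>"
  define f where "f r = cf (G r) w" for r
  define g where "g r = cf (G r) [j]" for r
  define F where "F r = cf (G r) (w @ [j])" for r
  obtain C where C: "0 \<le> C"
    "\<And>s t. 0 \<le> s \<Longrightarrow> s \<le> t \<Longrightarrow> t \<le> L \<Longrightarrow> \<bar>F t - F s - f s * (g t - g s)\<bar> \<le> C * (t - s)\<^sup>2"
    unfolding F_def f_def g_def using curve_primitive[OF G] by blast
  obtain C' where C': "0 \<le> C'"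
    "\<And>s t. 0 \<le> s \<Longrightarrow> s \<le> t \<Longrightarrow> t \<le> L \<Longrightarrow> \<bar>f t - f s\<bar> \<le> C' * (t - s)"
    unfolding f_def using curve_lipschitz[OF G] by blast
  have g: "\<bar>g t - g s\<bar> \<le> t - s" if "0 \<le> s" "s \<le> t" "t \<le> L" for s t
    unfolding g_def by (rule curve_singleton_abs[OF G that])
  define D where "D = C + C'"
  define T where "T = \<tau> b - \<tau> 0"
  have D: "0 \<le> D" and T: "0 \<le> T" using C C' \<tau>(2)[of 0 b] b by (auto simp: D_def T_def)
  define \<eta> where "\<eta> = \<epsilon> / (D * T + 1)"
  have \<eta>: "0 < \<eta>" "D * \<eta> * T < \<epsilon>"
  proof -
    have DT: "0 \<le> D * T" using D T by simp
    then show "0 < \<eta>" using \<epsilon> by (simp add: \<eta>_def)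
    have "D * \<eta> * T = \<epsilon> * (D * T / (D * T + 1))" by (simp add: \<eta>_def)
    also have "\<dots> < \<epsilon> * 1" using DT \<epsilon> by (intro mult_strict_left_mono) (auto simp: field_simps)
    finally show "D * \<eta> * T < \<epsilon>" by simp
  qed
  have "uniformly_continuous_on {0..1} \<tau>" using \<tau>(1) by (intro compact_uniformly_continuous) auto
  then obtain \<delta> where \<delta>: "0 < \<delta>"
    "\<And>x y. x \<in> {0..1} \<Longrightarrow> y \<in> {0..1} \<Longrightarrow> \<bar>y - x\<bar> < \<delta> \<Longrightarrow> \<bar>\<tau> y - \<tau> x\<bar> < \<eta>"
    unfolding uniformly_continuous_on_def using \<eta>(1) by (metis dist_real_def)
  show "\<exists>\<delta>>0. \<forall>p. p tagged_division_of {0..b} \<and> (\<forall>(x, K)\<in>p. diameter K < \<delta>) \<longrightarrow>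
      \<bar>(\<Sum>(x, K)\<in>p. cf (G (\<tau> x)) w * (cf (G (\<tau> (Sup K))) [j] - cf (G (\<tau> (Inf K))) [j]))
        - (cf (G (\<tau> b)) (w @ [j]) - cf (G (\<tau> 0)) (w @ [j]))\<bar> < \<epsilon>"
  proof (intro exI[of _ \<delta>] conjI allI impI)
    fix p assume "p tagged_division_of {0..b} \<and> (\<forall>(x, K)\<in>p. diameter K < \<delta>)"
    then have p: "p tagged_division_of {0..b}" and dp: "\<And>x K. (x, K) \<in> p \<Longrightarrow> diameter K < \<delta>" by auto
    have tele: "(\<Sum>(x, K)\<in>p. \<phi> (Sup K) - \<phi> (Inf K)) = \<phi> b - \<phi> 0" for \<phi> :: "real \<Rightarrow> real"
      by (rule additive_tagged_division_1[OF b(1) p])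
    have bound: "\<bar>f (\<tau> x) * (g (\<tau> (Sup K)) - g (\<tau> (Inf K))) - (F (\<tau> (Sup K)) - F (\<tau> (Inf K)))\<bar>
        \<le> D * \<eta> * (\<tau> (Sup K) - \<tau> (Inf K))" if xK: "(x, K) \<in> p" for x K
    proof -
      obtain u v where "K = cbox u v" using p xK by blast
      then have K: "K = {u..v}" by simp
      have "x \<in> K" "K \<subseteq> {0..b}" using p xK by blast+
      then have x: "u \<le> x" "x \<le> v" and uv: "0 \<le> u" "v \<le> b" unfolding K by auto
      have SI: "Sup K = v" "Inf K = u" using x unfolding K by auto
      have "dist v u \<le> diameter K" using x unfolding K by (intro diameter_bounded_bound) auto
      then have "\<bar>v - u\<bar> < \<delta>" using dp[OF xK] by (simp add: dist_real_def)
      then have small: "\<tau> v - \<tau> u \<le> \<eta>" using \<delta>(2)[of u v] x uv b by auto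
      have \<tau>m: "0 \<le> \<tau> u" "\<tau> u \<le> \<tau> x" "\<tau> x \<le> \<tau> v" "\<tau> v \<le> L"
        using \<tau>(2)[of 0 u] \<tau>(2)[of u x] \<tau>(2)[of x v] \<tau>(2)[of v 1] \<tau>(3,4) x uv b by auto
      have 1: "\<bar>F (\<tau> v) - F (\<tau> u) - f (\<tau> u) * (g (\<tau> v) - g (\<tau> u))\<bar> \<le> C * (\<tau> v - \<tau> u)\<^sup>2"
        using \<tau>m by (intro C) auto
      have 2: "\<bar>(f (\<tau> x) - f (\<tau> u)) * (g (\<tau> v) - g (\<tau> u))\<bar> \<le> (C' * (\<tau> v - \<tau> u)) * (\<tau> v - \<tau> u)"
      proof -
        have "\<bar>f (\<tau> x) - f (\<tau> u)\<bar> \<le> C' * (\<tau> x - \<tau> u)" using \<tau>m by (intro C') auto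
        also have "\<dots> \<le> C' * (\<tau> v - \<tau> u)" using \<tau>m C'(1) by (intro mult_left_mono) auto
        finally show ?thesis unfolding abs_mult using \<tau>m C'(1) by (intro mult_mono g) auto
      qed
      have "f (\<tau> x) * (g (\<tau> v) - g (\<tau> u)) - (F (\<tau> v) - F (\<tau> u))
        = (f (\<tau> x) - f (\<tau> u)) * (g (\<tau> v) - g (\<tau> u))
          - (F (\<tau> v) - F (\<tau> u) - f (\<tau> u) * (g (\<tau> v) - g (\<tau> u)))" by (simp add: algebra_simps)
      then have "\<bar>f (\<tau> x) * (g (\<tau> v) - g (\<tau> u)) - (F (\<tau> v) - F (\<tau> u))\<bar>
        \<le> (C' * (\<tau> v - \<tau> u)) * (\<tau> v - \<tau> u) + C * (\<tau> v - \<tau> u)\<^sup>2"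
        using 1 2 by linarith
      also have "\<dots> = D * (\<tau> v - \<tau> u) * (\<tau> v - \<tau> u)"
        by (simp add: D_def power2_eq_square algebra_simps)
      also have "\<dots> \<le> D * \<eta> * (\<tau> v - \<tau> u)"
        using small \<tau>m D by (intro mult_right_mono mult_left_mono) auto
      finally show ?thesis unfolding SI .
    qed
    have "\<bar>(\<Sum>(x, K)\<in>p. f (\<tau> x) * (g (\<tau> (Sup K)) - g (\<tau> (Inf K)))) - (F (\<tau> b) - F (\<tau> 0))\<bar>
      = \<bar>\<Sum>(x, K)\<in>p. f (\<tau> x) * (g (\<tau> (Sup K)) - g (\<tau> (Inf K))) - (F (\<tau> (Sup K)) - F (\<tau> (Inf K)))\<bar>"
      unfolding tele[of "\<lambda>t. F (\<tau> t)", symmetric] sum_subtractf[symmetric] by (simp add: case_prod_unfold)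
    also have "\<dots> \<le> (\<Sum>(x, K)\<in>p. D * \<eta> * (\<tau> (Sup K) - \<tau> (Inf K)))"
      using bound by (intro order_trans[OF sum_abs] sum_mono) auto
    also have "\<dots> = D * \<eta> * T"
      unfolding T_def tele[of \<tau>, symmetric] sum_distrib_left by (simp add: case_prod_unfold)
    also have "\<dots> < \<epsilon>" by fact
    finally show "\<bar>(\<Sum>(x, K)\<in>p. cf (G (\<tau> x)) w * (cf (G (\<tau> (Sup K))) [j] - cf (G (\<tau> (Inf K))) [j]))
        - (cf (G (\<tau> b)) (w @ [j]) - cf (G (\<tau> 0)) (w @ [j]))\<bar> < \<epsilon>"
      unfolding f_def g_def F_def .
  qed (fact \<delta>(1))
qed

lemma curve_iter_integral:
  assumes G: "curve L G" and \<tau>: "continuous_on {0..1} \<tau>" "\<And>s t. 0 \<le> s \<Longrightarrow> s \<le> t \<Longrightarrow> t \<le> 1 \<Longrightarrow> \<tau> s \<le> \<tau> t"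
      "\<tau> 0 = 0" "\<tau> 1 \<le> L"
    and \<gamma>: "\<And>t j. 0 \<le> t \<Longrightarrow> t \<le> 1 \<Longrightarrow> \<gamma> t $ j = cf (G (\<tau> t)) [j] + \<gamma> 0 $ j"
    and b: "0 \<le> b" "b \<le> 1"
  shows "iter_integral \<gamma> 0 w b = cf (G (\<tau> b)) (rev w)"
  using b
proof (induction w arbitrary: b)
  case Nil
  then have "unip (G (\<tau> b))" using \<tau>(2)[of 0 b] \<tau>(2)[of b 1] \<tau>(3,4) by (intro curve_unip[OF G]) auto
  then show ?case by (simp add: unip_def)
next
  case (Cons j w)
  have "has_RS_integral (iter_integral \<gamma> 0 w) (\<lambda>t. \<gamma> t $ j) 0 b
    (cf (G (\<tau> b)) (rev w @ [j]) - cf (G (\<tau> 0)) (rev w @ [j]))"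
  proof (rule has_RS_integral_cong[OF curve_has_RS_integral[OF G]])
    fix x assume "x \<in> {0..b}"
    then have x: "0 \<le> x" "x \<le> 1" using Cons.prems by auto
    show "iter_integral \<gamma> 0 w x = cf (G (\<tau> x)) (rev w)" using Cons.IH[OF x] .
    show "\<gamma> x $ j = cf (G (\<tau> x)) [j] + \<gamma> 0 $ j" using \<gamma>[OF x] .
  qed (use Cons.prems \<tau> in auto)
  from RS_integral_eq[OF this] show ?case using curve_0[OF G] \<tau>(3) by simp
qed

subsection \<open>Arc length\<close>

fun variation_sum :: "('a \<Rightarrow> 'a \<Rightarrow> real) \<Rightarrow> (real \<Rightarrow> 'a) \<Rightarrow> real list \<Rightarrow> real" where
  "variation_sum d \<gamma> (x # y # xs) = d (\<gamma> x) (\<gamma> y) + variation_sum d \<gamma> (y # xs)"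
| "variation_sum d \<gamma> xs = 0"

lemma variation_sum_eq:
  "variation_sum d \<gamma> ts = (\<Sum>i<length ts - 1. d (\<gamma> (ts ! i)) (\<gamma> (ts ! Suc i)))"
  by (induction ts rule: induct_list012) (simp_all add: sum.lessThan_Suc_shift del: sum.lessThan_Suc)

lemma path_length_eq:
  assumes "\<And>x y. 0 \<le> d x y"
  shows "path_length d a b \<gamma> = (SUP ts \<in> {ts. sorted ts \<and> set ts \<subseteq> {a..b}}. ennreal (variation_sum d \<gamma> ts))"
  unfolding path_length_def variation_sum_eq using assms by (simp add: sum_ennreal)

lemma variation_sum_append:
  "variation_sum d \<gamma> (xs @ x # ys) = variation_sum d \<gamma> (xs @ [x]) + variation_sum d \<gamma> (x # ys)"
  by (induction xs rule: induct_list012) auto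

lemma variation_sum_nonneg: "(\<And>x y. 0 \<le> d x y) \<Longrightarrow> 0 \<le> variation_sum d \<gamma> ts"
  by (simp add: variation_sum_eq sum_nonneg)

lemma variation_sum_snoc_ge:
  assumes "\<And>x y. 0 \<le> d x y" shows "variation_sum d \<gamma> xs \<le> variation_sum d \<gamma> (xs @ [x])"
  by (induction xs rule: induct_list012) (use assms in auto)

lemma variation_sum_le:
  assumes d: "\<And>s t. a \<le> s \<Longrightarrow> s \<le> t \<Longrightarrow> t \<le> b \<Longrightarrow> d (\<gamma> s) (\<gamma> t) \<le> \<tau> t - \<tau> s"
    and \<tau>: "\<And>s t. a \<le> s \<Longrightarrow> s \<le> t \<Longrightarrow> t \<le> b \<Longrightarrow> \<tau> s \<le> \<tau> t"
    and ts: "sorted ts" "set ts \<subseteq> {a..b}" and ab: "a \<le> b"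
  shows "variation_sum d \<gamma> ts \<le> \<tau> b - \<tau> a"
proof -
  have *: "variation_sum d \<gamma> (x # xs) \<le> \<tau> b - \<tau> x" if "sorted (x # xs)" "set (x # xs) \<subseteq> {a..b}" for x xs
    using that
  proof (induction xs arbitrary: x)
    case Nil
    then show ?case using \<tau>[of x b] by simp
  next
    case (Cons y xs)
    then have "variation_sum d \<gamma> (y # xs) \<le> \<tau> b - \<tau> y" by simp
    then show ?case using d[of x y] Cons.prems by simp
  qed
  show ?thesis
  proof (cases ts)
    case (Cons x xs)
    then show ?thesis using *[of x xs] ts \<tau>[of a x] by simp
  qed (use \<tau>[of a b] ab in simp)
qed

lemma path_length_le:
  assumes "\<And>x y. 0 \<le> d x y" "a \<le> b"
    and "\<And>s t. a \<le> s \<Longrightarrow> s \<le> t \<Longrightarrow> t \<le> b \<Longrightarrow> d (\<gamma> s) (\<gamma> t) \<le> \<tau> t - \<tau> s"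
    and "\<And>s t. a \<le> s \<Longrightarrow> s \<le> t \<Longrightarrow> t \<le> b \<Longrightarrow> \<tau> s \<le> \<tau> t"
  shows "path_length d a b \<gamma> \<le> ennreal (\<tau> b - \<tau> a)"
  unfolding path_length_eq[OF assms(1)]
proof (rule SUP_least, rule ennreal_leI)
  fix ts assume "ts \<in> {ts. sorted ts \<and> set ts \<subseteq> {a..b}}"
  then show "variation_sum d \<gamma> ts \<le> \<tau> b - \<tau> a"
    using assms by (intro variation_sum_le) auto
qed

lemma variation_sum_insert:
  fixes \<gamma> :: "real \<Rightarrow> 'a::metric_space"
  shows "variation_sum dist \<gamma> (xs @ ys) \<le> variation_sum dist \<gamma> (xs @ x # ys)"
proof (cases ys)
  case Nil
  then show ?thesis by (simp add: variation_sum_snoc_ge)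
next
  case (Cons y zs)
  show ?thesis
  proof (cases xs rule: rev_cases)
    case (snoc us u)
    have 1: "variation_sum dist \<gamma> (us @ u # y # zs)
        = variation_sum dist \<gamma> (us @ [u]) + (dist (\<gamma> u) (\<gamma> y) + variation_sum dist \<gamma> (y # zs))"
      using variation_sum_append[of dist \<gamma> us u "y # zs"] by simp
    have 2: "variation_sum dist \<gamma> (us @ u # x # y # zs)
        = variation_sum dist \<gamma> (us @ [u]) + (dist (\<gamma> u) (\<gamma> x) + (dist (\<gamma> x) (\<gamma> y) + variation_sum dist \<gamma> (y # zs)))"
      using variation_sum_append[of dist \<gamma> us u "x # y # zs"] by simp
    show ?thesis using 1 2 dist_triangle[of "\<gamma> u" "\<gamma> y" "\<gamma> x"] by (simp add: snoc Cons)
  qed (simp add: Cons)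
qed

lemma variation_sum_concat:
  fixes \<gamma> :: "real \<Rightarrow> 'a::metric_space"
  shows "variation_sum dist \<gamma> us + variation_sum dist \<gamma> (x # ys) \<le> variation_sum dist \<gamma> (us @ x # ys)"
  using variation_sum_append[of dist \<gamma> us x ys] variation_sum_snoc_ge[of dist \<gamma> us x] by simp

definition arc_length :: "(real \<Rightarrow> 'a::metric_space) \<Rightarrow> real \<Rightarrow> real" where
  "arc_length \<gamma> t = (SUP ts \<in> {ts. sorted ts \<and> set ts \<subseteq> {0..t}}. variation_sum dist \<gamma> ts)"

context
  fixes \<gamma> :: "real \<Rightarrow> 'a::metric_space"
  assumes finite: "path_length dist 0 1 \<gamma> < \<infinity>"
begin

lemma variation_sum_le_path_length:
  assumes "sorted ts" "set ts \<subseteq> {0..1}"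
  shows "variation_sum dist \<gamma> ts \<le> enn2real (path_length dist 0 1 \<gamma>)"
proof -
  have "ennreal (variation_sum dist \<gamma> ts) \<le> path_length dist 0 1 \<gamma>"
    unfolding path_length_eq[OF zero_le_dist] using assms by (intro SUP_upper) auto
  from enn2real_mono[OF this] show ?thesis
    using finite by (simp add: variation_sum_nonneg)
qed

lemma arc_length_ge:
  assumes "t \<le> 1" "sorted ts" "set ts \<subseteq> {0..t}"
  shows "variation_sum dist \<gamma> ts \<le> arc_length \<gamma> t"
  unfolding arc_length_def
proof (rule cSUP_upper)
  show "bdd_above (variation_sum dist \<gamma> ` {ts. sorted ts \<and> set ts \<subseteq> {0..t}})"
  proof (rule bdd_aboveI2)
    fix us assume "us \<in> {ts. sorted ts \<and> set ts \<subseteq> {0..t}}"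
    then show "variation_sum dist \<gamma> us \<le> enn2real (path_length dist 0 1 \<gamma>)"
      using assms(1) by (intro variation_sum_le_path_length) auto
  qed
qed (use assms in auto)

lemma arc_length_le:
  assumes "\<And>ts. sorted ts \<Longrightarrow> set ts \<subseteq> {0..t} \<Longrightarrow> variation_sum dist \<gamma> ts \<le> c"
  shows "arc_length \<gamma> t \<le> c"
  unfolding arc_length_def by (rule cSUP_least) (use assms in \<open>auto intro: exI[of _ "[]"]\<close>)

lemma arc_length_1: "arc_length \<gamma> 1 \<le> enn2real (path_length dist 0 1 \<gamma>)"
  by (rule arc_length_le) (rule variation_sum_le_path_length)

lemma arc_length_0: "arc_length \<gamma> 0 = 0"
proof -
  have "variation_sum dist \<gamma> ts \<le> 0" if "set ts \<subseteq> {0..0}" for ts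
    using that by (induction ts rule: induct_list012) auto
  then have "arc_length \<gamma> 0 \<le> 0" by (intro arc_length_le) auto
  then show ?thesis using arc_length_ge[of 0 "[]"] by simp
qed

lemma arc_length_dist:
  assumes "0 \<le> s" "s \<le> t" "t \<le> 1"
  shows "arc_length \<gamma> s + dist (\<gamma> s) (\<gamma> t) \<le> arc_length \<gamma> t"
proof -
  have "variation_sum dist \<gamma> ts \<le> arc_length \<gamma> t - dist (\<gamma> s) (\<gamma> t)"
    if "sorted ts" "set ts \<subseteq> {0..s}" for ts
  proof -
    have "variation_sum dist \<gamma> ts + dist (\<gamma> s) (\<gamma> t) \<le> variation_sum dist \<gamma> (ts @ [s, t])"
      using variation_sum_concat[of \<gamma> ts s "[t]"] by simp
    also have "\<dots> \<le> arc_length \<gamma> t"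
      using that assms by (intro arc_length_ge) (auto simp: sorted_append)
    finally show ?thesis by simp
  qed
  then have "arc_length \<gamma> s \<le> arc_length \<gamma> t - dist (\<gamma> s) (\<gamma> t)" by (rule arc_length_le)
  then show ?thesis by simp
qed

lemma arc_length_mono: "0 \<le> s \<Longrightarrow> s \<le> t \<Longrightarrow> t \<le> 1 \<Longrightarrow> arc_length \<gamma> s \<le> arc_length \<gamma> t"
  using arc_length_dist[of s t] zero_le_dist[of "\<gamma> s" "\<gamma> t"] by linarith

text \<open>Inserting \<open>s\<close> and \<open>t\<close> into a nearly optimal partition without points in between shows that the partition
  already accounts for the length before \<open>s\<close> and after \<open>t\<close>; what is left for the piece between them is
  the chord and the defect \<open>\<epsilon>\<close>. This is why the arc length of a continuous path is continuous.\<close>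

lemma arc_length_increment:
  assumes ts: "sorted ts" "set ts \<subseteq> {0..1}" "arc_length \<gamma> 1 < variation_sum dist \<gamma> ts + \<epsilon>"
    and st: "0 \<le> s" "s \<le> t" "t \<le> 1" and gap: "set ts \<inter> {s<..<t} = {}"
  shows "arc_length \<gamma> t \<le> arc_length \<gamma> s + dist (\<gamma> s) (\<gamma> t) + \<epsilon>"
proof -
  define xs where "xs = takeWhile (\<lambda>u. u \<le> s) ts"
  define ys where "ys = dropWhile (\<lambda>u. u \<le> s) ts"
  have xy: "ts = xs @ ys" by (simp add: xs_def ys_def)
  have xs: "sorted xs" "set xs \<subseteq> {0..s}"
    using ts(1,2) set_takeWhileD[of _ "\<lambda>u. u \<le> s" ts, folded xs_def]
    by (auto simp: sorted_append xy)
  have sy: "sorted ys" "set ys \<subseteq> {0..1}" using ts(1,2) unfolding xy by (auto simp: sorted_append)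
  have ys: "t \<le> u" if u: "u \<in> set ys" for u
  proof -
    obtain y zs where y: "ys = y # zs" using u by (cases ys) auto
    then have "\<not> y \<le> s" using hd_dropWhile[of "\<lambda>u. u \<le> s" ts] by (simp add: ys_def)
    then have "s < u" using u sy(1) y by auto
    moreover have "u \<in> set ts" using u xy by simp
    ultimately show ?thesis using gap by force
  qed
  have "variation_sum dist \<gamma> ts \<le> variation_sum dist \<gamma> (xs @ s # ys)"
    unfolding xy by (rule variation_sum_insert)
  also have "\<dots> = variation_sum dist \<gamma> (xs @ [s]) + variation_sum dist \<gamma> (s # ys)"
    by (rule variation_sum_append)
  also have "variation_sum dist \<gamma> (s # ys) \<le> variation_sum dist \<gamma> (s # t # ys)"
    using variation_sum_insert[of \<gamma> "[s]" ys t] by simp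
  also have "\<dots> = dist (\<gamma> s) (\<gamma> t) + variation_sum dist \<gamma> (t # ys)" by simp
  also have "variation_sum dist \<gamma> (xs @ [s]) \<le> arc_length \<gamma> s"
    using xs st by (intro arc_length_ge) (auto simp: sorted_append)
  finally have 1: "variation_sum dist \<gamma> ts \<le> arc_length \<gamma> s + (dist (\<gamma> s) (\<gamma> t) + variation_sum dist \<gamma> (t # ys))"
    by simp
  have "arc_length \<gamma> t \<le> arc_length \<gamma> 1 - variation_sum dist \<gamma> (t # ys)"
  proof (rule arc_length_le)
    fix us assume us: "sorted us" "set us \<subseteq> {0..t}"
    have "variation_sum dist \<gamma> us + variation_sum dist \<gamma> (t # ys) \<le> variation_sum dist \<gamma> (us @ t # ys)"
      by (rule variation_sum_concat)
    also have "\<dots> \<le> arc_length \<gamma> 1"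
    proof (rule arc_length_ge)
      show "sorted (us @ t # ys)" using us sy ys by (force simp: sorted_append)
      show "set (us @ t # ys) \<subseteq> {0..1}" using us sy st by force
    qed simp
    finally show "variation_sum dist \<gamma> us \<le> arc_length \<gamma> 1 - variation_sum dist \<gamma> (t # ys)" by simp
  qed
  then show ?thesis using 1 ts(3) by linarith
qed

lemma arc_length_continuous:
  assumes \<gamma>: "continuous_on {0..1} \<gamma>"
  shows "continuous_on {0..1} (arc_length \<gamma>)"
  unfolding continuous_on_iff
proof (intro ballI allI impI)
  fix t e :: real assume t: "t \<in> {0..1}" and e: "0 < e"
  obtain ts where ts: "sorted ts" "set ts \<subseteq> {0..1}" "arc_length \<gamma> 1 < variation_sum dist \<gamma> ts + e / 2"
  proof (rule ccontr)
    assume "\<not> thesis"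
    then have "arc_length \<gamma> 1 \<le> arc_length \<gamma> 1 - e / 2"
      by (intro arc_length_le) (use that in force)
    then show False using e by simp
  qed
  obtain d1 where d1: "0 < d1" "\<And>x. x \<in> set ts \<Longrightarrow> x \<noteq> t \<Longrightarrow> d1 \<le> dist t x"
    using finite_set_avoid[of "set ts" t] by auto
  obtain d2 where d2: "0 < d2" "\<And>s. s \<in> {0..1} \<Longrightarrow> dist s t < d2 \<Longrightarrow> dist (\<gamma> s) (\<gamma> t) < e / 2"
    using \<gamma> t e unfolding continuous_on_iff by (metis half_gt_zero)
  show "\<exists>d>0. \<forall>s\<in>{0..1}. dist s t < d \<longrightarrow> dist (arc_length \<gamma> s) (arc_length \<gamma> t) < e"
  proof (intro exI[of _ "min d1 d2"] conjI ballI impI)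
    fix s assume s: "s \<in> {0..1}" "dist s t < min d1 d2"
    have d: "dist (\<gamma> s) (\<gamma> t) < e / 2" using d2(2)[of s] s by simp
    have gap: "set ts \<inter> {s<..<t} = {}" "set ts \<inter> {t<..<s} = {}"
      using d1(2) s(2) by (force simp: dist_real_def)+
    show "dist (arc_length \<gamma> s) (arc_length \<gamma> t) < e"
    proof (cases "s \<le> t")
      case True
      then have "arc_length \<gamma> t \<le> arc_length \<gamma> s + dist (\<gamma> s) (\<gamma> t) + e / 2" "arc_length \<gamma> s \<le> arc_length \<gamma> t"
        using s t by (auto intro!: arc_length_increment[OF ts] arc_length_mono gap)
      then show ?thesis using d by (simp add: dist_real_def)
    next
      case False
      then have "arc_length \<gamma> s \<le> arc_length \<gamma> t + dist (\<gamma> t) (\<gamma> s) + e / 2" "arc_length \<gamma> t \<le> arc_length \<gamma> s"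
        using s t by (auto intro!: arc_length_increment[OF ts] arc_length_mono gap)
      then show ?thesis using d by (simp add: dist_real_def dist_commute)
    qed
  qed (use d1 d2 in auto)
qed

end

subsection \<open>Signatures of rectifiable paths\<close>

text \<open>The path factors through its arc length \<open>\<tau>\<close> as a 1-Lipschitz path \<open>\<gamma> \<circ> \<sigma>\<close>, whose lift has the signature as
  its end point.\<close>

lemma rectifiable_reach:
  fixes \<gamma> :: "real \<Rightarrow> real^'n::finite"
  assumes "rectifiable 0 1 \<gamma>"
  shows "reach (enn2real (path_length dist 0 1 \<gamma>)) (Series (signature \<gamma>))"
proof -
  have cont: "continuous_on {0..1} \<gamma>" and fin: "path_length dist 0 1 \<gamma> < \<infinity>"
    using assms by (auto simp: rectifiable_def)
  define \<tau> where "\<tau> = arc_length \<gamma>"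
  define L where "L = \<tau> 1"
  have \<tau>: "continuous_on {0..1} \<tau>" "\<tau> 0 = 0"
    unfolding \<tau>_def using arc_length_continuous[OF fin cont] arc_length_0[OF fin] by auto
  have mono: "\<tau> s \<le> \<tau> t" if "0 \<le> s" "s \<le> t" "t \<le> 1" for s t
    unfolding \<tau>_def using arc_length_mono[OF fin that] .
  have L: "0 \<le> L" using mono[of 0 1] by (simp add: L_def \<tau>)
  have dist: "dist (\<gamma> s) (\<gamma> t) \<le> \<bar>\<tau> t - \<tau> s\<bar>" if "s \<in> {0..1}" "t \<in> {0..1}" for s t
    using arc_length_dist[OF fin, of s t] arc_length_dist[OF fin, of t s] that
    unfolding \<tau>_def by (cases "s \<le> t") (auto simp: dist_commute)
  have "\<exists>t\<in>{0..1}. \<tau> t = r" if "0 \<le> r" "r \<le> L" for r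
    using IVT'[of \<tau> 0 r 1] that \<tau> by (auto simp: L_def)
  then obtain \<sigma> where \<sigma>: "\<And>r. 0 \<le> r \<Longrightarrow> r \<le> L \<Longrightarrow> \<sigma> r \<in> {0..1} \<and> \<tau> (\<sigma> r) = r" by metis
  have lip: "norm (\<gamma> (\<sigma> t) - \<gamma> (\<sigma> s)) \<le> t - s" if "0 \<le> s" "s \<le> t" "t \<le> L" for s t
    using dist[of "\<sigma> s" "\<sigma> t"] \<sigma>[of s] \<sigma>[of t] that by (auto simp: dist_norm norm_minus_commute)
  obtain G where G: "curve L G"
    "\<And>t j. 0 \<le> t \<Longrightarrow> t \<le> L \<Longrightarrow> cf (G t) [j] = \<gamma> (\<sigma> t) $ j - \<gamma> (\<sigma> 0) $ j"
    by (rule curve_lift_exists[OF L, of "\<lambda>r. \<gamma> (\<sigma> r)"]) (blast intro: lip)+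
  have \<gamma>\<sigma>: "\<gamma> (\<sigma> (\<tau> t)) = \<gamma> t" and \<tau>L: "0 \<le> \<tau> t" "\<tau> t \<le> L" if "0 \<le> t" "t \<le> 1" for t
  proof -
    show *: "0 \<le> \<tau> t" "\<tau> t \<le> L" using mono[of 0 t] mono[of t 1] that \<tau> by (auto simp: L_def)
    show "\<gamma> (\<sigma> (\<tau> t)) = \<gamma> t" using dist[of "\<sigma> (\<tau> t)" t] \<sigma>[OF *] that by auto
  qed
  have \<gamma>: "\<gamma> t $ j = cf (G (\<tau> t)) [j] + \<gamma> 0 $ j" if "0 \<le> t" "t \<le> 1" for t j
    using G(2)[OF \<tau>L[OF that]] \<gamma>\<sigma>[OF that] \<gamma>\<sigma>[of 0] \<tau> by simp
  have "signature \<gamma> w = cf (G L) w" for w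
    unfolding signature_def
    using curve_iter_integral[OF G(1) \<tau>(1) mono \<tau>(2) _ \<gamma>, of 1 "rev w"] by (simp add: L_def)
  then have "Series (signature \<gamma>) = G L" by (intro series_eqI) simp
  then have "reach L (Series (signature \<gamma>))" using G(1) L by (auto simp: reach_def)
  then show ?thesis by (rule reach_mono) (use arc_length_1[OF fin] in \<open>simp add: L_def \<tau>_def\<close>)
qed

text \<open>The degree one part of a curve, run through with constant speed in unit time.\<close>

lemma reach_rectifiable:
  fixes X :: "'n::finite series"
  assumes "reach L X"
  obtains \<gamma> :: "real \<Rightarrow> real^'n" where "rectifiable 0 1 \<gamma>"
    "enn2real (path_length dist 0 1 \<gamma>) \<le> L" "signature \<gamma> = cf X"
proof -
  from assms obtain G where L: "0 \<le> L" and G: "curve L G" "G L = X" by (auto simp: reach_def)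
  define \<gamma> :: "real \<Rightarrow> real^'n" where "\<gamma> t = (\<chi> j. cf (G (L * t)) [j])" for t
  have m: "L * s \<le> L * t" if "s \<le> t" for s t using that L by (intro mult_left_mono)
  have d: "dist (\<gamma> s) (\<gamma> t) \<le> L * t - L * s" if "0 \<le> s" "s \<le> t" "t \<le> 1" for s t
    using curve_singleton_norm[OF G(1), of "L * s" "L * t"] that L m[of s t] m[of t 1]
    by (simp add: dist_norm \<gamma>_def norm_minus_commute)
  have "L-lipschitz_on {0..1} \<gamma>"
  proof (rule lipschitz_onI)
    fix s t :: real assume st: "s \<in> {0..1}" "t \<in> {0..1}"
    show "dist (\<gamma> s) (\<gamma> t) \<le> L * dist s t"
    proof (cases "s \<le> t")
      case True
      then show ?thesis using d[of s t] st by (simp add: dist_real_def right_diff_distrib)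
    next
      case False
      then show ?thesis using d[of t s] st by (simp add: dist_real_def dist_commute right_diff_distrib)
    qed
  qed (fact L)
  then have "continuous_on {0..1} \<gamma>" by (rule lipschitz_on_continuous_on)
  moreover have len: "path_length dist 0 1 \<gamma> \<le> ennreal L"
    using path_length_le[of dist 0 1 \<gamma> "\<lambda>t. L * t", OF zero_le_dist _ d m] by simp
  ultimately have "rectifiable 0 1 \<gamma>"
    unfolding rectifiable_def using order_le_less_trans by fastforce
  moreover have "enn2real (path_length dist 0 1 \<gamma>) \<le> L"
    using enn2real_mono[OF len] L by simp
  moreover have "signature \<gamma> = cf X"
  proof
    fix w
    have "iter_integral \<gamma> 0 (rev w) 1 = cf (G (L * 1)) (rev (rev w))"
    proof (rule curve_iter_integral[OF G(1)])
      show "continuous_on {0..1} (\<lambda>t. L * t)" by (intro continuous_intros)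
      show "\<gamma> t $ j = cf (G (L * t)) [j] + \<gamma> 0 $ j" for t j
        using curve_0[OF G(1)] by (simp add: \<gamma>_def)
    qed (use m in auto)
    then show "signature \<gamma> w = cf X w" by (simp add: signature_def G)
  qed
  ultimately show ?thesis by (rule that)
qed

text \<open>By uniqueness of lifts, the curve is the one that \<open>curve_lift_exists\<close> obtains from polygons.\<close>

lemma reach_polygons:
  fixes X :: "'n::finite series"
  assumes "reach L X"
  obtains F :: "nat filter" and Y where "F \<noteq> bot" "\<And>N. Y N \<in> polygons" "conv F Y X"
proof -
  from assms obtain G where L: "0 \<le> L" and G: "curve L G" "G L = X" by (auto simp: reach_def)
  define g :: "real \<Rightarrow> real^'n" where "g t = (\<chi> j. cf (G t) [j])" for t
  have g: "norm (g t - g s) \<le> t - s" if "0 \<le> s" "s \<le> t" "t \<le> L" for s t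
    unfolding g_def by (rule curve_singleton_norm[OF G(1) that])
  obtain H and F :: "nat filter" and Y where H: "curve L H"
    "\<And>t j. 0 \<le> t \<Longrightarrow> t \<le> L \<Longrightarrow> cf (H t) [j] = g t $ j - g 0 $ j"
    "F \<noteq> bot" "\<And>N. Y N \<in> polygons" "conv F Y (H L)"
    by (rule curve_lift_exists[OF L, of g]) (blast intro: g)+
  have "H L = G L"
  proof (rule curve_lift_unique[OF H(1) G(1)])
    show "cf (H t) [j] = cf (G t) [j]" if "0 \<le> t" "t \<le> L" for t j
      using H(2)[OF that] curve_0[OF G(1)] by (simp add: g_def)
  qed (use L in auto)
  then show ?thesis using that H G by auto
qed

section \<open>Lie series modulo high degree\<close>

lemma truncate_cong_iff:
  "truncate k (cf X) = truncate k (cf Y) \<longleftrightarrow> order_ge (Suc k) (X - Y)"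
  by (auto simp: truncate_def order_ge_def fun_eq_iff less_Suc_eq_le)

lemma truncate_truncate [simp]: "truncate k (truncate k g) = truncate k g"
  by (auto simp: truncate_def)

lemma truncate_tensor_mult:
  "truncate k (tensor_mult (truncate k g) (truncate k h)) = truncate k (tensor_mult g h)"
  by (auto simp: truncate_def tensor_mult_def fun_eq_iff intro!: sum.cong)

lemma trunc_mult_cf: "trunc_mult k (truncate k (cf X)) (truncate k (cf Y)) = truncate k (cf (X * Y))"
  by (simp add: trunc_mult_def truncate_tensor_mult cf_mult)

lemma lie_bracket_cf:
  "lie_bracket k (truncate k (cf X)) (truncate k (cf Y)) = truncate k (cf (X * Y - Y * X))"
proof -
  have "truncate k (cf (X * Y - Y * X)) = (\<lambda>w. truncate k (cf (X * Y)) w - truncate k (cf (Y * X)) w)"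
    by (auto simp: truncate_def)
  then show ?thesis by (simp add: lie_bracket_def trunc_mult_cf)
qed

lemma truncate_upto: "g \<in> tensors_upto k \<Longrightarrow> truncate k g = g"
  by (auto simp: truncate_def tensors_upto_def fun_eq_iff not_le)

lemma lie_subalgebra_free_nilpotent:
  assumes "1 \<le> k" shows "lie_subalgebra k (free_nilpotent_algebra k :: 'n tensors set)"
proof -
  define V where "V = {g :: 'n tensors. g \<in> tensors_upto k \<and> g [] = 0}"
  have "lie_subalgebra k V"
    unfolding lie_subalgebra_def V_def
    by (auto simp: tensors_upto_def lie_bracket_def trunc_mult_def truncate_def)
  moreover have "tensors_of_degree 1 \<subseteq> V"
    using assms by (auto simp: V_def tensors_of_degree_def tensors_upto_def)
  ultimately have "free_nilpotent_algebra k \<subseteq> V"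
    unfolding free_nilpotent_algebra_def by blast
  then show ?thesis
    unfolding lie_subalgebra_def V_def[symmetric] free_nilpotent_algebra_def
    by (auto simp: lie_subalgebra_def V_def)
qed

lemma free_nilpotent_zero: "1 \<le> k \<Longrightarrow> (\<lambda>w. 0) \<in> free_nilpotent_algebra k"
  and free_nilpotent_add: "1 \<le> k \<Longrightarrow> g \<in> free_nilpotent_algebra k \<Longrightarrow> h \<in> free_nilpotent_algebra k \<Longrightarrow>
    (\<lambda>w. g w + h w) \<in> free_nilpotent_algebra k"
  and free_nilpotent_scale: "1 \<le> k \<Longrightarrow> g \<in> free_nilpotent_algebra k \<Longrightarrow>
    (\<lambda>w. c * g w) \<in> free_nilpotent_algebra k"
  and free_nilpotent_bracket: "1 \<le> k \<Longrightarrow> g \<in> free_nilpotent_algebra k \<Longrightarrow> h \<in> free_nilpotent_algebra k \<Longrightarrow>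
    lie_bracket k g h \<in> free_nilpotent_algebra k"
  and free_nilpotent_upto: "1 \<le> k \<Longrightarrow> g \<in> free_nilpotent_algebra k \<Longrightarrow> g \<in> tensors_upto k"
  and free_nilpotent_Nil: "1 \<le> k \<Longrightarrow> g \<in> free_nilpotent_algebra k \<Longrightarrow> g [] = 0"
  using lie_subalgebra_free_nilpotent[of k] unfolding lie_subalgebra_def by blast+

lemma degree_one_free_nilpotent: "tensors_of_degree 1 \<subseteq> free_nilpotent_algebra k"
  by (auto simp: free_nilpotent_algebra_def)

text \<open>The truncated Lie algebra pulled back to all series: every series of order above \<open>k\<close> belongs to
  it, so that calculations need no truncated products.\<close>

definition lie_mod :: "nat \<Rightarrow> 'n series set" where
  "lie_mod k = {X. truncate k (cf X) \<in> free_nilpotent_algebra k}"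

lemma lie_mod_cong: "X \<in> lie_mod k \<Longrightarrow> order_ge (Suc k) (X - Y) \<Longrightarrow> Y \<in> lie_mod k"
  by (simp add: lie_mod_def flip: truncate_cong_iff)

context
  fixes k :: nat
  assumes k: "1 \<le> k"
begin

lemma lie_mod_zero: "(0 :: 'n series) \<in> lie_mod k"
proof -
  have "truncate k (cf (0 :: 'n series)) = (\<lambda>w. 0)" by (auto simp: truncate_def)
  then show ?thesis using free_nilpotent_zero[OF k] by (simp add: lie_mod_def)
qed

lemma lie_mod_order: "X \<in> lie_mod k \<Longrightarrow> order_ge (Suc 0) X"
  using free_nilpotent_Nil[OF k, of "truncate k (cf X)"]
  by (simp add: lie_mod_def order_ge_1_iff truncate_def)

lemma lie_mod_add:
  assumes "X \<in> lie_mod k" "Y \<in> lie_mod k" shows "X + Y \<in> lie_mod k"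
proof -
  have "truncate k (cf (X + Y)) = (\<lambda>w. truncate k (cf X) w + truncate k (cf Y) w)"
    by (auto simp: truncate_def)
  then show ?thesis
    using assms free_nilpotent_add[OF k] free_nilpotent_scale[OF k] by (simp add: lie_mod_def)
qed

lemma lie_mod_scaleR:
  assumes "X \<in> lie_mod k" shows "c *\<^sub>R X \<in> lie_mod k"
proof -
  have "truncate k (cf (c *\<^sub>R X)) = (\<lambda>w. c * truncate k (cf X) w)"
    by (auto simp: truncate_def)
  then show ?thesis
    using assms free_nilpotent_add[OF k] free_nilpotent_scale[OF k] by (simp add: lie_mod_def)
qed

lemma lie_mod_bracket:
  assumes "X \<in> lie_mod k" "Y \<in> lie_mod k" shows "X * Y - Y * X \<in> lie_mod k"
  using assms free_nilpotent_bracket[OF k] by (simp add: lie_mod_def flip: lie_bracket_cf)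

lemma lie_mod_diff: "X \<in> lie_mod k \<Longrightarrow> Y \<in> lie_mod k \<Longrightarrow> X - Y \<in> lie_mod k"
  using lie_mod_add[OF _ lie_mod_scaleR[of Y "-1"], of X] by simp

lemma lie_mod_sum: "(\<And>i. i \<in> A \<Longrightarrow> f i \<in> lie_mod k) \<Longrightarrow> sum f A \<in> lie_mod k"
  by (induction A rule: infinite_finite_induct) (auto simp: lie_mod_zero lie_mod_add)

lemma lie_mod_degree_one:
  assumes "\<And>w. length w \<noteq> 1 \<Longrightarrow> cf X w = 0" shows "X \<in> lie_mod k"
proof -
  have "truncate k (cf X) \<in> tensors_of_degree 1"
    using assms by (auto simp: tensors_of_degree_def truncate_def)
  then show ?thesis using degree_one_free_nilpotent by (auto simp: lie_mod_def)
qed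

text \<open>The smallest Lie subalgebra admits induction over the generation of its elements; the rule \<open>cong\<close> accounts for the
  components of degree above \<open>k\<close>.\<close>

lemma lie_mod_induct [consumes 1, case_names cong degree_one zero add scale bracket]:
  assumes X: "X \<in> lie_mod k"
    and cong: "\<And>X Y. P X \<Longrightarrow> order_ge (Suc k) (X - Y) \<Longrightarrow> P Y"
    and degree_one: "\<And>X. (\<And>w. length w \<noteq> 1 \<Longrightarrow> cf X w = 0) \<Longrightarrow> P X"
    and zero: "P 0"
    and add: "\<And>X Y. X \<in> lie_mod k \<Longrightarrow> Y \<in> lie_mod k \<Longrightarrow> P X \<Longrightarrow> P Y \<Longrightarrow> P (X + Y)"
    and scale: "\<And>X c. X \<in> lie_mod k \<Longrightarrow> P X \<Longrightarrow> P (c *\<^sub>R X)"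
    and bracket: "\<And>X Y. X \<in> lie_mod k \<Longrightarrow> Y \<in> lie_mod k \<Longrightarrow> P X \<Longrightarrow> P Y \<Longrightarrow> P (X * Y - Y * X)"
  shows "P X"
proof -
  define V where "V = {g. g \<in> free_nilpotent_algebra k \<and> P (Series g)}"
  have g: "g \<in> tensors_upto k" "Series g \<in> lie_mod k" if "g \<in> free_nilpotent_algebra k" for g :: "'a tensors"
  proof -
    show "g \<in> tensors_upto k"
      using that free_nilpotent_upto[OF k] by auto
    then show "Series g \<in> lie_mod k" using that by (simp add: lie_mod_def truncate_upto)
  qed
  have "lie_subalgebra k V"
    unfolding lie_subalgebra_def
  proof (intro conjI ballI allI)
    show "V \<subseteq> {g \<in> tensors_upto k. g [] = 0}"
      using free_nilpotent_upto[OF k] free_nilpotent_Nil[OF k] by (auto simp: V_def)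
    have "Series (\<lambda>w. 0) = (0 :: 'a series)" by (rule series_eqI) simp
    then show "(\<lambda>w. 0) \<in> V"
      using free_nilpotent_zero[OF k] zero by (simp add: V_def)
  next
    fix g h assume "g \<in> V" "h \<in> V"
    then have gh: "g \<in> free_nilpotent_algebra k" "h \<in> free_nilpotent_algebra k" "P (Series g)" "P (Series h)"
      by (auto simp: V_def)
    have "Series (\<lambda>w. g w + h w) = Series g + Series h" by (rule series_eqI) simp
    then show "(\<lambda>w. g w + h w) \<in> V"
      using free_nilpotent_add[OF k gh(1,2)] gh add[of "Series g" "Series h"] g
      by (simp add: V_def)
    have "lie_bracket k g h = truncate k (cf (Series g * Series h - Series h * Series g))"
      using lie_bracket_cf[of k "Series g" "Series h"] gh g by (simp add: truncate_upto)
    then have "order_ge (Suc k) (Series g * Series h - Series h * Series g - Series (lie_bracket k g h))"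
      by (simp flip: truncate_cong_iff)
    then have "P (Series (lie_bracket k g h))"
      using bracket[of "Series g" "Series h"] gh g cong by blast
    then show "lie_bracket k g h \<in> V"
      using free_nilpotent_bracket[OF k gh(1,2)] by (simp add: V_def)
  next
    fix c g assume "g \<in> V"
    then have gh: "g \<in> free_nilpotent_algebra k" "P (Series g)"
      by (auto simp: V_def)
    have "Series (\<lambda>w. c * g w) = c *\<^sub>R Series g" by (rule series_eqI) simp
    then show "(\<lambda>w. c * g w) \<in> V"
      using free_nilpotent_scale[OF k gh(1)] gh scale[of "Series g" c] g
      by (simp add: V_def)
  qed
  moreover have "tensors_of_degree 1 \<subseteq> V"
    using degree_one_free_nilpotent degree_one by (auto simp: V_def tensors_of_degree_def)
  ultimately have "free_nilpotent_algebra k \<subseteq> V"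
    unfolding free_nilpotent_algebra_def by blast
  then have "P (Series (truncate k (cf X)))" using X by (auto simp: V_def lie_mod_def)
  then show ?thesis by (rule cong) (simp flip: truncate_cong_iff)
qed

end

definition proj :: "nat \<Rightarrow> 'n series \<Rightarrow> 'n series" where
  "proj m X = Series (\<lambda>w. if length w = m then cf X w else 0)"

lemma cf_proj [simp]: "cf (proj m X) w = (if length w = m then cf X w else 0)"
  by (simp add: proj_def)

lemma proj_add: "proj m (X + Y) = proj m X + proj m Y"
  by (rule series_eqI) simp

lemma proj_diff: "proj m (X - Y) = proj m X - proj m Y"
  by (rule series_eqI) simp

lemma proj_scaleR: "proj m (c *\<^sub>R X) = c *\<^sub>R proj m X"
  by (rule series_eqI) simp

lemma proj_order: "order_ge m (proj m X)"
  by (simp add: order_ge_def)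

lemma proj_rest: "order_ge m X \<Longrightarrow> order_ge (Suc m) (X - proj m X)"
  by (auto simp: order_ge_def less_Suc_eq)

lemma proj_cong: "order_ge (Suc m) (X - Y) \<Longrightarrow> proj m X = proj m Y"
  by (rule series_eqI) (auto simp: order_ge_def)

lemma proj_mult: "proj m (X * Y) = (\<Sum>i\<le>m. proj i X * proj (m - i) Y)"
proof (rule series_eqI)
  fix w :: "'a list"
  have "cf (proj i X * proj (m - i) Y) w = (if length w = m then cf X (take i w) * cf Y (drop i w) else 0)"
    if "i \<le> m" for i
  proof -
    have "cf (proj i X * proj (m - i) Y) w
      = (\<Sum>j\<le>length w. if j = i \<and> length w = m then cf X (take i w) * cf Y (drop i w) else 0)"
      unfolding cf_mult_sum using that by (intro sum.cong) auto
    also have "\<dots> = (if length w = m then cf X (take i w) * cf Y (drop i w) else 0)"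
      using that by (cases "length w = m") (simp_all add: sum.delta)
    finally show ?thesis .
  qed
  then have "cf (\<Sum>i\<le>m. proj i X * proj (m - i) Y) w
      = (\<Sum>i\<le>m. if length w = m then cf X (take i w) * cf Y (drop i w) else 0)"
    unfolding cf_sum by (intro sum.cong) auto
  then show "cf (proj m (X * Y)) w = cf (\<Sum>i\<le>m. proj i X * proj (m - i) Y) w"
    by (simp add: cf_mult_sum del: cf_sum)
qed

lemma proj_bracket:
  "proj m (X * Y - Y * X) = (\<Sum>i\<le>m. proj i X * proj (m - i) Y - proj (m - i) Y * proj i X)"
proof -
  have "(\<Sum>i\<le>m. proj i Y * proj (m - i) X) = (\<Sum>i\<le>m. proj (m - i) Y * proj i X)"
    by (rule sum.reindex_bij_witness[where i = "\<lambda>i. m - i" and j = "\<lambda>i. m - i"]) auto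
  then show ?thesis by (simp add: proj_diff proj_mult sum_subtractf)
qed

text \<open>The Lie algebra is graded.\<close>

lemma lie_mod_proj:
  assumes k: "1 \<le> k" and "X \<in> lie_mod k" shows "proj m X \<in> lie_mod k"
  using assms(2)
proof (induction arbitrary: m rule: lie_mod_induct[OF k, consumes 1, case_names cong degree_one zero add scale bracket])
  case (cong X Y)
  show ?case by (rule lie_mod_cong[OF cong(1)[of m]]) (use cong(2) in \<open>auto simp: order_ge_def\<close>)
next
  case (degree_one X)
  then show ?case by (intro lie_mod_degree_one[OF k]) auto
next
  case zero
  have "proj m 0 = (0 :: 'a series)" by (rule series_eqI) simp
  then show ?case by (simp add: lie_mod_zero[OF k])
next
  case (bracket X Y)
  then show ?case unfolding proj_bracket by (intro lie_mod_sum[OF k] lie_mod_bracket[OF k])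
qed (simp_all add: proj_add proj_scaleR lie_mod_add[OF k] lie_mod_scaleR[OF k])

subsection \<open>Derivations\<close>

definition degree_der :: "'n series \<Rightarrow> 'n series" where
  "degree_der X = Series (\<lambda>w. real (length w) * cf X w)"

lemma cf_degree_der [simp]: "cf (degree_der X) w = real (length w) * cf X w"
  by (simp add: degree_der_def)

text \<open>Not lowering degrees is what makes a derivation commute with the coefficientwise limits that define
  exponentials. The derivations of interest are \<open>degree_der\<close> and the commutators with a fixed series.\<close>

locale series_derivation =
  fixes D :: "'n series \<Rightarrow> 'n series"
  assumes add: "D (X + Y) = D X + D Y"
    and scale: "D (c *\<^sub>R X) = c *\<^sub>R D X"
    and mult: "D (X * Y) = D X * Y + X * D Y"
    and order: "order_ge m X \<Longrightarrow> order_ge m (D X)"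
begin

lemma one: "D 1 = 0"
  using mult[of 1 1] by simp

lemma zero: "D 0 = 0"
  using scale[of 0 0] by simp

lemma diff: "D (X - Y) = D X - D Y"
  using add[of X "- 1 *\<^sub>R Y"] scale[of "-1" Y] by simp

lemma sum: "D (sum f A) = (\<Sum>i\<in>A. D (f i))"
  by (induction A rule: infinite_finite_induct) (simp_all add: zero add)

end

interpretation degree_der: series_derivation degree_der
proof
  fix X Y :: "'a series"
  show "degree_der (X * Y) = degree_der X * Y + X * degree_der Y"
  proof (rule series_eqI)
    fix w :: "'a list"
    have "real (length w) * (cf X (take i w) * cf Y (drop i w))
      = real (length (take i w)) * cf X (take i w) * cf Y (drop i w)
        + cf X (take i w) * (real (length (drop i w)) * cf Y (drop i w))" if "i \<le> length w" for i
      using that by (simp add: of_nat_diff algebra_simps)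
    then show "cf (degree_der (X * Y)) w = cf (degree_der X * Y + X * degree_der Y) w"
      unfolding cf_add cf_degree_der cf_mult_sum sum_distrib_left sum.distrib[symmetric]
      by (intro sum.cong) auto
  qed
qed (auto simp: order_ge_def intro!: series_eqI simp: algebra_simps)

lemma inner_derivation: "series_derivation (\<lambda>X. Z * X - X * Z)"
  by standard (simp_all add: algebra_simps order_ge_diff order_ge_mult_left order_ge_mult_right)

definition exp_coeff :: "'n series \<Rightarrow> nat \<Rightarrow> 'n series" where
  "exp_coeff a n = (1 / fact n) *\<^sub>R a ^ n"

text \<open>The terms of \<open>(1 - e\<^bsup>- ad a\<^esup>) / ad a\<close>, applied to \<open>b\<close>, where \<open>- ad a\<close> maps \<open>x\<close> to \<open>x * a - a * x\<close>.\<close>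

definition ad_coeff :: "'n series \<Rightarrow> 'n series \<Rightarrow> nat \<Rightarrow> 'n series" where
  "ad_coeff a b i = (1 / fact (Suc i)) *\<^sub>R ((\<lambda>x. x * a - a * x) ^^ i) b"

lemma exp_coeff_Suc: "real (Suc n) *\<^sub>R exp_coeff a (Suc n) = exp_coeff a n * a"
proof -
  have "real (Suc n) * (1 / (real (Suc n) * c)) = 1 / c" for c by simp
  then have "real (Suc n) * (1 / fact (Suc n)) = 1 / fact n" by (metis fact_Suc of_nat_fact of_nat_mult)
  then show ?thesis
    unfolding exp_coeff_def scaleR_scaleR by (simp only: power_Suc2 mult_scaleR_left)
qed

lemma ad_coeff_Suc: "ad_coeff a b i * a = a * ad_coeff a b i + real (i + 2) *\<^sub>R ad_coeff a b (Suc i)"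
proof -
  define y where "y = ((\<lambda>x. x * a - a * x) ^^ i) b"
  have "fact (Suc (Suc i)) = real (i + 2) * fact (Suc i)" by (simp add: algebra_simps)
  moreover have "real (i + 2) * (1 / (real (i + 2) * c)) = 1 / c" for c by simp
  ultimately have "real (i + 2) * (1 / fact (Suc (Suc i))) = 1 / fact (Suc i)" by metis
  then have "real (i + 2) *\<^sub>R ad_coeff a b (Suc i) = (1 / fact (Suc i)) *\<^sub>R (y * a - a * y)"
    unfolding ad_coeff_def y_def by (simp only: scaleR_scaleR funpow.simps o_apply)
  then show ?thesis by (simp add: ad_coeff_def y_def[symmetric] scaleR_diff_right)
qed

lemma exp_coeff_order: "order_ge (Suc 0) a \<Longrightarrow> order_ge n (exp_coeff a n)"
  by (simp add: exp_coeff_def order_ge_scaleR order_ge_power)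

lemma ad_coeff_order:
  assumes "order_ge (Suc 0) a" shows "order_ge i (ad_coeff a b i)"
proof -
  have "order_ge i (((\<lambda>x. x * a - a * x) ^^ i) b)"
  proof (induction i)
    case (Suc i)
    then show ?case using order_ge_mult[OF Suc assms] order_ge_mult[OF assms Suc]
      by (simp add: order_ge_diff)
  qed simp
  then show ?thesis by (simp add: ad_coeff_def order_ge_scaleR)
qed

context series_derivation
begin

text \<open>The contribution of \<open>a ^ (n + 1)\<close> to the formula \<open>D (e\<^bsup>a\<^esup>) = e\<^bsup>a\<^esup> * ((1 - e\<^bsup>- ad a\<^esup>) / ad a) (D a)\<close>. In the inductive step
  \<open>a\<close> is moved to the left past \<open>ad_coeff\<close>, and the coefficients of the two families of terms that this produces
  add up to the same number for every term.\<close>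

lemma exp_coeff:
  "D (exp_coeff a (Suc n)) = (\<Sum>i\<le>n. exp_coeff a (n - i) * ad_coeff a (D a) i)"
proof (induction n)
  case 0
  show ?case by (simp add: exp_coeff_def ad_coeff_def scale one)
next
  case (Suc m)
  let ?p = "exp_coeff a" and ?q = "ad_coeff a (D a)"
  define T where "T i = ?p (Suc m - i) * ?q i" for i
  have q0: "?q 0 = D a" by (simp add: ad_coeff_def)
  have summand: "?p (m - i) * ?q i * a = real (Suc m - i) *\<^sub>R T i + real (Suc i + 1) *\<^sub>R T (Suc i)"
    if "i \<le> m" for i
  proof -
    have "?p (m - i) * ?q i * a = (?p (m - i) * a) * ?q i + real (i + 2) *\<^sub>R (?p (m - i) * ?q (Suc i))"
      unfolding mult.assoc ad_coeff_Suc by (simp add: distrib_left mult.assoc)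
    also have "?p (m - i) * a = real (Suc m - i) *\<^sub>R ?p (Suc m - i)"
      using exp_coeff_Suc[of "m - i" a] that by (simp add: Suc_diff_le)
    finally show ?thesis by (simp add: T_def)
  qed
  have "real (Suc (Suc m)) *\<^sub>R D (?p (Suc (Suc m))) = D (?p (Suc m) * a)"
    unfolding exp_coeff_Suc[symmetric] scale ..
  also have "\<dots> = D (?p (Suc m)) * a + ?p (Suc m) * D a" by (rule mult)
  also have "\<dots> = (\<Sum>i\<le>m. ?p (m - i) * ?q i * a) + T 0"
    unfolding Suc by (simp add: sum_distrib_right T_def q0)
  also have "\<dots> = (\<Sum>i\<le>m. real (Suc m - i) *\<^sub>R T i) + ((\<Sum>i\<le>m. real (Suc i + 1) *\<^sub>R T (Suc i)) + real (0 + 1) *\<^sub>R T 0)"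
    using summand by (simp add: sum.distrib)
  also have "\<dots> = (\<Sum>i\<le>Suc m. real (Suc m - i) *\<^sub>R T i) + (\<Sum>i\<le>Suc m. real (i + 1) *\<^sub>R T i)"
    unfolding sum.atMost_Suc_shift[of "\<lambda>i. real (i + 1) *\<^sub>R T i"] by (simp add: add.commute)
  also have "\<dots> = (\<Sum>i\<le>Suc m. real (Suc (Suc m)) *\<^sub>R T i)"
    unfolding sum.distrib[symmetric] scaleR_add_left[symmetric] by (intro sum.cong) (auto simp: of_nat_diff)
  finally have "real (Suc (Suc m)) *\<^sub>R D (?p (Suc (Suc m))) = real (Suc (Suc m)) *\<^sub>R (\<Sum>i\<le>Suc m. T i)"
    by (simp only: scaleR_sum_right)
  then show ?case by (simp only: scaleR_cancel_left) (simp add: T_def)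
qed

lemma exp_series:
  assumes a: "order_ge (Suc 0) a"
  shows "order_ge (Suc k) (D (exp_series a) - exp_series a * (\<Sum>i\<le>k. ad_coeff a (D a) i))"
proof -
  let ?p = "exp_coeff a" and ?q = "ad_coeff a (D a)"
  have e: "order_ge (Suc k) (exp_series a - (\<Sum>n\<le>k. ?p n))" for k
    using exp_series_cong[OF a, of k] by (simp add: exp_coeff_def)
  have "order_ge (Suc (Suc k)) (D (exp_series a) - (\<Sum>n\<le>Suc k. D (?p n)))"
    using order[OF e[of "Suc k"]] by (simp only: diff sum)
  moreover have "(\<Sum>n\<le>Suc k. D (?p n)) = (\<Sum>n\<le>k. \<Sum>i\<le>n. ?p (n - i) * ?q i)"
    unfolding sum.atMost_Suc_shift exp_coeff by (simp add: exp_coeff_def scale one)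
  ultimately have 1: "order_ge (Suc k) (D (exp_series a) - (\<Sum>n\<le>k. \<Sum>i\<le>n. ?p (n - i) * ?q i))"
    using order_ge_mono by fastforce
  have 2: "order_ge (Suc k) ((\<Sum>n\<le>k. \<Sum>i\<le>n. ?p (n - i) * ?q i) - (\<Sum>n\<le>k. ?p n) * (\<Sum>i\<le>k. ?q i))"
    unfolding order_ge_def
  proof (intro allI impI)
    fix w :: "'n list" assume w: "length w < Suc k"
    have z: "cf (?p j * ?q i) w = 0" if "k < i + j" for i j
      using that w
      by (intro order_geD[OF order_ge_mult[OF exp_coeff_order[OF a, of j] ad_coeff_order[OF a, of i "D a"]]]) auto
    have "(\<Sum>n\<le>k. \<Sum>i\<le>n. cf (?p (n - i) * ?q i) w) = (\<Sum>(i, j)\<in>{(i, j). i + j \<le> k}. cf (?p j * ?q i) w)"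
      by (rule sum.triangle_reindex_eq[symmetric])
    also have "\<dots> = (\<Sum>(i, j)\<in>{..k} \<times> {..k}. cf (?p j * ?q i) w)"
      by (intro sum.mono_neutral_left) (auto, meson z not_le)
    also have "\<dots> = (\<Sum>i\<le>k. \<Sum>j\<le>k. cf (?p j * ?q i) w)"
      by (rule sum.cartesian_product[symmetric])
    also have "\<dots> = (\<Sum>j\<le>k. \<Sum>i\<le>k. cf (?p j * ?q i) w)" by (rule sum.swap)
    also have "\<dots> = cf ((\<Sum>n\<le>k. ?p n) * (\<Sum>i\<le>k. ?q i)) w" by (simp add: sum_product)
    finally show "cf ((\<Sum>n\<le>k. \<Sum>i\<le>n. ?p (n - i) * ?q i) - (\<Sum>n\<le>k. ?p n) * (\<Sum>i\<le>k. ?q i)) w = 0"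
      by simp
  qed
  have 3: "order_ge (Suc k) ((\<Sum>n\<le>k. ?p n) * (\<Sum>i\<le>k. ?q i) - exp_series a * (\<Sum>i\<le>k. ?q i))"
    using order_ge_mult_left[OF order_ge_sym[OF e[of k]]] by (simp add: left_diff_distrib)
  show ?thesis using order_ge_trans[OF order_ge_trans[OF 1 2] 3] .
qed

text \<open>Modulo high degree the formula for the derivative of \<open>exp a\<close> is a finite sum of iterated brackets with \<open>a\<close>.\<close>

lemma exp_series_lie:
  assumes k: "1 \<le> k" and a: "a \<in> lie_mod k" "D a \<in> lie_mod k"
  shows "tinv (exp_series a) * D (exp_series a) \<in> lie_mod k"
proof -
  let ?E = "exp_series a" and ?s = "\<Sum>i\<le>k. ad_coeff a (D a) i"
  have "((\<lambda>x. x * a - a * x) ^^ i) (D a) \<in> lie_mod k" for i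
    by (induction i) (use a lie_mod_bracket[OF k] in auto)
  then have s: "?s \<in> lie_mod k"
    unfolding ad_coeff_def by (intro lie_mod_sum[OF k] lie_mod_scaleR[OF k])
  have "order_ge (Suc k) (D ?E - ?E * ?s)" by (rule exp_series[OF lie_mod_order[OF k a(1)]])
  then have "order_ge (Suc k) (tinv ?E * (D ?E - ?E * ?s))" by (rule order_ge_mult_right)
  then have "order_ge (Suc k) (?s - tinv ?E * D ?E)"
    by (intro order_ge_sym[of _ "tinv ?E * D ?E"]) (simp add: right_diff_distrib)
  then show ?thesis by (rule lie_mod_cong[OF s])
qed

end

text \<open>Conjugation is reduced to the derivative of \<open>exp a\<close> under the commutator with \<open>Z\<close>.\<close>

lemma exp_series_conj_lie:
  assumes k: "1 \<le> k" and "a \<in> lie_mod k" "Z \<in> lie_mod k"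
  shows "tinv (exp_series a) * Z * exp_series a \<in> lie_mod k"
proof -
  let ?E = "exp_series a"
  have "tinv ?E * (Z * ?E - ?E * Z) \<in> lie_mod k"
    using assms lie_mod_bracket[OF k]
    by (intro series_derivation.exp_series_lie[OF inner_derivation k]) auto
  then have "tinv ?E * (Z * ?E - ?E * Z) + Z \<in> lie_mod k"
    using assms by (intro lie_mod_add[OF k]) auto
  then show ?thesis by (simp add: right_diff_distrib mult.assoc)
qed

lemma lie_mod_degree_der:
  assumes k: "1 \<le> k" and X: "X \<in> lie_mod k" shows "degree_der X \<in> lie_mod k"
proof -
  have "(\<Sum>m\<le>k. real m *\<^sub>R proj m X) \<in> lie_mod k"
    by (intro lie_mod_sum[OF k] lie_mod_scaleR[OF k] lie_mod_proj[OF k] X)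
  then show ?thesis
  proof (rule lie_mod_cong)
    show "order_ge (Suc k) ((\<Sum>m\<le>k. real m *\<^sub>R proj m X) - degree_der X)"
      unfolding order_ge_def
    proof (intro allI impI)
      fix w :: "'a list" assume w: "length w < Suc k"
      have "(\<Sum>m\<le>k. real m * (if length w = m then cf X w else 0)) = real (length w) * cf X w"
        using w by (simp add: if_distrib sum.delta cong: if_cong)
      then show "cf ((\<Sum>m\<le>k. real m *\<^sub>R proj m X) - degree_der X) w = 0" by simp
    qed
  qed
qed

text \<open>Those series whose logarithmic derivative along the dilations is a Lie series modulo high degree. The
  condition passes to products and limits more easily than that of being an exponential, with which it
  agrees by \<open>exp_series_log_lie\<close> and \<open>log_lie_imp_exp\<close>.\<close>

definition log_lie :: "nat \<Rightarrow> 'n series set" where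
  "log_lie k = {E. unip E \<and> tinv E * degree_der E \<in> lie_mod k}"

lemma log_lie_unip: "E \<in> log_lie k \<Longrightarrow> unip E"
  by (simp add: log_lie_def)

lemma exp_series_log_lie: "1 \<le> k \<Longrightarrow> a \<in> lie_mod k \<Longrightarrow> exp_series a \<in> log_lie k"
  by (simp add: log_lie_def degree_der.exp_series_lie lie_mod_degree_der)

lemma log_lie_mult_exp:
  assumes k: "1 \<le> k" and E: "E \<in> log_lie k" and a: "a \<in> lie_mod k"
  shows "E * exp_series a \<in> log_lie k"
proof -
  let ?F = "exp_series a"
  have u: "unip E" using E by (simp add: log_lie_def)
  have "tinv (E * ?F) * degree_der (E * ?F)
     = tinv ?F * (tinv E * degree_der E) * ?F + tinv ?F * degree_der ?F"
    using u by (simp add: tinv_mult degree_der.mult distrib_left mult.assoc)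
  moreover have "tinv ?F * (tinv E * degree_der E) * ?F \<in> lie_mod k"
    using E a by (intro exp_series_conj_lie[OF k]) (auto simp: log_lie_def)
  moreover have "tinv ?F * degree_der ?F \<in> lie_mod k"
    using exp_series_log_lie[OF k a] by (simp add: log_lie_def)
  ultimately show ?thesis using u by (simp add: log_lie_def unip_mult lie_mod_add[OF k])
qed

lemma polygons_log_lie:
  assumes k: "1 \<le> k" shows "X \<in> polygons \<Longrightarrow> X \<in> log_lie k"
proof (induction rule: polygons.induct)
  case polygons_one
  then show ?case by (simp add: log_lie_def degree_der.one lie_mod_zero[OF k])
next
  case (polygons_step X v)
  have "vec_series v \<in> lie_mod k"
    by (rule lie_mod_degree_one[OF k]) (simp add: vec_series_def)
  from log_lie_mult_exp[OF k polygons_step.IH this] show ?case by (simp add: exp_series_vec)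
qed

text \<open>If \<open>Y\<close> were not in the subspace, a linear functional would vanish on the subspace but not at \<open>Y\<close>. As the
  subspace contains all series of order above \<open>k\<close>, such a functional depends on finitely many
  coefficients and is continuous.\<close>

lemma lie_mod_closed:
  fixes Y :: "'n::finite series"
  assumes k: "1 \<le> k" and X: "conv F X Y" "F \<noteq> bot" "\<And>i. X i \<in> lie_mod k"
  shows "Y \<in> lie_mod k"
proof (rule ccontr)
  assume Y: "Y \<notin> lie_mod k"
  have sub: "subspace (lie_mod k :: 'n series set)"
    unfolding subspace_def using lie_mod_zero[OF k] lie_mod_add[OF k] lie_mod_scaleR[OF k] by blast
  obtain B :: "'n series set" where B: "B \<subseteq> lie_mod k" "independent B" "lie_mod k \<subseteq> span B"
    "card B = dim (lie_mod k :: 'n series set)"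
    by (rule basis_exists[of "lie_mod k :: 'n series set"])
  have spanB: "span B = lie_mod k"
    by (rule subset_antisym[OF span_minimal[OF B(1) sub] B(3)])
  have "independent (insert Y B)" using B(2) Y spanB by (intro independent_insertI) auto
  from linear_independent_extend[OF this, of "\<lambda>x. if x = Y then 1 else (0::real)"]
  obtain f :: "'n series \<Rightarrow> real" where f: "linear f" "\<forall>x\<in>insert Y B. f x = (if x = Y then 1 else 0)"
    by blast
  have "Y \<notin> B" using Y B by auto
  then have fB: "f x = 0" if "x \<in> B" for x using f(2) that by auto
  have f0: "f x = 0" if "x \<in> lie_mod k" for x
    using linear_eq_0_on_span[OF f(1) fB] that spanB by auto
  define W where "W = {w :: 'n list. length w \<le> k}"
  have W: "finite W" using finite_lists_length_le[of "UNIV :: 'n set" k] by (simp add: W_def)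
  define e where "e w = Series (\<lambda>u. if u = w then 1 else (0::real))" for w :: "'n list"
  have fX: "f Z = (\<Sum>w\<in>W. cf Z w * f (e w))" for Z
  proof -
    have "order_ge (Suc k) (0 - (Z - (\<Sum>w\<in>W. cf Z w *\<^sub>R e w)))"
      unfolding order_ge_def
    proof (intro allI impI)
      fix u :: "'n list" assume "length u < Suc k"
      then have "u \<in> W" by (simp add: W_def)
      then have "(\<Sum>w\<in>W. cf Z w * (if u = w then 1 else 0)) = cf Z u"
        using W by (simp add: if_distrib sum.delta cong: if_cong)
      then show "cf (0 - (Z - (\<Sum>w\<in>W. cf Z w *\<^sub>R e w))) u = 0" by (simp add: e_def)
    qed
    then have "Z - (\<Sum>w\<in>W. cf Z w *\<^sub>R e w) \<in> lie_mod k" by (rule lie_mod_cong[OF lie_mod_zero[OF k]])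
    then have "f (Z - (\<Sum>w\<in>W. cf Z w *\<^sub>R e w)) = 0" by (rule f0)
    then show ?thesis
      using f(1) by (simp add: linear_diff linear_sum linear_scale)
  qed
  have "((\<lambda>i. \<Sum>w\<in>W. cf (X i) w * f (e w)) \<longlongrightarrow> (\<Sum>w\<in>W. cf Y w * f (e w))) F"
    by (intro tendsto_intros convD[OF X(1)])
  moreover have "(\<Sum>w\<in>W. cf (X i) w * f (e w)) = 0" for i
    using fX[of "X i"] f0[OF X(3)[of i]] by simp
  ultimately have "((\<lambda>i. 0) \<longlongrightarrow> f Y) F" using fX[of Y] by simp
  then have "f Y = 0" using X(2) by (simp add: tendsto_const_iff)
  then show False using f(2) by simp
qed

lemma reach_log_lie:
  assumes k: "1 \<le> k" and X: "reach L X" shows "X \<in> log_lie k"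
proof -
  obtain F :: "nat filter" and Y where Y: "F \<noteq> bot" "\<And>N. Y N \<in> polygons" "conv F Y X"
    using reach_polygons[OF X] by metis
  have "conv F (\<lambda>N. degree_der (Y N)) (degree_der X)"
    using Y(3) unfolding conv_def by (auto intro!: tendsto_intros)
  then have "conv F (\<lambda>N. tinv (Y N) * degree_der (Y N)) (tinv X * degree_der X)"
    by (intro conv_mult conv_tinv Y(3))
  moreover have "tinv (Y N) * degree_der (Y N) \<in> lie_mod k" for N
    using polygons_log_lie[OF k Y(2)[of N]] by (simp add: log_lie_def)
  ultimately have "tinv X * degree_der X \<in> lie_mod k" by (rule lie_mod_closed[OF k _ Y(1)])
  then show ?thesis using reach_unip[OF X] by (simp add: log_lie_def)
qed

section \<open>Free nilpotent groups consist of truncated signatures\<close>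

text \<open>If \<open>E = F + z\<close> up to higher degree, with \<open>z\<close> homogeneous of degree \<open>m + 1\<close>, then the logarithmic derivatives
  differ by \<open>degree_der z = (m + 1) z\<close> up to higher degree.\<close>

lemma log_lie_difference:
  assumes k: "1 \<le> k" and E: "E \<in> log_lie k" and F: "F \<in> log_lie k"
    and EF: "order_ge (Suc m) (E - F)"
  shows "proj (Suc m) (E - F) \<in> lie_mod k"
proof -
  let ?M = "Suc (Suc m)"
  define z where "z = proj (Suc m) (E - F)"
  have z: "order_ge (Suc m) z" by (simp add: z_def proj_order)
  have r: "order_ge ?M (E - F - z)" unfolding z_def by (rule proj_rest[OF EF])
  have u: "unip E" "unip F" using E F by (auto simp: log_lie_unip)
  have one: "order_ge ?M (X * y - y)" "order_ge ?M (y * X - y)"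
    if "unip X" "order_ge (Suc m) y" for X y :: "'a series"
  proof -
    have X: "order_ge (Suc 0) (X - 1)" using that(1) by (simp add: order_ge_1_iff unip_def)
    show "order_ge ?M (X * y - y)" using order_ge_mult[OF X that(2)] by (simp add: left_diff_distrib)
    show "order_ge ?M (y * X - y)" using order_ge_mult[OF that(2) X] by (simp add: right_diff_distrib)
  qed
  have degz: "degree_der z = real (Suc m) *\<^sub>R z"
    by (rule series_eqI) (simp add: z_def)
  have "order_ge ?M (degree_der E - (degree_der F + real (Suc m) *\<^sub>R z))"
    using degree_der.order[OF r] unfolding degree_der.diff degz by (simp only: diff_diff_eq)
  then have 1: "order_ge ?M (tinv E * degree_der E - tinv E * (degree_der F + real (Suc m) *\<^sub>R z))"
    unfolding right_diff_distrib[symmetric] by (rule order_ge_mult_right)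
  have "order_ge (Suc 0) (degree_der F)" by (simp add: order_ge_1_iff)
  then have "order_ge (Suc m + Suc 0) ((tinv E - tinv F) * degree_der F)"
    by (intro order_ge_mult order_ge_tinv_cong u EF)
  then have 2: "order_ge ?M (tinv E * degree_der F - tinv F * degree_der F)"
    by (simp add: left_diff_distrib)
  have "order_ge ?M (real (Suc m) *\<^sub>R (tinv E * z - z))"
    using one(1)[OF unip_tinv[OF u(1)] z] by (rule order_ge_scaleR)
  then have 3: "order_ge ?M (tinv E * (real (Suc m) *\<^sub>R z) - real (Suc m) *\<^sub>R z)"
    by (simp add: scaleR_diff_right)
  have "order_ge ?M ((tinv E * degree_der E - tinv F * degree_der F) - real (Suc m) *\<^sub>R z)"
    using order_ge_add[OF 1 order_ge_add[OF 2 3]] by (simp add: algebra_simps)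
  then have "proj (Suc m) (tinv E * degree_der E - tinv F * degree_der F) = proj (Suc m) (real (Suc m) *\<^sub>R z)"
    by (rule proj_cong)
  also have "\<dots> = real (Suc m) *\<^sub>R z" by (rule series_eqI) (simp add: z_def)
  finally have "real (Suc m) *\<^sub>R z \<in> lie_mod k"
    using lie_mod_proj[OF k lie_mod_diff[OF k], of "tinv E * degree_der E" "tinv F * degree_der F" "Suc m"] E F
    by (simp add: log_lie_def)
  from lie_mod_scaleR[OF k this, of "1 / real (Suc m)"] show ?thesis by (simp add: z_def)
qed

lemma exp_series_perturb:
  assumes a: "order_ge (Suc 0) a" and z: "order_ge (Suc m) z"
  shows "order_ge (Suc (Suc m)) (exp_series (a + z) - exp_series a - z)"
proof -
  let ?M = "Suc (Suc m)"
  have az: "order_ge (Suc 0) (a + z)" using a order_ge_mono[OF z] by (intro order_ge_add) auto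
  have p: "order_ge (Suc m + n) ((a + z) ^ Suc n - a ^ Suc n)" for n
  proof (induction n)
    case (Suc n)
    have "(a + z) ^ Suc (Suc n) - a ^ Suc (Suc n)
      = (a + z) * ((a + z) ^ Suc n - a ^ Suc n) + z * a ^ Suc n"
      by (simp add: algebra_simps)
    moreover have "order_ge (Suc 0 + (Suc m + n)) ((a + z) * ((a + z) ^ Suc n - a ^ Suc n))"
      by (intro order_ge_mult az Suc)
    moreover have "order_ge (Suc m + Suc n) (z * a ^ Suc n)"
      by (intro order_ge_mult z order_ge_power a)
    ultimately show ?case by (simp add: order_ge_add del: power_Suc)
  qed (use z in simp)
  have t: "order_ge ?M ((1 / fact n) *\<^sub>R (a + z) ^ n - (1 / fact n) *\<^sub>R a ^ n - (if n = 1 then z else 0))" for n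
  proof -
    consider "n = 0" | "n = 1" | l where "n = Suc (Suc l)" by (metis One_nat_def not0_implies_Suc)
    then show ?thesis
    proof cases
      case 3
      then have "order_ge ?M ((a + z) ^ n - a ^ n)" using p[of "Suc l"] by (auto elim: order_ge_mono)
      then show ?thesis using 3 order_ge_scaleR[of ?M "(a + z) ^ n - a ^ n" "1 / fact n"]
        by (simp add: scaleR_diff_right del: power_Suc)
    qed simp_all
  qed
  have "(\<Sum>n\<le>Suc m. if n = 1 then z else 0) = z" by simp
  then have s: "order_ge ?M ((\<Sum>n\<le>Suc m. (1 / fact n) *\<^sub>R (a + z) ^ n) - (\<Sum>n\<le>Suc m. (1 / fact n) *\<^sub>R a ^ n) - z)"
    using order_ge_sum[of "{..Suc m}" ?M
        "\<lambda>n. (1 / fact n) *\<^sub>R (a + z) ^ n - (1 / fact n) *\<^sub>R a ^ n - (if n = 1 then z else 0)"] t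
    by (simp only: sum_subtractf)
  from order_ge_add[OF s order_ge_diff[OF exp_series_cong[OF az, of "Suc m"] exp_series_cong[OF a, of "Suc m"]]]
  show ?thesis by (simp add: algebra_simps)
qed

text \<open>The logarithm is built one degree after the other, adding the difference provided by
  \<open>log_lie_difference\<close> each time.\<close>

lemma log_lie_imp_exp:
  assumes k: "1 \<le> k" and E: "E \<in> log_lie k"
  obtains a where "a \<in> lie_mod k" "order_ge (Suc k) (E - exp_series a)"
proof -
  have "\<exists>a\<in>lie_mod k. order_ge (Suc m) (E - exp_series a)" for m
  proof (induction m)
    case 0
    have "cf (exp_series 0) [] = 1" using unip_exp_series unfolding unip_def by blast
    then have "order_ge (Suc 0) (E - exp_series 0)"
      using log_lie_unip[OF E] by (simp add: order_ge_1_iff unip_def)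
    then show ?case using lie_mod_zero[OF k] by blast
  next
    case (Suc m)
    then obtain a where a: "a \<in> lie_mod k" "order_ge (Suc m) (E - exp_series a)" by blast
    define z where "z = proj (Suc m) (E - exp_series a)"
    have z: "z \<in> lie_mod k"
      unfolding z_def by (rule log_lie_difference[OF k E exp_series_log_lie[OF k a(1)] a(2)])
    have "order_ge (Suc (Suc m)) (E - exp_series a - z)" unfolding z_def by (rule proj_rest[OF a(2)])
    moreover have "order_ge (Suc (Suc m)) (exp_series (a + z) - exp_series a - z)"
      by (intro exp_series_perturb lie_mod_order[OF k a(1)]) (simp add: z_def proj_order)
    ultimately have "order_ge (Suc (Suc m)) ((E - exp_series a - z) - (exp_series (a + z) - exp_series a - z))"
      by (rule order_ge_diff)
    then have "order_ge (Suc (Suc m)) (E - exp_series (a + z))" by simp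
    then show ?case using lie_mod_add[OF k a(1) z] by blast
  qed
  then show ?thesis using that by blast
qed

text \<open>\<open>Z\<close> is the first nontrivial component of some signature. These \<open>Z\<close> form a graded Lie algebra: products of
  signatures add leading terms, dilations and inverses scale them, group commutators take brackets.\<close>

definition leading_term :: "nat \<Rightarrow> 'n::finite series \<Rightarrow> bool" where
  "leading_term m Z \<longleftrightarrow> order_ge m Z \<and> (\<exists>L h. reach L h \<and> order_ge (Suc m) (h - 1 - Z))"

lemma leading_term_zero: "leading_term m 0"
  unfolding leading_term_def using reach_one[of 0] by fastforce

lemma leading_term_add:
  assumes m: "1 \<le> m" and "leading_term m Z" "leading_term m Z'"
  shows "leading_term m (Z + Z')"
proof -
  from assms obtain L L' h h' where Z: "order_ge m Z" "reach L h" "order_ge (Suc m) (h - 1 - Z)"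
    and Z': "order_ge m Z'" "reach L' h'" "order_ge (Suc m) (h' - 1 - Z')"
    unfolding leading_term_def by blast
  have h: "order_ge m (h - 1)" using order_ge_add[OF order_ge_mono[OF Z(3), of m] Z(1)] by simp
  have h': "order_ge m (h' - 1)" using order_ge_add[OF order_ge_mono[OF Z'(3), of m] Z'(1)] by simp
  have "order_ge (Suc m) ((h - 1) * (h' - 1))"
    using order_ge_mult[OF h h'] by (rule order_ge_mono) (use m in simp)
  from order_ge_add[OF order_ge_add[OF Z(3) Z'(3)] this]
  have "order_ge (Suc m) (h * h' - 1 - (Z + Z'))" by (simp add: algebra_simps)
  then show ?thesis unfolding leading_term_def
    using reach_mult[OF Z(2) Z'(2)] order_ge_add[OF Z(1) Z'(1)] by blast
qed

lemma leading_term_sum: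
  "1 \<le> m \<Longrightarrow> (\<And>i. i \<in> A \<Longrightarrow> leading_term m (f i)) \<Longrightarrow> leading_term m (sum f A)"
  by (induction A rule: infinite_finite_induct) (auto simp: leading_term_zero leading_term_add)

lemma leading_term_uminus:
  assumes m: "1 \<le> m" and "leading_term m Z" shows "leading_term m (- Z)"
proof -
  from assms obtain L h where Z: "order_ge m Z" "reach L h" "order_ge (Suc m) (h - 1 - Z)"
    unfolding leading_term_def by blast
  have u: "unip h" by (rule reach_unip[OF Z(2)])
  have 1: "order_ge (Suc m) (tinv h * (h - 1 - Z))" using Z(3) by (rule order_ge_mult_right)
  have "order_ge (Suc 0) (tinv h - 1)" using unip_tinv[OF u] by (simp add: order_ge_1_iff unip_def)
  from order_ge_mult[OF this Z(1)] have 2: "order_ge (Suc m) ((tinv h - 1) * Z)" by simp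
  from order_ge_uminus[OF order_ge_add[OF 1 2]] have "order_ge (Suc m) (tinv h - 1 - (- Z))"
    using u by (simp add: algebra_simps)
  then show ?thesis unfolding leading_term_def
    using reach_tinv[OF Z(2)] order_ge_uminus[OF Z(1)] by blast
qed

lemma leading_term_scaleR:
  assumes m: "1 \<le> m" and Z: "leading_term m (proj m X)" shows "leading_term m (proj m (c *\<^sub>R X))"
proof -
  have pos: "leading_term m (proj m (c *\<^sub>R X))" if c: "0 < c" for c
  proof -
    from Z obtain L h where h: "reach L h" "order_ge (Suc m) (h - 1 - proj m X)"
      unfolding leading_term_def by blast
    define s where "s = root m c"
    have s: "0 < s" "s ^ m = c" using c m by (auto simp: s_def)
    have "dil s (h - 1 - proj m X) = dil s h - 1 - proj m (c *\<^sub>R X)"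
      using s(2) by (intro series_eqI) (auto simp: algebra_simps cf_one tensor_one_def)
    moreover have "order_ge (Suc m) (dil s (h - 1 - proj m X))" using h(2) by (simp add: order_ge_def)
    ultimately show ?thesis unfolding leading_term_def
      using reach_dil[OF h(1) s(1)] proj_order by metis
  qed
  consider "0 < c" | "c = 0" | "c < 0" by linarith
  then show ?thesis
  proof cases
    case 1
    then show ?thesis by (rule pos)
  next
    case 2
    have "proj m (0 *\<^sub>R X) = 0" by (rule series_eqI) simp
    then show ?thesis using 2 by (simp add: leading_term_zero)
  next
    case 3
    have "- proj m ((- c) *\<^sub>R X) = proj m (c *\<^sub>R X)" by (rule series_eqI) simp
    then show ?thesis using leading_term_uminus[OF m pos[of "- c"]] 3 by simp
  qed
qed

text \<open>The difference of \<open>h * h'\<close> and \<open>h' * h\<close> is the commutator of \<open>h - 1\<close> and \<open>h' - 1\<close>; the further factor \<open>tinv (h' * h)\<close>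
  is \<open>1\<close> up to higher degree.\<close>

lemma leading_term_bracket:
  assumes "leading_term i Z" "leading_term j Z'"
  shows "leading_term (i + j) (Z * Z' - Z' * Z)"
proof -
  from assms obtain L L' h h' where Z: "order_ge i Z" "reach L h" "order_ge (Suc i) (h - 1 - Z)"
    and Z': "order_ge j Z'" "reach L' h'" "order_ge (Suc j) (h' - 1 - Z')"
    unfolding leading_term_def by blast
  define x where "x = h - 1"
  define y where "y = h' - 1"
  have x: "order_ge i x" unfolding x_def using order_ge_add[OF order_ge_mono[OF Z(3), of i] Z(1)] by simp
  have y: "order_ge j y" unfolding y_def using order_ge_add[OF order_ge_mono[OF Z'(3), of j] Z'(1)] by simp
  have u: "unip h" "unip h'" using Z(2) Z'(2) by (auto simp: reach_unip)
  have prod: "order_ge (Suc (i + j)) (x * y - Z * Z')" "order_ge (Suc (i + j)) (y * x - Z' * Z)"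
  proof -
    have "x * y - Z * Z' = (x - Z) * y + Z * (y - Z')" "y * x - Z' * Z = (y - Z') * x + Z' * (x - Z)"
      by (simp_all add: algebra_simps)
    then show "order_ge (Suc (i + j)) (x * y - Z * Z')" "order_ge (Suc (i + j)) (y * x - Z' * Z)"
      using order_ge_mult[OF Z(3)[folded x_def] y] order_ge_mult[OF Z(1) Z'(3)[folded y_def]]
        order_ge_mult[OF Z'(3)[folded y_def] x] order_ge_mult[OF Z'(1) Z(3)[folded x_def]]
      by (simp_all add: order_ge_add add.commute)
  qed
  have br: "order_ge (Suc (i + j)) ((h * h' - h' * h) - (Z * Z' - Z' * Z))"
    using order_ge_diff[OF prod] by (simp add: x_def y_def algebra_simps)
  have ZZ: "order_ge (i + j) (Z * Z' - Z' * Z)"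
    using order_ge_mult[OF Z(1) Z'(1)] order_ge_mult[OF Z'(1) Z(1)] by (simp add: order_ge_diff add.commute)
  let ?t = "tinv (h' * h)"
  have ut: "unip ?t" using u by (simp add: unip_mult)
  have "h * h' * ?t - 1 = (h * h' - h' * h) * ?t"
    using u by (simp add: left_diff_distrib unip_mult)
  also have "\<dots> - (Z * Z' - Z' * Z)
    = ((h * h' - h' * h) - (Z * Z' - Z' * Z)) * ?t + (Z * Z' - Z' * Z) * (?t - 1)"
    by (simp add: algebra_simps)
  finally have "h * h' * ?t - 1 - (Z * Z' - Z' * Z)
    = ((h * h' - h' * h) - (Z * Z' - Z' * Z)) * ?t + (Z * Z' - Z' * Z) * (?t - 1)" .
  moreover have "order_ge (Suc 0) (?t - 1)" using ut by (simp add: order_ge_1_iff unip_def)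
  from order_ge_mult[OF ZZ this] have "order_ge (Suc (i + j)) ((Z * Z' - Z' * Z) * (?t - 1))" by simp
  ultimately have "order_ge (Suc (i + j)) (h * h' * ?t - 1 - (Z * Z' - Z' * Z))"
    using order_ge_mult_left[OF br, of ?t] by (simp add: order_ge_add)
  moreover have "reach ((L + L') + (L' + L)) (h * h' * ?t)"
    by (intro reach_mult reach_tinv Z Z')
  ultimately show ?thesis unfolding leading_term_def using ZZ by blast
qed

lemma lie_mod_leading_term:
  assumes k: "1 \<le> k" and "X \<in> lie_mod k" "1 \<le> m" "m \<le> k"
  shows "leading_term m (proj m X)"
  using assms(2-4)
proof (induction arbitrary: m rule: lie_mod_induct[OF k, consumes 1, case_names cong degree_one zero add scale bracket])
  case (cong X Y)
  have "proj m X = proj m Y" using cong(2) by (rule proj_cong[OF order_ge_mono]) (use cong.prems in simp)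
  then show ?case using cong by metis
next
  case (degree_one X)
  show ?case
  proof (cases "m = 1")
    case True
    define v where "v = (\<chi> j. cf X [j])"
    have "cf (exp_vec v - 1 - proj 1 X) w = 0" if "length w < 2" for w
    proof (cases w)
      case Nil
      then show ?thesis using unip_exp_vec[of v] by (simp add: unip_def)
    next
      case (Cons j u)
      then show ?thesis using that by (simp add: v_def)
    qed
    then have "order_ge (Suc m) (exp_vec v - 1 - proj m X)"
      unfolding True by (simp add: order_ge_def numeral_2_eq_2)
    then show ?thesis using reach_exp_vec[of v] proj_order[of m X]
      unfolding leading_term_def by blast
  next
    case False
    have "proj m X = 0" using degree_one(1) False by (intro series_eqI) auto
    then show ?thesis by (simp add: leading_term_zero)
  qed
next
  case zero
  have "proj m 0 = (0 :: 'a series)" by (rule series_eqI) simp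
  then show ?case by (simp add: leading_term_zero)
next
  case (add X Y)
  then show ?case by (simp add: proj_add leading_term_add)
next
  case (scale X c)
  then show ?case by (intro leading_term_scaleR)
next
  case (bracket X Y)
  have nil: "proj 0 X = 0" "proj 0 Y = 0"
    using lie_mod_order[OF k bracket.hyps(1)] lie_mod_order[OF k bracket.hyps(2)]
    by (auto intro!: series_eqI simp: order_ge_1_iff)
  have "leading_term m (proj i X * proj (m - i) Y - proj (m - i) Y * proj i X)" if "i \<le> m" for i
  proof (cases "i = 0 \<or> m - i = 0")
    case True
    then show ?thesis using nil by (auto simp: leading_term_zero)
  next
    case False
    then have "leading_term i (proj i X)" "leading_term (m - i) (proj (m - i) Y)"
      using bracket.prems that by (auto intro!: bracket.IH)
    from leading_term_bracket[OF this] show ?thesis using that by simp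
  qed
  then show ?case unfolding proj_bracket using bracket.prems by (intro leading_term_sum) auto
qed

text \<open>Chow's theorem: the components of \<open>E\<close> are matched in increasing degree by multiplying signatures with
  the required leading terms.\<close>

lemma log_lie_reach:
  assumes k: "1 \<le> k" and E: "E \<in> log_lie k"
  obtains L h where "reach L h" "order_ge (Suc k) (E - h)"
proof -
  have "\<exists>L h. reach L h \<and> order_ge (Suc m) (E - h)" if "m \<le> k" for m
    using that
  proof (induction m)
    case 0
    have "order_ge (Suc 0) (E - 1)" using log_lie_unip[OF E] by (simp add: order_ge_1_iff unip_def)
    then show ?case using reach_one[of 0] by fastforce
  next
    case (Suc m)
    then obtain L h where h: "reach L h" "order_ge (Suc m) (E - h)" by auto
    define z where "z = proj (Suc m) (E - h)"
    have "z \<in> lie_mod k"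
      unfolding z_def by (rule log_lie_difference[OF k E reach_log_lie[OF k h(1)] h(2)])
    from lie_mod_leading_term[OF k this, of "Suc m"] Suc.prems
    have "leading_term (Suc m) (proj (Suc m) z)" by simp
    moreover have "proj (Suc m) z = z" by (rule series_eqI) (simp add: z_def)
    ultimately obtain L' h' where h': "reach L' h'" "order_ge (Suc (Suc m)) (h' - 1 - z)"
      unfolding leading_term_def by auto
    have 1: "order_ge (Suc (Suc m)) (E - h - z)" unfolding z_def by (rule proj_rest[OF h(2)])
    have 2: "order_ge (Suc (Suc m)) (h * (h' - 1 - z))" using h'(2) by (rule order_ge_mult_right)
    have "order_ge (Suc 0) (h - 1)" using reach_unip[OF h(1)] by (simp add: order_ge_1_iff unip_def)
    from order_ge_mult[OF this, of "Suc m" z] have 3: "order_ge (Suc (Suc m)) ((h - 1) * z)"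
      by (simp add: z_def proj_order)
    from order_ge_diff[OF order_ge_diff[OF 1 2] 3] have "order_ge (Suc (Suc m)) (E - h * h')"
      by (simp add: algebra_simps)
    then show ?case using reach_mult[OF h(1) h'(1)] by blast
  qed
  then show ?thesis using that by blast
qed

lemma tensor_exp_truncate:
  assumes k: "1 \<le> k" and A: "order_ge (Suc 0) A"
  shows "tensor_exp k (truncate k (cf A)) = truncate k (cf (exp_series A))"
proof
  fix w
  have p: "(trunc_mult k (truncate k (cf A)) ^^ i) tensor_one = truncate k (cf (A ^ i))" for i
  proof (induction i)
    case 0
    show ?case using k by (auto simp: cf_one truncate_def tensor_one_def)
  next
    case (Suc i)
    then show ?case by (simp add: trunc_mult_cf)
  qed
  show "tensor_exp k (truncate k (cf A)) w = truncate k (cf (exp_series A)) w"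
  proof (cases "length w \<le> k")
    case True
    have "cf (exp_series A) w = (\<Sum>n\<le>k. cf (A ^ n) w / fact n)"
      using order_geD[OF exp_series_cong[OF A, of k], of w] True by simp
    also have "\<dots> = tensor_one w + (\<Sum>n=1..k. cf (A ^ n) w / fact n)"
      by (simp add: sum.atMost_shift cf_one atLeast0AtMost[symmetric] sum.atLeast_Suc_atMost)
    finally show ?thesis using True unfolding tensor_exp_def p by (simp add: truncate_def)
  next
    case False
    then have "w \<noteq> []" by auto
    then show ?thesis using False unfolding tensor_exp_def p by (simp add: truncate_def tensor_one_def)
  qed
qed

theorem carrier_free_nilpotent_group:
  assumes k: "1 \<le> k"
  shows "carrier (free_nilpotent_group k) = {truncate k (cf X) | X L. reach L (X :: 'n::finite series)}"
proof (intro subset_antisym subsetI)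
  fix g :: "'n tensors" assume "g \<in> carrier (free_nilpotent_group k)"
  then obtain a where a: "a \<in> free_nilpotent_algebra k" "g = tensor_exp k a"
    by (auto simp: free_nilpotent_group_def)
  have ta: "truncate k a = a" by (rule truncate_upto[OF free_nilpotent_upto[OF k a(1)]])
  have A: "Series a \<in> lie_mod k" using a by (simp add: lie_mod_def ta)
  have g: "g = truncate k (cf (exp_series (Series a)))"
    using tensor_exp_truncate[OF k lie_mod_order[OF k A]] a ta by simp
  obtain L h where "reach L h" "order_ge (Suc k) (exp_series (Series a) - h)"
    using log_lie_reach[OF k exp_series_log_lie[OF k A]] by blast
  then show "g \<in> {truncate k (cf X) | X L. reach L X}"
    unfolding g by (auto simp flip: truncate_cong_iff)
next
  fix g :: "'n tensors" assume "g \<in> {truncate k (cf X) | X L. reach L X}"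
  then obtain X L where X: "g = truncate k (cf X)" "reach L X" by blast
  obtain a where a: "a \<in> lie_mod k" "order_ge (Suc k) (X - exp_series a)"
    using log_lie_imp_exp[OF k reach_log_lie[OF k X(2)]] by blast
  then have "g = tensor_exp k (truncate k (cf a))"
    using X by (simp add: tensor_exp_truncate[OF k lie_mod_order[OF k]] flip: truncate_cong_iff)
  then show "g \<in> carrier (free_nilpotent_group k)"
    using a(1) by (auto simp: free_nilpotent_group_def lie_mod_def)
qed

section \<open>The groups of signatures and of truncated signatures\<close>

text \<open>The signatures of rectifiable paths.\<close>

definition sigs :: "'n::finite series set" where
  "sigs = {X. \<exists>L. reach L X}"

lemma sigs_one [simp]: "1 \<in> sigs"
  unfolding sigs_def using reach_one by auto

lemma sigs_mult: "X \<in> sigs \<Longrightarrow> Y \<in> sigs \<Longrightarrow> X * Y \<in> sigs"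
  unfolding sigs_def using reach_mult by blast

lemma sigs_tinv: "X \<in> sigs \<Longrightarrow> tinv X \<in> sigs"
  unfolding sigs_def using reach_tinv by blast

lemma sigs_unip: "X \<in> sigs \<Longrightarrow> unip X"
  unfolding sigs_def using reach_unip by blast

text \<open>The three groups in question are images of the group of signatures under multiplicative maps.\<close>

lemma group_image_sigs:
  assumes carr: "carrier H = \<phi> ` sigs" and one: "one H = \<phi> 1"
    and mult: "\<And>X Y. mult H (\<phi> X) (\<phi> Y) = \<phi> (X * Y)"
  shows "group H"
proof (rule groupI)
  fix x y z assume "x \<in> carrier H" "y \<in> carrier H" "z \<in> carrier H"
  then show "x \<otimes>\<^bsub>H\<^esub> y \<in> carrier H" "x \<otimes>\<^bsub>H\<^esub> y \<otimes>\<^bsub>H\<^esub> z = x \<otimes>\<^bsub>H\<^esub> (y \<otimes>\<^bsub>H\<^esub> z)"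
    by (auto simp: carr mult sigs_mult mult.assoc)
next
  fix x assume "x \<in> carrier H"
  then obtain X where X: "X \<in> sigs" "x = \<phi> X" by (auto simp: carr)
  show "\<one>\<^bsub>H\<^esub> \<otimes>\<^bsub>H\<^esub> x = x" by (simp add: X one mult)
  show "\<exists>y\<in>carrier H. y \<otimes>\<^bsub>H\<^esub> x = \<one>\<^bsub>H\<^esub>"
    using X sigs_tinv[OF X(1)] sigs_unip[OF X(1)]
    by (intro bexI[of _ "\<phi> (tinv X)"]) (auto simp: carr one mult)
qed (auto simp: carr one)

lemma carrier_signature_group: "carrier signature_group = cf ` sigs"
proof (intro subset_antisym subsetI)
  fix s :: "'a tensors" assume "s \<in> carrier signature_group"
  then obtain \<gamma> :: "real \<Rightarrow> real^'a" where \<gamma>: "s = signature \<gamma>" "rectifiable 0 1 \<gamma>"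
    by (auto simp: signature_group_def)
  then have "s = cf (Series (signature \<gamma>))" "Series (signature \<gamma>) \<in> sigs"
    using rectifiable_reach by (auto simp: sigs_def)
  then show "s \<in> cf ` sigs" by blast
next
  fix s :: "'a tensors" assume "s \<in> cf ` sigs"
  then obtain L and X :: "'a series" where "s = cf X" "reach L X" by (auto simp: sigs_def)
  then show "s \<in> carrier signature_group"
    using reach_rectifiable[of L X] by (fastforce simp: signature_group_def)
qed

lemma signature_group_simps:
  "mult signature_group (cf X) (cf Y) = cf (X * Y)" "one signature_group = cf 1"
  by (simp_all add: signature_group_def cf_mult cf_one)

lemma group_signature_group: "group (signature_group :: 'n::finite tensors monoid)"
  by (rule group_image_sigs) (auto simp: carrier_signature_group signature_group_simps)

lemma carrier_free_nilpotent:
  "1 \<le> k \<Longrightarrow> carrier (free_nilpotent_group k) = (\<lambda>X. truncate k (cf X)) ` sigs"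
  by (auto simp: carrier_free_nilpotent_group sigs_def)

lemma tensor_one_truncate: "tensor_one = truncate k (cf 1)"
  by (auto simp: cf_one truncate_def tensor_one_def)

lemma free_nilpotent_group_simps:
  "mult (free_nilpotent_group k) (truncate k (cf X)) (truncate k (cf Y)) = truncate k (cf (X * Y))"
  "one (free_nilpotent_group k) = truncate k (cf 1)"
  by (simp_all add: free_nilpotent_group_def trunc_mult_cf tensor_one_truncate[symmetric])

lemma group_free_nilpotent_group:
  assumes "1 \<le> k" shows "group (free_nilpotent_group k :: 'n::finite tensors monoid)"
  by (rule group_image_sigs[where \<phi> = "\<lambda>X. truncate k (cf X)"])
    (auto simp: carrier_free_nilpotent[OF assms] free_nilpotent_group_simps)

lemma inv_free_nilpotent_group:
  assumes k: "1 \<le> k" and X: "X \<in> sigs"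
  shows "inv\<^bsub>free_nilpotent_group k\<^esub> (truncate k (cf X)) = truncate k (cf (tinv X))"
  using X sigs_tinv[OF X] sigs_unip[OF X]
  by (intro group.inv_equality[OF group_free_nilpotent_group[OF k]])
    (auto simp: carrier_free_nilpotent[OF k] free_nilpotent_group_simps)

section \<open>Carnot-Caratheodory norms\<close>

lemma step_signature_truncate: "step_signature k 0 1 \<gamma> = truncate k (signature \<gamma>)"
  by (auto simp: step_signature_def truncate_def signature_def)

lemma cc_norm_le:
  assumes "reach L (X :: 'n::finite series)" shows "cc_norm k (truncate k (cf X)) \<le> L"
proof -
  obtain \<gamma> :: "real \<Rightarrow> real^'n" where \<gamma>: "rectifiable 0 1 \<gamma>"
    "enn2real (path_length dist 0 1 \<gamma>) \<le> L" "signature \<gamma> = cf X"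
    using reach_rectifiable[OF assms] .
  have "cc_norm k (truncate k (cf X)) \<le> enn2real (path_length dist 0 1 \<gamma>)"
    unfolding cc_norm_def
  proof (rule cInf_lower)
    show "bdd_below {enn2real (path_length dist 0 1 \<gamma>) |\<gamma> :: real \<Rightarrow> real^'n.
        rectifiable 0 1 \<gamma> \<and> step_signature k 0 1 \<gamma> = truncate k (cf X)}"
      by (rule bdd_belowI[of _ 0]) auto
  qed (use \<gamma> in \<open>auto simp: step_signature_truncate\<close>)
  then show ?thesis using \<gamma>(2) by simp
qed

lemma cc_norm_reach:
  assumes X: "X \<in> (sigs :: 'n::finite series set)" and c: "cc_norm k (truncate k (cf X)) < c"
  obtains Y where "reach c Y" "truncate k (cf Y) = truncate k (cf X)"
proof -
  obtain L where "reach L X" using X by (auto simp: sigs_def)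
  then obtain \<gamma>0 :: "real \<Rightarrow> real^'n" where "rectifiable 0 1 \<gamma>0" "signature \<gamma>0 = cf X"
    using reach_rectifiable by blast
  then have ne: "{enn2real (path_length dist 0 1 \<gamma>) |\<gamma> :: real \<Rightarrow> real^'n.
        rectifiable 0 1 \<gamma> \<and> step_signature k 0 1 \<gamma> = truncate k (cf X)} \<noteq> {}"
    by (auto simp: step_signature_truncate)
  from cInf_lessD[OF ne c[unfolded cc_norm_def]] obtain \<gamma> :: "real \<Rightarrow> real^'n" where
    \<gamma>: "rectifiable 0 1 \<gamma>" "step_signature k 0 1 \<gamma> = truncate k (cf X)"
      "enn2real (path_length dist 0 1 \<gamma>) < c" by auto
  then show ?thesis
    using that[of "Series (signature \<gamma>)"] reach_mono[OF rectifiable_reach[OF \<gamma>(1)], of c]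
    by (simp add: step_signature_truncate)
qed

lemma cc_norm_nonneg:
  assumes "X \<in> (sigs :: 'n::finite series set)" shows "0 \<le> cc_norm k (truncate k (cf X))"
proof (rule ccontr)
  assume "\<not> 0 \<le> cc_norm k (truncate k (cf X))"
  then have "cc_norm k (truncate k (cf X)) < cc_norm k (truncate k (cf X)) / 2" by simp
  from cc_norm_reach[OF assms this] obtain Y where
    "reach (cc_norm k (truncate k (cf X)) / 2) Y" "truncate k (cf Y) = truncate k (cf X)" .
  from reach_nonneg[OF this(1)] show False using \<open>\<not> 0 \<le> cc_norm k (truncate k (cf X))\<close> by simp
qed

lemma cc_dist_eq:
  assumes "1 \<le> k" "X \<in> sigs"
  shows "cc_dist k (truncate k (cf X)) (truncate k (cf Y)) = cc_norm k (truncate k (cf (tinv X * Y)))"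
  using assms by (simp add: cc_dist_def inv_free_nilpotent_group trunc_mult_cf)

lemma cc_dist_one: "1 \<le> k \<Longrightarrow> cc_dist k tensor_one (truncate k (cf Y)) = cc_norm k (truncate k (cf Y))"
  using cc_dist_eq[of k 1 Y] by (simp add: tensor_one_truncate[of k])

text \<open>The first \<open>n + 1\<close> degrees are those of the signature of a path of length at most \<open>C + 1 / (n + 1)\<close>. These signatures
  converge coefficientwise, as each coefficient is eventually constant, so \<open>reach_closed\<close> applies.\<close>

lemma limit_signature:
  fixes x :: "nat \<Rightarrow> 'n::finite tensors"
  assumes x: "\<And>k. 1 \<le> k \<Longrightarrow> x k \<in> carrier (free_nilpotent_group k)"
    and compat: "\<And>k. 1 \<le> k \<Longrightarrow> truncate k (x (Suc k)) = x k"
    and C: "\<And>k. 1 \<le> k \<Longrightarrow> cc_norm k (x k) \<le> C"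
  obtains X where "reach C X" "\<And>k. 1 \<le> k \<Longrightarrow> truncate k (cf X) = x k"
proof -
  have comp: "truncate m (x n) = x m" if mn: "1 \<le> m" "m \<le> n" for m n
    using mn(2)
  proof (induction n rule: dec_induct)
    case base
    obtain X where "x m = truncate m (cf X)" using x[OF mn(1)] carrier_free_nilpotent[OF mn(1)] by auto
    then show ?case by simp
  next
    case (step n)
    have "truncate m (x (Suc n)) = truncate m (truncate n (x (Suc n)))"
      using step by (auto simp: truncate_def)
    also have "\<dots> = truncate m (x n)" using compat[of n] step mn by simp
    finally show ?case using step by simp
  qed
  define X where "X = Series (\<lambda>w. x (Suc (length w)) w)"
  have X: "truncate k (cf X) = x k" if k: "1 \<le> k" for k
  proof
    fix w
    show "truncate k (cf X) w = x k w"
    proof (cases "length w \<le> k")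
      case True
      have "x (Suc (length w)) w = truncate (Suc (length w)) (x (Suc k)) w"
        using comp[of "Suc (length w)" "Suc k"] True by simp
      also have "\<dots> = truncate k (x (Suc k)) w" using True by (simp add: truncate_def)
      also have "\<dots> = x k w" using comp[of k "Suc k"] k by simp
      finally show ?thesis using True by (simp add: truncate_def X_def)
    next
      case False
      have "x k w = truncate k (x k) w" using comp[of k k] k by simp
      then show ?thesis using False by (simp add: truncate_def)
    qed
  qed
  have C0: "0 \<le> C"
  proof -
    obtain Y where "Y \<in> sigs" "x 1 = truncate 1 (cf Y)" using x[of 1] carrier_free_nilpotent[of 1] by auto
    then show ?thesis using cc_norm_nonneg[of Y 1] C[of 1] by simp
  qed
  have "\<exists>Y. reach (C + 1 / real (Suc n)) Y \<and> truncate (Suc n) (cf Y) = x (Suc n)" for n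
  proof -
    obtain Z where Z: "Z \<in> sigs" "x (Suc n) = truncate (Suc n) (cf Z)"
      using x[of "Suc n"] carrier_free_nilpotent[of "Suc n"] by auto
    have "cc_norm (Suc n) (truncate (Suc n) (cf Z)) < C + 1 / real (Suc n)"
    proof -
      have "0 < 1 / real (Suc n)" by simp
      then show ?thesis using C[of "Suc n"] unfolding Z(2)[symmetric] by linarith
    qed
    from cc_norm_reach[OF Z(1) this] obtain Y where
      "reach (C + 1 / real (Suc n)) Y" "truncate (Suc n) (cf Y) = truncate (Suc n) (cf Z)" .
    then show ?thesis using Z(2) by auto
  qed
  then obtain Y where Y: "\<And>n. reach (C + 1 / real (Suc n)) (Y n)"
    "\<And>n. truncate (Suc n) (cf (Y n)) = x (Suc n)" by metis
  have "conv sequentially Y X"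
    unfolding conv_def
  proof
    fix w
    have "cf (Y n) w = cf X w" if "length w \<le> n" for n
    proof -
      have "truncate (Suc n) (cf (Y n)) w = truncate (Suc n) (cf X) w" using Y(2) X by simp
      then show ?thesis using that by (simp add: truncate_def)
    qed
    then have "\<forall>\<^sub>F n in sequentially. cf (Y n) w = cf X w"
      by (rule eventually_sequentiallyI)
    then show "(\<lambda>n. cf (Y n) w) \<longlonglongrightarrow> cf X w" by (rule tendsto_eventually)
  qed
  moreover have "(\<lambda>n. 1 / real (Suc n)) \<longlonglongrightarrow> 0" by (intro LIMSEQ_Suc lim_const_over_n)
  ultimately have "reach C X"
    using Y(1) C0 by (intro reach_closed[of sequentially C "\<lambda>n. 1 / real (Suc n)" Y]) auto
  then show ?thesis using that X by blast
qed

definition sig_norm :: "'n::finite series \<Rightarrow> real" where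
  "sig_norm X = Inf {L. reach L X}"

lemma sig_norm_le: "reach L X \<Longrightarrow> sig_norm X \<le> L"
  unfolding sig_norm_def by (rule cInf_lower) (auto intro!: bdd_belowI[of _ 0] reach_nonneg)

lemma truncations_inj:
  assumes "\<And>k. 1 \<le> k \<Longrightarrow> truncate k (cf X) = truncate k (cf Y)" shows "X = Y"
proof (rule series_eq_if_cong)
  fix N
  have "order_ge (Suc (Suc N)) (X - Y)" using assms[of "Suc N"] by (simp add: truncate_cong_iff)
  then show "order_ge (Suc N) (X - Y)" by (rule order_ge_mono) simp
qed

text \<open>Applied to the truncations of \<open>X\<close> itself, \<open>limit_signature\<close> produces a path with signature \<open>X\<close> that is no
  longer than the supremum of the Carnot-Caratheodory norms. So the supremum is the least length, and it is attained.\<close>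

lemma sig_norm_props:
  assumes X: "X \<in> (sigs :: 'n::finite series set)"
  shows reach_sig_norm: "reach (sig_norm X) X"
    and sig_norm_SUP: "(SUP k\<in>{1..}. cc_norm k (truncate k (cf X))) = sig_norm X"
    and cc_norm_bdd: "bdd_above ((\<lambda>k. cc_norm k (truncate k (cf X))) ` {1..})"
proof -
  define C where "C = (SUP k\<in>{1..}. cc_norm k (truncate k (cf X)))"
  obtain L where L: "reach L X" using X by (auto simp: sigs_def)
  show bdd: "bdd_above ((\<lambda>k. cc_norm k (truncate k (cf X))) ` {1..})"
    by (rule bdd_aboveI2[of _ _ L]) (rule cc_norm_le[OF L])
  have le: "C \<le> sig_norm X" unfolding sig_norm_def
  proof (rule cInf_greatest)
    fix M assume "M \<in> {L. reach L X}"
    then show "C \<le> M" unfolding C_def by (intro cSUP_least) (auto intro: cc_norm_le)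
  qed (use L in auto)
  obtain Y where Y: "reach C Y" "\<And>k. 1 \<le> k \<Longrightarrow> truncate k (cf Y) = truncate k (cf X)"
  proof (rule limit_signature[of "\<lambda>k. truncate k (cf X)" C])
    show "truncate k (truncate (Suc k) (cf X)) = truncate k (cf X)" for k by (auto simp: truncate_def)
    show "cc_norm k (truncate k (cf X)) \<le> C" if "1 \<le> k" for k
      unfolding C_def using bdd that by (intro cSUP_upper) auto
  qed (use X in \<open>auto simp: carrier_free_nilpotent\<close>)
  have "Y = X" by (rule truncations_inj) (rule Y(2))
  then have *: "reach C X" using Y(1) by simp
  from sig_norm_le[OF this] le have "C = sig_norm X" by simp
  then show "reach (sig_norm X) X" "(SUP k\<in>{1..}. cc_norm k (truncate k (cf X))) = sig_norm X"
    using * by (auto simp: C_def)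
qed

section \<open>The inverse limit\<close>

text \<open>The point of the inverse limit belonging to the signature \<open>X\<close>.\<close>

definition limit_point :: "'n series \<Rightarrow> nat \<Rightarrow> 'n tensors" where
  "limit_point X = truncations (cf X)"

lemma limit_point_apply: "1 \<le> k \<Longrightarrow> limit_point X k = truncate k (cf X)"
  by (simp add: limit_point_def truncations_def)

lemma limit_point_inj: "limit_point X = limit_point Y \<longleftrightarrow> X = Y"
proof
  assume eq: "limit_point X = limit_point Y"
  show "X = Y"
  proof (rule truncations_inj)
    fix k :: nat assume "1 \<le> k"
    then show "truncate k (cf X) = truncate k (cf Y)"
      using fun_cong[OF eq, of k] by (simp only: limit_point_apply)
  qed
qed simp

lemma carrier_inverse_limit_group:
  "carrier inverse_limit_group = limit_point ` (sigs :: 'n::finite series set)"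
proof (intro subset_antisym subsetI)
  fix x :: "nat \<Rightarrow> 'n tensors" assume "x \<in> carrier inverse_limit_group"
  then have x: "x \<in> (\<Pi>\<^sub>E k\<in>{1..}. carrier (free_nilpotent_group k))"
    "\<And>k. 1 \<le> k \<Longrightarrow> truncate k (x (Suc k)) = x k"
    and bdd: "bdd_above ((\<lambda>k. cc_dist k tensor_one (x k)) ` {1..})"
    by (simp_all add: inverse_limit_group_def)
  have xc: "x k \<in> carrier (free_nilpotent_group k)" if "1 \<le> k" for k
    using PiE_mem[OF x(1), of k] that by simp
  define C where "C = (SUP k\<in>{1..}. cc_dist k tensor_one (x k))"
  have "cc_norm k (x k) \<le> C" if k: "1 \<le> k" for k
  proof -
    obtain Y where "x k = truncate k (cf Y)" using xc[OF k] carrier_free_nilpotent[OF k] by auto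
    then have "cc_norm k (x k) = cc_dist k tensor_one (x k)" using cc_dist_one[OF k, of Y] by simp
    also have "\<dots> \<le> C" unfolding C_def using bdd k by (intro cSUP_upper) auto
    finally show ?thesis .
  qed
  from limit_signature[OF xc x(2) this] obtain X where
    X: "reach C X" "\<And>k. 1 \<le> k \<Longrightarrow> truncate k (cf X) = x k" by blast
  have "x = limit_point X"
  proof
    fix k show "x k = limit_point X k"
    proof (cases "1 \<le> k")
      case True
      then show ?thesis using X(2)[of k] by (simp add: limit_point_apply)
    next
      case False
      then have "x k = undefined" by (intro PiE_arb[OF x(1)]) simp
      then show ?thesis using False by (simp add: limit_point_def truncations_def)
    qed
  qed
  then show "x \<in> limit_point ` sigs" using X(1) by (auto simp: sigs_def)
next
  fix x :: "nat \<Rightarrow> 'n tensors" assume "x \<in> limit_point ` sigs"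
  then obtain X where X: "X \<in> sigs" "x = limit_point X" by blast
  have "(\<lambda>k. cc_dist k tensor_one (x k)) ` {1..} = (\<lambda>k. cc_norm k (truncate k (cf X))) ` {1..}"
    using X by (intro image_cong) (auto simp: limit_point_apply cc_dist_one)
  then have "bdd_above ((\<lambda>k. cc_dist k tensor_one (x k)) ` {1..})"
    using cc_norm_bdd[OF X(1)] by simp
  moreover have "truncate k (x (Suc k)) = x k" if "1 \<le> k" for k
    using that by (auto simp: X limit_point_apply truncate_def)
  moreover have "x \<in> (\<Pi>\<^sub>E k\<in>{1..}. carrier (free_nilpotent_group k))"
    unfolding X limit_point_def truncations_def
    by (rule restrict_PiE_iff[THEN iffD2]) (use X(1) in \<open>simp add: carrier_free_nilpotent\<close>)
  ultimately show "x \<in> carrier inverse_limit_group"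
    by (simp add: inverse_limit_group_def)
qed

lemma mult_inverse_limit_group:
  "mult inverse_limit_group (limit_point X) (limit_point Y) = limit_point (X * Y)"
proof
  fix k show "mult inverse_limit_group (limit_point X) (limit_point Y) k = limit_point (X * Y) k"
    by (cases "1 \<le> k")
      (simp_all add: inverse_limit_group_def limit_point_def truncations_def trunc_mult_cf)
qed

lemma truncations_iso:
  "truncations \<in> iso (signature_group :: 'n::finite tensors monoid) inverse_limit_group"
proof -
  have "truncations (cf X) = limit_point X" for X :: "'n series" by (simp add: limit_point_def)
  note tr = this
  have "inj_on truncations (cf ` (sigs :: 'n series set))"
    by (rule inj_onI) (auto simp: tr limit_point_inj)
  moreover have "truncations ` cf ` (sigs :: 'n series set) = limit_point ` sigs"
    unfolding image_image tr ..
  moreover have "truncations \<in> hom (signature_group :: 'n tensors monoid) inverse_limit_group"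
    by (rule homI) (auto simp: carrier_signature_group carrier_inverse_limit_group tr
        signature_group_simps mult_inverse_limit_group)
  ultimately show ?thesis
    by (simp add: iso_def bij_betw_def carrier_signature_group carrier_inverse_limit_group)
qed

lemma group_inverse_limit_group: "group (inverse_limit_group :: (nat \<Rightarrow> 'n::finite tensors) monoid)"
proof (rule group_image_sigs)
  have "truncate k (tensor_one :: 'n tensors) = tensor_one" for k
    by (auto simp: truncate_def tensor_one_def)
  then show "one inverse_limit_group = limit_point (1 :: 'n series)"
    by (simp add: inverse_limit_group_def limit_point_def truncations_def cf_one)
qed (auto simp: carrier_inverse_limit_group mult_inverse_limit_group)

section \<open>The metric of the inverse limit\<close>

definition sig_dist :: "'n::finite series \<Rightarrow> 'n series \<Rightarrow> real" where
  "sig_dist X Y = sig_norm (tinv X * Y)"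

lemma sigs_div: "X \<in> sigs \<Longrightarrow> Y \<in> sigs \<Longrightarrow> tinv X * Y \<in> sigs"
  by (simp add: sigs_mult sigs_tinv)

lemma reach_sig_dist: "X \<in> sigs \<Longrightarrow> Y \<in> sigs \<Longrightarrow> reach (sig_dist X Y) (tinv X * Y)"
  unfolding sig_dist_def by (intro reach_sig_norm sigs_div)

lemma sig_dist_le: "reach L (tinv X * Y) \<Longrightarrow> sig_dist X Y \<le> L"
  unfolding sig_dist_def by (rule sig_norm_le)

lemma sig_dist_nonneg: "X \<in> sigs \<Longrightarrow> Y \<in> sigs \<Longrightarrow> 0 \<le> sig_dist X Y"
  using reach_sig_dist reach_nonneg by blast

lemma sig_dist_triangle:
  assumes "X \<in> sigs" "Y \<in> sigs" "Z \<in> sigs"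
  shows "sig_dist X Z \<le> sig_dist X Y + sig_dist Y Z"
proof (rule sig_dist_le)
  have "reach (sig_dist X Y + sig_dist Y Z) ((tinv X * Y) * (tinv Y * Z))"
    by (intro reach_mult reach_sig_dist assms)
  then show "reach (sig_dist X Y + sig_dist Y Z) (tinv X * Z)"
    using sigs_unip[OF assms(2)] by (simp add: mult.assoc)
qed

lemma sig_dist_commute:
  assumes "X \<in> sigs" "Y \<in> sigs" shows "sig_dist X Y = sig_dist Y X"
proof -
  have *: "sig_dist Y X \<le> sig_dist X Y" if "X \<in> sigs" "Y \<in> sigs" for X Y :: "'a series"
  proof (rule sig_dist_le)
    show "reach (sig_dist X Y) (tinv Y * X)"
      using reach_tinv[OF reach_sig_dist[OF that]] sigs_unip[OF that(1)] sigs_unip[OF that(2)]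
      by (simp add: tinv_mult)
  qed
  show ?thesis using *[OF assms] *[OF assms(2,1)] by simp
qed

lemma sig_dist_zero:
  assumes "X \<in> sigs" "Y \<in> sigs" shows "sig_dist X Y = 0 \<longleftrightarrow> X = Y"
proof
  assume "sig_dist X Y = 0"
  then have "tinv X * Y = 1" using reach_sig_dist[OF assms] reach_0 by simp
  then have "X * (tinv X * Y) = X" by simp
  then show "X = Y" using sigs_unip[OF assms(1)] by simp
next
  assume "X = Y"
  then have "sig_dist X Y \<le> 0"
    using sigs_unip[OF assms(1)] by (intro sig_dist_le) (simp add: reach_one)
  then show "sig_dist X Y = 0" using sig_dist_nonneg[OF assms] by simp
qed

lemma inverse_limit_dist_eq:
  fixes X Y :: "'n::finite series"
  assumes "X \<in> sigs" "Y \<in> sigs"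
  shows "inverse_limit_dist (limit_point X) (limit_point Y) = sig_dist X Y"
proof -
  have "(SUP k\<in>{1..}. cc_dist k (limit_point X k) (limit_point Y k))
      = (SUP k\<in>{1..}. cc_norm k (truncate k (cf (tinv X * Y))))"
    using assms by (intro SUP_cong) (auto simp: limit_point_apply cc_dist_eq)
  also have "\<dots> = sig_dist X Y"
    unfolding sig_dist_def by (rule sig_norm_SUP[OF sigs_div[OF assms]])
  finally show ?thesis
    using assms by (simp add: inverse_limit_dist_def carrier_inverse_limit_group)
qed

interpretation lim: Metric_space "carrier (inverse_limit_group :: (nat \<Rightarrow> 'n::finite tensors) monoid)" inverse_limit_dist
proof
  fix x y z :: "nat \<Rightarrow> 'n tensors"
  show "0 \<le> inverse_limit_dist x y"
  proof (cases "x \<in> carrier inverse_limit_group \<and> y \<in> carrier inverse_limit_group")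
    case True
    then show ?thesis
      by (auto simp: carrier_inverse_limit_group inverse_limit_dist_eq sig_dist_nonneg)
  next
    case False
    then show ?thesis by (auto simp: inverse_limit_dist_def)
  qed
  show "inverse_limit_dist x y = inverse_limit_dist y x"
  proof (cases "x \<in> carrier inverse_limit_group \<and> y \<in> carrier inverse_limit_group")
    case True
    then show ?thesis
      using sig_dist_commute by (auto simp: carrier_inverse_limit_group inverse_limit_dist_eq)
  next
    case False
    then show ?thesis by (auto simp: inverse_limit_dist_def)
  qed
  assume xy: "x \<in> carrier inverse_limit_group" "y \<in> carrier inverse_limit_group"
  then show "(inverse_limit_dist x y = 0) = (x = y)"
    by (auto simp: carrier_inverse_limit_group inverse_limit_dist_eq sig_dist_zero limit_point_inj)
  assume "z \<in> carrier inverse_limit_group"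
  with xy show "inverse_limit_dist x z \<le> inverse_limit_dist x y + inverse_limit_dist y z"
    by (auto simp: carrier_inverse_limit_group inverse_limit_dist_eq sig_dist_triangle)
qed

lemma limit_point_in [simp]: "X \<in> sigs \<Longrightarrow> limit_point X \<in> carrier inverse_limit_group"
  by (simp add: carrier_inverse_limit_group)

text \<open>A Cauchy sequence stays within bounded distance of one of its members, so it has a coefficientwise cluster point by
  compactness, and closedness of \<open>reach\<close> turns the Cauchy condition into convergence.\<close>

theorem inverse_limit_complete:
  "Metric_space.mcomplete (carrier (inverse_limit_group :: (nat \<Rightarrow> 'n::finite tensors) monoid)) inverse_limit_dist"
  unfolding lim.mcomplete_def
proof (intro allI impI)
  fix \<sigma> :: "nat \<Rightarrow> nat \<Rightarrow> 'n tensors" assume \<sigma>: "lim.MCauchy \<sigma>"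
  then have "range \<sigma> \<subseteq> carrier inverse_limit_group" by (simp add: lim.MCauchy_def)
  then have "\<forall>n. \<exists>X\<in>sigs. \<sigma> n = limit_point X"
    unfolding carrier_inverse_limit_group by blast
  then obtain X where X: "\<And>n. X n \<in> sigs" "\<And>n. \<sigma> n = limit_point (X n)" by metis
  have cauchy: "\<exists>N. \<forall>n n'. N \<le> n \<longrightarrow> N \<le> n' \<longrightarrow> sig_dist (X n) (X n') < \<epsilon>" if "0 < \<epsilon>" for \<epsilon>
    using \<sigma> that unfolding lim.MCauchy_def by (simp add: X inverse_limit_dist_eq)
  obtain N0 where N0: "\<And>n n'. N0 \<le> n \<Longrightarrow> N0 \<le> n' \<Longrightarrow> sig_dist (X n) (X n') < 1"
    using cauchy[of 1] by auto
  have "reach 1 (tinv (X N0) * X (N0 + n))" for n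
    using N0[of N0 "N0 + n"] reach_sig_dist[OF X(1) X(1), of N0 "N0 + n"] reach_mono by fastforce
  then obtain F and Z :: "'n series" where F: "F \<noteq> bot" "F \<le> sequentially"
    and Z: "conv F (\<lambda>n. tinv (X N0) * X (N0 + n)) Z"
    using reach_cluster[of sequentially 1 "\<lambda>n. tinv (X N0) * X (N0 + n)"] by auto
  define Y where "Y = X N0 * Z"
  have uX: "unip (X n)" for n using X(1) by (rule sigs_unip)
  have Y: "conv F (\<lambda>n. X (N0 + n)) Y"
    using conv_mult[OF conv_const Z, of "X N0"] uX by (simp add: Y_def)
  have close: "reach \<epsilon> (tinv (X m) * Y)"
    if N: "\<And>n n'. N \<le> n \<Longrightarrow> N \<le> n' \<Longrightarrow> sig_dist (X n) (X n') < \<epsilon>" "0 < \<epsilon>" "N \<le> m" for N m \<epsilon>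
  proof (rule reach_closed[of F \<epsilon> "\<lambda>_. 0" "\<lambda>n. tinv (X m) * X (N0 + n)"])
    have "reach \<epsilon> (tinv (X m) * X (N0 + n))" if "N \<le> n" for n
      using N(1)[of m "N0 + n"] N(3) that reach_mono[OF reach_sig_dist[OF X(1) X(1)], of m "N0 + n"] by simp
    then have "\<forall>\<^sub>F n in sequentially. reach \<epsilon> (tinv (X m) * X (N0 + n))"
      by (rule eventually_sequentiallyI)
    then show "\<forall>\<^sub>F n in F. reach (\<epsilon> + 0) (tinv (X m) * X (N0 + n))"
      using filter_leD[OF F(2)] by simp
    show "conv F (\<lambda>n. tinv (X m) * X (N0 + n)) (tinv (X m) * Y)"
      by (rule conv_mult[OF conv_const Y])
  qed (use F N in auto)
  have "tinv (X N0) * Y \<in> sigs" 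
    using close[OF N0 zero_less_one order_refl] unfolding sigs_def by blast
  from sigs_mult[OF X(1)[of N0] this] have Ys: "Y \<in> sigs" using uX by simp
  have "limitin lim.mtopology \<sigma> (limit_point Y) sequentially"
    unfolding lim.limit_metric_sequentially
  proof (intro conjI allI impI)
    fix \<epsilon> :: real assume \<epsilon>: "0 < \<epsilon>"
    then obtain N where N: "\<And>n n'. N \<le> n \<Longrightarrow> N \<le> n' \<Longrightarrow> sig_dist (X n) (X n') < \<epsilon> / 2"
      using cauchy[of "\<epsilon> / 2"] by auto
    have "sig_dist (X n) Y < \<epsilon>" if "N \<le> n" for n
      using sig_dist_le[OF close[OF N _ that]] \<epsilon> by simp
    then show "\<exists>N. \<forall>n\<ge>N. \<sigma> n \<in> carrier inverse_limit_group \<and> inverse_limit_dist (\<sigma> n) (limit_point Y) < \<epsilon>"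
      using X Ys by (intro exI[of _ N]) (simp add: inverse_limit_dist_eq)
  qed (use Ys in simp)
  then show "\<exists>x. limitin lim.mtopology \<sigma> x sequentially" by blast
qed

section \<open>Geodesics\<close>

lemma curve_sigs: "curve L G \<Longrightarrow> 0 \<le> t \<Longrightarrow> t \<le> L \<Longrightarrow> G t \<in> sigs"
  using curve_reach[of L G 0 t] by (auto simp: sigs_def curve_0)

lemma geodesic_exists:
  assumes X: "X \<in> sigs" and Y: "Y \<in> (sigs :: 'n::finite series set)"
  obtains G where "curve (sig_dist X Y) G" "X * G (sig_dist X Y) = Y"
proof -
  obtain G where "curve (sig_dist X Y) G" "G (sig_dist X Y) = tinv X * Y"
    using reach_sig_dist[OF X Y] by (auto simp: reach_def)
  then show ?thesis using that sigs_unip[OF X] by simp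
qed

lemma curve_sig_dist_le:
  assumes X: "X \<in> (sigs :: 'n::finite series set)" and G: "curve L G" and st: "0 \<le> s" "s \<le> t" "t \<le> L"
  shows "sig_dist (X * G s) (X * G t) \<le> t - s"
proof (rule sig_dist_le)
  have "unip X" "unip (G s)" using sigs_unip[OF X] curve_unip[OF G] st by auto
  then show "reach (t - s) (tinv (X * G s) * (X * G t))"
    using curve_reach[OF G st] by (simp add: tinv_mult mult.assoc)
qed

text \<open>The pieces before, between and after \<open>s\<close> and \<open>t\<close> have distances at most \<open>s\<close>, \<open>t - s\<close> and \<open>L - t\<close>; as these bounds add up to
  the distance \<open>L\<close> of the end points, each of them is attained.\<close>

lemma geodesic_isometry:
  assumes X: "X \<in> (sigs :: 'n::finite series set)" and G: "curve L G" and L: "L = sig_dist X (X * G L)"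
    and st: "0 \<le> s" "s \<le> t" "t \<le> L"
  shows "sig_dist (X * G s) (X * G t) = t - s"
proof (rule antisym)
  show "sig_dist (X * G s) (X * G t) \<le> t - s" by (rule curve_sig_dist_le[OF X G st])
  have m: "X * G r \<in> sigs" if "0 \<le> r" "r \<le> L" for r
    using sigs_mult[OF X curve_sigs[OF G that]] .
  have "X * G s \<in> sigs" "X * G t \<in> sigs" "X * G L \<in> sigs" using m st by auto
  then have "sig_dist X (X * G L) \<le> sig_dist X (X * G s) + sig_dist (X * G s) (X * G t) + sig_dist (X * G t) (X * G L)"
    using sig_dist_triangle[OF X, of "X * G s" "X * G L"] sig_dist_triangle[of "X * G s" "X * G t" "X * G L"]
    by simp
  moreover have "sig_dist X (X * G s) \<le> s"
    using curve_sig_dist_le[OF X G, of 0 s] st by (simp add: curve_0[OF G])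
  moreover have "sig_dist (X * G t) (X * G L) \<le> L - t"
    using curve_sig_dist_le[OF X G, of t L] st by simp
  ultimately show "t - s \<le> sig_dist (X * G s) (X * G t)" using L by simp
qed

lemma geodesic_inj:
  assumes X: "X \<in> (sigs :: 'n::finite series set)" and G: "curve L G" and L: "L = sig_dist X (X * G L)"
  shows "inj_on G {0..L}"
proof -
  have "s = t" if "0 \<le> s" "s \<le> t" "t \<le> L" "G s = G t" for s t
  proof -
    have "X * G s \<in> sigs" using sigs_mult[OF X curve_sigs[OF G]] that by simp
    then show ?thesis using geodesic_isometry[OF assms that(1-3)] sig_dist_zero that(4) by fastforce
  qed
  then show ?thesis by (intro inj_onI) (metis atLeastAtMost_iff linear)
qed

lemma lipschitz_continuous_map:
  fixes f :: "real \<Rightarrow> nat \<Rightarrow> 'n::finite tensors"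
  assumes M: "\<And>t. t \<in> {a..b} \<Longrightarrow> f t \<in> carrier inverse_limit_group"
    and d: "\<And>s t. s \<in> {a..b} \<Longrightarrow> t \<in> {a..b} \<Longrightarrow> inverse_limit_dist (f s) (f t) \<le> K * \<bar>s - t\<bar>"
    and K: "0 \<le> K"
  shows "continuous_map (top_of_set {a..b}) lim.mtopology f"
  unfolding continuous_map_def
proof (intro conjI allI impI)
  show "f \<in> topspace (top_of_set {a..b}) \<rightarrow> topspace lim.mtopology" using M by simp
  fix U :: "(nat \<Rightarrow> 'n tensors) set" assume U: "openin lim.mtopology U"
  show "openin (top_of_set {a..b}) {x \<in> topspace (top_of_set {a..b}). f x \<in> U}"
    unfolding openin_euclidean_subtopology_iff
  proof (intro conjI ballI)
    fix s assume s: "s \<in> {x \<in> topspace (top_of_set {a..b}). f x \<in> U}"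
    then obtain r where r: "0 < r" "lim.mball (f s) r \<subseteq> U"
      using U unfolding lim.openin_mtopology by blast
    have Kr: "0 < r / (K + 1)" using r K by simp
    have "f t \<in> U" if "t \<in> {a..b}" "dist t s < r / (K + 1)" for t
    proof -
      have "inverse_limit_dist (f s) (f t) \<le> K * \<bar>s - t\<bar>" using d s that by simp
      also have "\<dots> \<le> (K + 1) * \<bar>s - t\<bar>" by (intro mult_right_mono) auto
      also have "\<dots> < r" using that(2) K by (simp add: dist_real_def abs_minus_commute pos_less_divide_eq mult.commute)
      finally show ?thesis using r(2) M s that by (auto simp: lim.in_mball)
    qed
    then show "\<exists>e>0. \<forall>x'\<in>{a..b}. dist x' s < e \<longrightarrow> x' \<in> {x \<in> topspace (top_of_set {a..b}). f x \<in> U}"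
      using Kr by (intro exI[of _ "r / (K + 1)"]) auto
  qed auto
qed

lemma geodesic_limit_dist:
  assumes X: "X \<in> (sigs :: 'n::finite series set)" and G: "curve L G" and L: "L = sig_dist X (X * G L)"
    and s: "s \<in> {0..L}" and t: "t \<in> {0..L}"
  shows "inverse_limit_dist (limit_point (X * G s)) (limit_point (X * G t)) = \<bar>s - t\<bar>"
proof -
  have m: "X * G s \<in> sigs" "X * G t \<in> sigs" using sigs_mult[OF X curve_sigs[OF G]] s t by auto
  show ?thesis
  proof (cases "s \<le> t")
    case True
    then show ?thesis using geodesic_isometry[OF X G L, of s t] s t m by (simp add: inverse_limit_dist_eq)
  next
    case False
    then show ?thesis using geodesic_isometry[OF X G L, of t s] s t m sig_dist_commute[OF m]
      by (simp add: inverse_limit_dist_eq)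
  qed
qed

theorem inverse_limit_geodesic:
  "geodesic_space (carrier (inverse_limit_group :: (nat \<Rightarrow> 'n::finite tensors) monoid)) inverse_limit_dist"
  unfolding geodesic_space_def
proof (intro ballI)
  fix x y :: "nat \<Rightarrow> 'n tensors"
  assume "x \<in> carrier inverse_limit_group" "y \<in> carrier inverse_limit_group"
  then obtain X Y where XY: "X \<in> sigs" "Y \<in> sigs" "x = limit_point X" "y = limit_point Y"
    by (auto simp: carrier_inverse_limit_group)
  obtain G where G: "curve (sig_dist X Y) G" "X * G (sig_dist X Y) = Y"
    using geodesic_exists[OF XY(1,2)] .
  define L where "L = sig_dist X Y"
  have L: "0 \<le> L" "L = sig_dist X (X * G L)" "curve L G" "X * G L = Y"
    using sig_dist_nonneg[OF XY(1,2)] G by (auto simp: L_def)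
  define c where "c t = limit_point (X * G t)" for t
  have dc: "inverse_limit_dist (c s) (c t) = \<bar>s - t\<bar>" if "s \<in> {0..L}" "t \<in> {0..L}" for s t
    unfolding c_def using geodesic_limit_dist[OF XY(1) L(3,2) that] .
  have "continuous_map (top_of_set {0..L}) lim.mtopology c"
  proof (rule lipschitz_continuous_map[of _ _ _ 1])
    show "c t \<in> carrier inverse_limit_group" if "t \<in> {0..L}" for t
      using sigs_mult[OF XY(1) curve_sigs[OF L(3)]] that by (simp add: c_def)
  qed (use dc in auto)
  moreover have "c 0 = x" "c L = y" using L XY curve_0[OF L(3)] by (auto simp: c_def)
  moreover have "path_length inverse_limit_dist 0 L c = ennreal (inverse_limit_dist x y)"
  proof -
    have dxy: "inverse_limit_dist x y = L" using XY by (simp add: inverse_limit_dist_eq L_def)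
    have "path_length inverse_limit_dist 0 L c \<le> ennreal (L - 0)"
      by (rule path_length_le[of inverse_limit_dist 0 L c "\<lambda>t. t"]) (use L dc in auto)
    moreover have "ennreal L \<le> path_length inverse_limit_dist 0 L c"
    proof -
      have "ennreal (variation_sum inverse_limit_dist c [0, L]) \<le> path_length inverse_limit_dist 0 L c"
        unfolding path_length_eq[OF lim.nonneg] using L by (intro SUP_upper) auto
      then show ?thesis using dc[of 0 L] L by simp
    qed
    ultimately show ?thesis unfolding dxy by simp
  qed
  ultimately show "\<exists>a b \<gamma>. a \<le> b \<and> continuous_map (top_of_set {a..b}) lim.mtopology \<gamma> \<and>
      \<gamma> a = x \<and> \<gamma> b = y \<and> path_length inverse_limit_dist a b \<gamma> = ennreal (inverse_limit_dist x y)"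
    using L(1) by blast
qed

section \<open>Arcs\<close>

text \<open>Joined by a curve that stays within distance \<open>\<epsilon>\<close> of \<open>A\<close>.\<close>

definition joined_near :: "'n::finite series set \<Rightarrow> real \<Rightarrow> 'n series \<Rightarrow> 'n series \<Rightarrow> bool" where
  "joined_near A \<epsilon> X Y \<longleftrightarrow> (\<exists>L G. 0 \<le> L \<and> curve L G \<and> X * G L = Y \<and>
     (\<forall>r\<in>{0..L}. \<exists>Z\<in>A. sig_dist Z (X * G r) < \<epsilon>))"

lemma joined_near_sym:
  assumes "unip X" "joined_near A \<epsilon> X Y" shows "joined_near A \<epsilon> Y X"
proof -
  from assms(2) obtain L G where L: "0 \<le> L" and G: "curve L G" "X * G L = Y"
    and near: "\<And>r. r \<in> {0..L} \<Longrightarrow> \<exists>Z\<in>A. sig_dist Z (X * G r) < \<epsilon>"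
    unfolding joined_near_def by blast
  have u: "unip (G L)" using L by (intro curve_unip[OF G(1)]) auto
  have cancel: "Y * (tinv (G L) * Z) = X * Z" for Z
    using u assms(1) by (simp add: G(2)[symmetric] mult.assoc)
  have "\<exists>Z\<in>A. sig_dist Z (Y * (tinv (G L) * G (L - r))) < \<epsilon>" if "r \<in> {0..L}" for r
    using near[of "L - r"] that unfolding cancel by auto
  then show ?thesis unfolding joined_near_def
    using L curve_reverse[OF G(1) L] cancel[of 1] curve_0[OF G(1)]
    by (intro exI[of _ L] exI[of _ "\<lambda>t. tinv (G L) * G (L - t)"]) auto
qed

lemma joined_near_trans:
  assumes "joined_near A \<epsilon> X Y" "joined_near A \<epsilon> Y W" shows "joined_near A \<epsilon> X W"
proof -
  from assms(1) obtain L G where L: "0 \<le> L" and G: "curve L G" "X * G L = Y"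
    and Gn: "\<And>r. r \<in> {0..L} \<Longrightarrow> \<exists>Z\<in>A. sig_dist Z (X * G r) < \<epsilon>"
    unfolding joined_near_def by blast
  from assms(2) obtain M H where M: "0 \<le> M" and H: "curve M H" "Y * H M = W"
    and Hn: "\<And>r. r \<in> {0..M} \<Longrightarrow> \<exists>Z\<in>A. sig_dist Z (Y * H r) < \<epsilon>"
    unfolding joined_near_def by blast
  have "\<exists>Z\<in>A. sig_dist Z (X * join_at L G H r) < \<epsilon>" if r: "r \<in> {0..L + M}" for r
  proof (cases "r \<le> L")
    case True
    then show ?thesis using Gn[of r] r by (simp add: join_at_def)
  next
    case False
    then have "X * join_at L G H r = Y * H (r - L)"
      by (simp add: join_at_def G(2)[symmetric] mult.assoc)
    then show ?thesis using Hn[of "r - L"] r False by simp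
  qed
  moreover have "X * join_at L G H (L + M) = W"
    using join_end[OF H(1) M, of L G] G(2) H(2) by (simp add: mult.assoc[symmetric])
  ultimately show ?thesis unfolding joined_near_def
    using curve_join[OF G(1) H(1) L] L M by (intro exI[of _ "L + M"] exI[of _ "join_at L G H"]) auto
qed

text \<open>A path in a geodesic space need not be rectifiable, but arbitrarily close to it there are rectifiable
  curves with the same end points: nearby points of the path are joined by short geodesics, and connectedness of the
  interval joins all of them. Each of these curves passes through every point of the geodesic, and the image of the path is closed.\<close>

lemma geodesic_subset_path:
  fixes f :: "real \<Rightarrow> nat \<Rightarrow> 'n::finite tensors"
  assumes f: "continuous_map (top_of_set {0..1}) lim.mtopology f"
    and ends: "f 0 = limit_point X" "f 1 = limit_point (X * G L)"
    and X: "X \<in> sigs" and G: "curve L G" and L: "L = sig_dist X (X * G L)" "0 \<le> L"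
  shows "(\<lambda>r. limit_point (X * G r)) ` {0..L} \<subseteq> f ` {0..1}"
proof (rule image_subsetI, rule ccontr)
  fix r assume r: "r \<in> {0..L}" and notin: "limit_point (X * G r) \<notin> f ` {0..1}"
  have m: "X * G t \<in> sigs" if "t \<in> {0..L}" for t
    using sigs_mult[OF X curve_sigs[OF G]] that by simp
  have "compactin lim.mtopology (f ` {0..1})"
    by (rule image_compactin[OF _ f]) (simp add: compactin_subtopology)
  then have "closedin lim.mtopology (f ` {0..1})"
    by (rule compactin_imp_closedin[OF lim.Hausdorff_space_mtopology])
  then obtain \<epsilon> where \<epsilon>: "0 < \<epsilon>" "disjnt (f ` {0..1}) (lim.mball (limit_point (X * G r)) \<epsilon>)"
    using notin m[OF r] unfolding lim.closedin_metric by (metis DiffI limit_point_in)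
  have fM: "f t \<in> carrier inverse_limit_group" if "t \<in> {0..1}" for t
    using continuous_map_image_subset_topspace[OF f] that by auto
  then have "\<forall>t\<in>{0..1}. \<exists>Z\<in>sigs. f t = limit_point Z"
    unfolding carrier_inverse_limit_group by blast
  then obtain h where h: "\<And>t. t \<in> {0..1} \<Longrightarrow> h t \<in> sigs" "\<And>t. t \<in> {0..1} \<Longrightarrow> f t = limit_point (h t)"
    by metis
  have h01: "h 0 = X" "h 1 = X * G L"
    using h(2)[of 0] h(2)[of 1] ends by (auto simp: limit_point_inj)
  define A where "A = h ` {0..1}"
  have "joined_near A \<epsilon> (h 0) (h 1)"
  proof (rule connected_equivalence_relation[of "{0..1::real}" 0 1 "\<lambda>s t. joined_near A \<epsilon> (h s) (h t)"])
    show "joined_near A \<epsilon> (h t) (h s)" if "joined_near A \<epsilon> (h s) (h t)" "s \<in> {0..1}" "t \<in> {0..1}" for s t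
      using sigs_unip[OF h(1)[OF that(2)]] that(1) by (rule joined_near_sym)
    show "joined_near A \<epsilon> (h s) (h u)"
      if "joined_near A \<epsilon> (h s) (h t)" "joined_near A \<epsilon> (h t) (h u)" for s t u
      using that by (rule joined_near_trans)
    fix s :: real assume s: "s \<in> {0..1}"
    define T where "T = {t \<in> topspace (top_of_set {0..1}). f t \<in> lim.mball (f s) \<epsilon>}"
    have "openin (top_of_set {0..1}) T"
      unfolding T_def by (rule openin_continuous_map_preimage[OF f]) simp
    moreover have "s \<in> T" using s fM[OF s] \<epsilon>(1) by (simp add: T_def)
    moreover have "joined_near A \<epsilon> (h s) (h t)" if "t \<in> T" for t
    proof -
      have t: "t \<in> {0..1}" "inverse_limit_dist (f s) (f t) < \<epsilon>" using that by (auto simp: T_def)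
      have d: "sig_dist (h s) (h t) < \<epsilon>" using t h s by (simp add: inverse_limit_dist_eq)
      obtain H where H: "curve (sig_dist (h s) (h t)) H" "h s * H (sig_dist (h s) (h t)) = h t"
        using geodesic_exists[OF h(1)[OF s] h(1)[OF t(1)]] .
      have "sig_dist (h s) (h s * H u) < \<epsilon>" if "u \<in> {0..sig_dist (h s) (h t)}" for u
        using curve_sig_dist_le[OF h(1)[OF s] H(1), of 0 u] that d by (simp add: curve_0[OF H(1)])
      then show ?thesis unfolding joined_near_def
        using H sig_dist_nonneg[OF h(1)[OF s] h(1)[OF t(1)]] s by (force simp: A_def)
    qed
    ultimately show "\<exists>T. openin (top_of_set {0..1}) T \<and> s \<in> T \<and> (\<forall>t\<in>T. joined_near A \<epsilon> (h s) (h t))"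
      by blast
  qed auto
  then obtain L' G' where L': "0 \<le> L'" and G': "curve L' G'" "X * G' L' = X * G L"
    and near: "\<And>r. r \<in> {0..L'} \<Longrightarrow> \<exists>Z\<in>A. sig_dist Z (X * G' r) < \<epsilon>"
    unfolding joined_near_def h01 by blast
  have "G' L' = G L" using arg_cong[OF G'(2), of "\<lambda>Z. tinv X * Z"] sigs_unip[OF X] by simp
  from curve_image_subset[OF G'(1) L' G L(2) this geodesic_inj[OF X G L(1)]] r
  obtain r' where r': "r' \<in> {0..L'}" "G r = G' r'" by blast
  from near[OF r'(1)] obtain t where t: "t \<in> {0..1}" "sig_dist (h t) (X * G r) < \<epsilon>"
    unfolding A_def r'(2) by auto
  have "inverse_limit_dist (limit_point (X * G r)) (f t) < \<epsilon>"
    using t h m[OF r] sig_dist_commute[of "X * G r" "h t"] by (simp add: inverse_limit_dist_eq)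
  then have "f t \<in> lim.mball (limit_point (X * G r)) \<epsilon>" using fM[OF t(1)] m[OF r] by simp
  then show False using \<epsilon>(2) t(1) by (auto simp: disjnt_iff)
qed

text \<open>No proper connected subset of an arc contains both end points.\<close>

lemma geodesic_arc_unique:
  fixes f :: "real \<Rightarrow> nat \<Rightarrow> 'n::finite tensors"
  assumes f: "homeomorphic_map (top_of_set {0..1}) (subtopology lim.mtopology A) f" "A \<subseteq> carrier inverse_limit_group"
    and B: "B \<subseteq> A" "connectedin lim.mtopology B" "f 0 \<in> B" "f 1 \<in> B"
  shows "A = B"
proof -
  obtain g where g: "homeomorphic_maps (top_of_set {0..1}) (subtopology lim.mtopology A) f g"
    using f(1) by (auto simp: homeomorphic_map_maps)
  then have gc: "continuous_map (subtopology lim.mtopology A) (top_of_set {0..1}) g"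
    and gf: "\<And>t. t \<in> {0..1} \<Longrightarrow> g (f t) = t" and fga: "\<And>a. a \<in> A \<Longrightarrow> f (g a) = a"
    using f(2) by (auto simp: homeomorphic_maps_def)
  have "g ` A \<subseteq> {0..1}"
    using continuous_map_image_subset_topspace[OF gc] f(2) by (simp add: Int_absorb1)
  then have fg: "f (g a) = a \<and> g a \<in> {0..1}" if "a \<in> A" for a using fga that by blast
  have "connectedin (subtopology lim.mtopology A) B"
    using B by (simp add: connectedin_subtopology)
  from connectedin_continuous_map_image[OF gc this] have "connected (g ` B)"
    by (simp add: connectedin_subtopology connectedin_iff_connected)
  moreover have "0 \<in> g ` B" "1 \<in> g ` B" using gf[of 0] gf[of 1] B by force+
  ultimately have "{0..1} \<subseteq> g ` B" using connected_contains_Icc by blast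
  then have "a \<in> B" if "a \<in> A" for a using fg[OF that] fg B(1) by (metis image_iff subsetD)
  then show ?thesis using B(1) by blast
qed

theorem inverse_limit_uniquely_arcwise_connected:
  "uniquely_arcwise_connected (lim.mtopology :: (nat \<Rightarrow> 'n::finite tensors) topology)"
  unfolding uniquely_arcwise_connected_def
proof (intro ballI impI)
  fix x y :: "nat \<Rightarrow> 'n tensors"
  assume "x \<in> topspace lim.mtopology" "y \<in> topspace lim.mtopology" and ne: "x \<noteq> y"
  then have "x \<in> carrier inverse_limit_group" "y \<in> carrier inverse_limit_group" by simp_all
  then obtain X Y where XY: "X \<in> sigs" "Y \<in> sigs" "x = limit_point X" "y = limit_point Y"
    by (auto simp: carrier_inverse_limit_group)
  obtain G where G: "curve (sig_dist X Y) G" "X * G (sig_dist X Y) = Y"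
    using geodesic_exists[OF XY(1,2)] .
  define L where "L = sig_dist X Y"
  have L: "0 < L" "L = sig_dist X (X * G L)" "curve L G" "X * G L = Y"
    using sig_dist_nonneg[OF XY(1,2)] sig_dist_zero[OF XY(1,2)] ne XY G by (auto simp: L_def less_le)
  define c where "c t = limit_point (X * G (L * t))" for t
  define B where "B = (\<lambda>r. limit_point (X * G r)) ` {0..L}"
  have scale: "L * t \<in> {0..L}" if "t \<in> {0..1}" for t using that L(1) by (simp add: mult_left_le)
  have Bc: "B = c ` {0..1}"
  proof -
    have "{0..L} = (\<lambda>t. L * t) ` {0..1}"
      using L(1) by (simp add: image_mult_atLeastAtMost)
    then show ?thesis unfolding B_def c_def by (metis image_image)
  qed
  have BM: "B \<subseteq> carrier inverse_limit_group"
    using sigs_mult[OF XY(1) curve_sigs[OF L(3)]] by (auto simp: B_def)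
  have dc: "inverse_limit_dist (c s) (c t) = L * \<bar>s - t\<bar>" if "s \<in> {0..1}" "t \<in> {0..1}" for s t
    using geodesic_limit_dist[OF XY(1) L(3,2) scale[OF that(1)] scale[OF that(2)]] L(1)
    by (simp add: c_def abs_mult flip: right_diff_distrib)
  have cont: "continuous_map (top_of_set {0..1}) lim.mtopology c"
    by (rule lipschitz_continuous_map[of _ _ _ L]) (use dc BM Bc L in auto)
  have injc: "inj_on c {0..1}"
  proof (rule inj_onI)
    fix s t :: real assume st: "s \<in> {0..1}" "t \<in> {0..1}" "c s = c t"
    have "c t \<in> carrier inverse_limit_group" using st BM Bc by auto
    then have "inverse_limit_dist (c s) (c t) = 0" using st(3) by simp
    then show "s = t" using dc[OF st(1,2)] L(1) by simp
  qed
  have "homeomorphic_map (top_of_set {0..1}) (subtopology lim.mtopology B) c"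
  proof (rule continuous_imp_homeomorphic_map)
    show "continuous_map (top_of_set {0..1}) (subtopology lim.mtopology B) c"
      using cont Bc by (simp add: continuous_map_in_subtopology)
    show "compact_space (top_of_set {0..1::real})" by (simp add: compact_space_subtopology)
    show "Hausdorff_space (subtopology lim.mtopology B)"
      by (intro Hausdorff_space_subtopology lim.Hausdorff_space_mtopology)
    show "c ` topspace (top_of_set {0..1}) = topspace (subtopology lim.mtopology B)"
      using BM Bc by (simp add: Int_absorb1)
  qed (use injc in simp)
  moreover have c01: "c 0 = x" "c 1 = y" using XY L curve_0[OF L(3)] by (auto simp: c_def)
  ultimately have arcB: "arc_with_ends lim.mtopology x y B"
    unfolding arc_with_ends_def using BM by auto
  show "\<exists>!A. arc_with_ends lim.mtopology x y A"
  proof (rule ex1I[of _ B])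
    show "arc_with_ends lim.mtopology x y B" by (rule arcB)
    fix A assume "arc_with_ends lim.mtopology x y A"
    then obtain f where A: "A \<subseteq> carrier inverse_limit_group"
      and f: "homeomorphic_map (top_of_set {0..1::real}) (subtopology lim.mtopology A) f" "f 0 = x" "f 1 = y"
      by (auto simp: arc_with_ends_def)
    have fc: "continuous_map (top_of_set {0..1}) lim.mtopology f"
      using homeomorphic_imp_continuous_map[OF f(1)] continuous_map_in_subtopology by blast
    have fA: "f ` {0..1} = A"
      using homeomorphic_imp_surjective_map[OF f(1)] A by (simp add: Int_absorb1)
    have "B \<subseteq> f ` {0..1}" unfolding B_def
      by (rule geodesic_subset_path[OF fc _ _ XY(1) L(3,2)]) (use f XY L in auto)
    then have BA: "B \<subseteq> A" unfolding fA .
    have conn: "connectedin lim.mtopology B"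
    proof -
      have "connectedin (top_of_set {0..1::real}) {0..1}"
        by (simp add: connectedin_subtopology connectedin_iff_connected)
      from connectedin_continuous_map_image[OF cont this] show ?thesis by (simp add: Bc)
    qed
    have "c 0 \<in> B" "c 1 \<in> B" unfolding Bc by (intro imageI; simp)+
    then have "f 0 \<in> B" "f 1 \<in> B" using f(2,3) c01 by simp_all
    then show "A = B" by (rule geodesic_arc_unique[OF f(1) A BA conn])
  qed
qed

theorem theorem4p2:
  shows "group (signature_group :: 'n::finite tensors monoid) \<and>
    group (inverse_limit_group :: (nat \<Rightarrow> 'n tensors) monoid) \<and>
    truncations \<in> iso (signature_group :: 'n tensors monoid) inverse_limit_group \<and>
    metric_tree (carrier (inverse_limit_group :: (nat \<Rightarrow> 'n tensors) monoid)) inverse_limit_dist \<and>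
    Metric_space.mcomplete (carrier (inverse_limit_group :: (nat \<Rightarrow> 'n tensors) monoid)) inverse_limit_dist"
  unfolding metric_tree_def
  by (intro conjI group_signature_group group_inverse_limit_group truncations_iso
      lim.Metric_space_axioms inverse_limit_geodesic inverse_limit_uniquely_arcwise_connected
      inverse_limit_complete)

end
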